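(* Let $n$ be an odd positive integer. The types of the hull of a cyclic code of length $n$ over $R=\mathbb{Z}_4+v\mathbb{Z}_4$, $v^2=v$, are $4^{k_1}2^{k_2}$, where $$k_1=\sum_{j\mid n,\,j\notin N_2}\mathrm{ord}_j(2)\,a_{1j}+\sum_{j\mid n,\,j\notin N_2}\mathrm{ord}_j(2)\,a_{2j},$$ $$k_2=\sum_{j\mid n,\,j\in N_2}\mathrm{ord}_j(2)\,b_{1j}+\sum_{j\mid n,\,j\in N_2}\mathrm{ord}_j(2)\,b_{2j}+\sum_{j\mid n,\,j\notin N_2}\mathrm{ord}_j(2)\,c_{1j}+\sum_{j\mid n,\,j\notin N_2}\mathrm{ord}_j(2)\,c_{2j},$$ with $0\le a_{1j},a_{2j}\le\beta(j)$, $0\le b_{1j},b_{2j}\le\gamma(j)$, $0\le c_{1j}\le 2(\beta(j)-a_{1j})$ and $0\le c_{2j}\le 2(\beta(j)-a_{2j})$.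
   Context: $R=\mathbb{Z}_4[v]/\langle v^2-v\rangle=\mathbb{Z}_4+v\mathbb{Z}_4$. A linear code of length $n$ over $R$ is an $R$-submodule of $R^n$; it is cyclic if closed under the cyclic shift of coordinates. For $h,k\in R^n$, $h\cdot k=\sum_i h_ik_i$; $C^\perp=\{h\in R^n:h\cdot k=0\ \forall k\in C\}$ and $\mathrm{Hull}(C)=C\cap C^\perp$. A code is of type $4^{k_1}2^{k_2}$ if as a $\mathbb{Z}_4$-module it is isomorphic to $\mathbb{Z}_4^{k_1}\oplus\mathbb{Z}_2^{k_2}$. $\mathrm{ord}_j(2)$ is the multiplicative order of $2$ modulo $j$ (with $\mathrm{ord}_1(2)=1$). $N_2=\{l\ge1: l \text{ divides } 2^i+1 \text{ for some positive integer } i\}$. With $\phi$ Euler's function, $\gamma(j)=\phi(j)/\mathrm{ord}_j(2)$ and $\beta(j)=\phi(j)/(2\,\mathrm{ord}_j(2))$ (the latter used for $j\notin N_2$, where it is an integer). The parameters $a_{1j},a_{2j},b_{1j},b_{2j},c_{1j},c_{2j}$ are integers. *)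

theory Defs
  imports
    "HOL-Library.Numeral_Type"
    "HOL-Computational_Algebra.Polynomial"
    "HOL-Number_Theory.Number_Theory"
    "Jordan_Normal_Form.VS_Connect"
begin

text \<open>The numeral types \<open>4\<close> and \<open>2\<close> of \<open>HOL-Library.Numeral_Type\<close> are the rings
  \<open>Z_4\<close> and \<open>Z_2\<close>. The ring \<open>Z_4[v]/(v^2 - v)\<close> is the quotient of the univariate polynomials over
  \<open>Z_4\<close> by congruence modulo \<open>v^2 - v\<close>, the polynomial \<open>[:0, -1, 1:]\<close>.\<close>

quotient_type z4v = "4 poly" / "\<lambda>p q. [:0, -1, 1:] dvd p - q"
proof (rule equivpI)
  show "reflp (\<lambda>p q :: 4 poly. [:0, -1, 1:] dvd p - q)"
    by (rule reflpI) simp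
  show "symp (\<lambda>p q :: 4 poly. [:0, -1, 1:] dvd p - q)"
    by (rule sympI) (metis dvd_minus_iff minus_diff_eq)
  show "transp (\<lambda>p q :: 4 poly. [:0, -1, 1:] dvd p - q)"
  proof (rule transpI)
    fix p q r :: "4 poly"
    assume "[:0, -1, 1:] dvd p - q" "[:0, -1, 1:] dvd q - r"
    then have "[:0, -1, 1:] dvd (p - q) + (q - r)" by (rule dvd_add)
    then show "[:0, -1, 1:] dvd p - r" by simp
  qed
qed

instantiation z4v :: comm_ring_1
begin

lift_definition zero_z4v :: z4v is 0 .

lift_definition one_z4v :: z4v is 1 .

lift_definition plus_z4v :: "z4v \<Rightarrow> z4v \<Rightarrow> z4v" is "(+)"
proof -
  fix p p' q q' :: "4 poly"
  assume "[:0, -1, 1:] dvd p - p'" "[:0, -1, 1:] dvd q - q'"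
  then have "[:0, -1, 1:] dvd (p - p') + (q - q')" by (rule dvd_add)
  then show "[:0, -1, 1:] dvd (p + q) - (p' + q')" by (simp add: algebra_simps)
qed

lift_definition uminus_z4v :: "z4v \<Rightarrow> z4v" is uminus
proof -
  fix p p' :: "4 poly"
  assume "[:0, -1, 1:] dvd p - p'"
  then have "[:0, -1, 1:] dvd - (p - p')" by (simp only: dvd_minus_iff)
  then show "[:0, -1, 1:] dvd - p - - p'" by simp
qed

lift_definition minus_z4v :: "z4v \<Rightarrow> z4v \<Rightarrow> z4v" is "(-)"
proof -
  fix p p' q q' :: "4 poly"
  assume "[:0, -1, 1:] dvd p - p'" "[:0, -1, 1:] dvd q - q'"
  then have "[:0, -1, 1:] dvd (p - p') - (q - q')" by (rule dvd_diff)
  then show "[:0, -1, 1:] dvd (p - q) - (p' - q')" by (simp add: algebra_simps)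
qed

lift_definition times_z4v :: "z4v \<Rightarrow> z4v \<Rightarrow> z4v" is "(*)"
proof -
  fix p p' q q' :: "4 poly"
  assume "[:0, -1, 1:] dvd p - p'" "[:0, -1, 1:] dvd q - q'"
  then have "[:0, -1, 1:] dvd q * (p - p') + p' * (q - q')"
    by (intro dvd_add dvd_mult)
  then show "[:0, -1, 1:] dvd p * q - p' * q'" by (simp add: algebra_simps)
qed

instance
proof
  fix a b c :: z4v
  show "a + b + c = a + (b + c)" by transfer (simp add: algebra_simps)
  show "a + b = b + a" by transfer (simp add: algebra_simps)
  show "0 + a = a" by transfer simp
  show "- a + a = 0" by transfer simp
  show "a - b = a + - b" by transfer simp
  show "a * b * c = a * (b * c)" by transfer (simp add: algebra_simps)
  show "a * b = b * a" by transfer (simp add: algebra_simps)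
  show "1 * a = a" by transfer simp
  show "(a + b) * c = a * c + b * c" by transfer (simp add: algebra_simps)
  show "(0 :: z4v) \<noteq> 1"
  proof (transfer, rule notI)
    assume "[:0, -1, 1:] dvd 0 - (1 :: 4 poly)"
    then obtain r :: "4 poly" where "0 - 1 = [:0, -1, 1:] * r" by (rule dvdE)
    then have "poly (0 - 1) 0 = poly ([:0, -1, 1:] * r) 0" by simp
    then show False by simp
  qed
qed

end

lift_definition const_z4v :: "4 \<Rightarrow> z4v" is "\<lambda>a. [:a:]" .

lift_definition v_z4v :: z4v is "[:0, 1:]" .

lemma v_z4v_idem: "v_z4v * v_z4v = v_z4v"
  by transfer simp

text \<open>\<open>R = Z_4 + v Z_4\<close>, every element having a unique such expression.\<close>

lemma z4v_ex1: "\<exists>!(a, b). x = const_z4v a + v_z4v * const_z4v b"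
proof -
  have ex: "\<exists>a b. x = const_z4v a + v_z4v * const_z4v b"
  proof transfer
    fix p :: "4 poly"
    show "\<exists>a b. [:0, -1, 1:] dvd p - ([:a:] + [:0, 1:] * [:b:])"
    proof (induction p)
      case 0
      show ?case by (intro exI[of _ 0]) simp
    next
      case (pCons c p)
      then obtain a b r where r: "p - ([:a:] + [:0, 1:] * [:b:]) = [:0, -1, 1:] * r"
        by (auto elim: dvdE)
      then have "p = [:a, b:] + [:0, -1, 1:] * r" by (simp add: algebra_simps)
      then have "pCons c p = [:c, a, b:] + [:0, -1, 1:] * ([:0, 1:] * r)"
        by (simp add: algebra_simps)
      also have "[:c, a, b:] = [:c, a + b:] + [:0, -1, 1:] * [:b:]" by simp
      finally have "pCons c p - ([:c:] + [:0, 1:] * [:a + b:])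
          = [:0, -1, 1:] * ([:b:] + [:0, 1:] * r)"
        by (simp add: algebra_simps)
      then show ?case by (metis dvd_triv_left)
    qed
  qed
  have uniq: "a = a' \<and> b = b'"
    if "const_z4v a + v_z4v * const_z4v b = const_z4v a' + v_z4v * const_z4v b'" for a b a' b'
    using that
  proof transfer
    fix a b a' b' :: 4
    assume "[:0, -1, 1:] dvd [:a:] + [:0, 1:] * [:b:] - ([:a':] + [:0, 1:] * [:b':])"
    then obtain r :: "4 poly"
      where r: "[:a:] + [:0, 1:] * [:b:] - ([:a':] + [:0, 1:] * [:b':]) = [:0, -1, 1:] * r"
      by (rule dvdE)
    from arg_cong[OF r, of "\<lambda>p. poly p 0"] have "a = a'" by simp
    moreover from arg_cong[OF r, of "\<lambda>p. poly p 1"] have "a + b = a' + b'" by (simp add: algebra_simps)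
    ultimately show "a = a' \<and> b = b'" by simp
  qed
  from ex obtain a b where "x = const_z4v a + v_z4v * const_z4v b" by blast
  then show ?thesis
    by (intro ex1I[of _ "(a, b)"]) (auto dest: uniq)
qed

definition linear_code :: "nat \<Rightarrow> z4v vec set \<Rightarrow> bool" where
  "linear_code n C \<longleftrightarrow> submodule class_ring C (module_vec TYPE(z4v) n)"

text \<open>The map \<open>(c_0, c_1, ..., c_{n-1}) \<mapsto> (c_{n-1}, c_0, ..., c_{n-2})\<close>; the summand \<open>n\<close>
  avoids truncated subtraction at \<open>i = 0\<close>.\<close>

definition cyclic_shift :: "nat \<Rightarrow> 'a vec \<Rightarrow> 'a vec" where
  "cyclic_shift n c = vec n (\<lambda>i. c $ ((i + n - 1) mod n))"

definition cyclic_code :: "nat \<Rightarrow> z4v vec set \<Rightarrow> bool" where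
  "cyclic_code n C \<longleftrightarrow> linear_code n C \<and> (\<forall>c\<in>C. cyclic_shift n c \<in> C)"

definition dual_code :: "nat \<Rightarrow> z4v vec set \<Rightarrow> z4v vec set" where
  "dual_code n C = {h \<in> carrier_vec n. \<forall>k\<in>C. h \<bullet> k = 0}"

definition Hull :: "nat \<Rightarrow> z4v vec set \<Rightarrow> z4v vec set" where
  "Hull n C = C \<inter> dual_code n C"

text \<open>A code as a \<open>Z_4\<close>-module, \<open>Z_4\<close> acting through the constants of \<open>R\<close>.
  As in \<^const>\<open>module_vec\<close>, the record fields \<open>mult\<close> and \<open>one\<close> play no role in a module.\<close>

definition code_z4_module :: "nat \<Rightarrow> z4v vec set \<Rightarrow> (4, z4v vec) module" where
  "code_z4_module n C = \<lparr>carrier = C, mult = undefined, one = undefined,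
     zero = 0\<^sub>v n, add = (+), smult = (\<lambda>a x. const_z4v a \<cdot>\<^sub>v x)\<rparr>"

definition red2 :: "4 \<Rightarrow> 2" where
  "red2 a = of_int (Rep_bit0 a)"

lemma red2_of_int: "red2 (of_int z) = of_int z"
proof -
  have "Rep_bit0 (of_int z :: 4) = z mod 4"
    using bit0.Rep_Abs_mod[where ?'a = "1 bit0"] by (simp add: bit0.of_int_eq)
  moreover have "(of_int (z mod 4) :: 2) = of_int z"
  proof -
    have "(of_int z :: 2) = of_int (4 * (z div 4) + z mod 4)" by simp
    also have "\<dots> = 4 * of_int (z div 4) + of_int (z mod 4)"
      by (simp only: of_int_add of_int_mult of_int_numeral)
    also have "(4 :: 2) = 0" by simp
    finally show ?thesis by simp
  qed
  ultimately show ?thesis by (simp add: red2_def)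
qed

text \<open>\<open>Z_2^k\<close> as a \<open>Z_4\<close>-module, \<open>Z_4\<close> acting through the reduction \<open>Z_4 \<rightarrow> Z_2\<close>.\<close>

definition z2_power_z4_module :: "nat \<Rightarrow> (4, 2 vec) module" where
  "z2_power_z4_module k = \<lparr>carrier = carrier_vec k, mult = undefined, one = undefined,
     zero = 0\<^sub>v k, add = (+), smult = (\<lambda>a x. red2 a \<cdot>\<^sub>v x)\<rparr>"

text \<open>\<open>C\<close>, a code of length \<open>n\<close>, is of type \<open>4^k1 2^k2\<close>.\<close>

definition of_type :: "nat \<Rightarrow> z4v vec set \<Rightarrow> nat \<Rightarrow> nat \<Rightarrow> bool" where
  "of_type n C k1 k2 \<longleftrightarrow>
     (\<exists>f \<in> module_hom class_ring (code_z4_module n C)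
            (direct_sum (module_vec TYPE(4) k1) (z2_power_z4_module k2)).
        bij_betw f C (carrier_vec k1 \<times> carrier_vec k2))"

definition N2 :: "nat set" where
  "N2 = {l. l \<ge> 1 \<and> (\<exists>i>0. l dvd 2 ^ i + 1)}"

text \<open>\<^term>\<open>ord j 2\<close> is the multiplicative order of 2 modulo \<open>j\<close>. The divisions below are exact
  for odd \<open>j\<close> (for \<open>beta\<close>: for odd \<open>j \<notin> N2\<close>).\<close>

definition gamma :: "nat \<Rightarrow> nat" where
  "gamma j = totient j div ord j 2"

definition beta :: "nat \<Rightarrow> nat" where
  "beta j = totient j div (2 * ord j 2)"

lemma ord_1_2: "ord 1 (2 :: nat) = 1"
  by simp

end

theory Submission
  imports "HOL-Algebra.Algebraic_Closure_Type" "HOL-Library.Z2" Defs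
begin

text \<open>Let \<open>K\<close> be an algebraic closure of the field with two elements. The values of a word, read as
  a polynomial modulo \<open>x^n - 1\<close>, at the \<open>n\<close>-th roots of unity of \<open>K\<close>, taken for the two reductions
  \<open>v \<mapsto> 0\<close> and \<open>v \<mapsto> 1\<close>, form its spectrum; a word has zero spectrum iff it is divisible by 2.
  A cyclic code \<open>C\<close> determines the set \<open>S\<close> of points at which some word of \<open>C\<close> does not vanish,
  and the set \<open>T \<supseteq> S\<close> of points at which some word \<open>p\<close> with \<open>2p\<close> in \<open>C\<close> does not vanish. Both are
  closed under squaring of roots, every such pair arises, and \<open>C\<close> has type \<open>4^k1 2^k2\<close> with
  \<open>k1 = |S|\<close> and \<open>k1 + k2 = |T|\<close>. The pair belonging to the hull is
  \<open>(S - T\<inverse>, T - S\<inverse>)\<close>. The roots of order \<open>j\<close> split into \<open>gamma j\<close> squaring orbits of size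
  \<open>ord j 2\<close>, which inversion fixes if \<open>j \<in> N2\<close> and permutes without fixed points otherwise; counting
  orbits gives the stated ranges.\<close>

text \<open>The obstacle is that spectra see words only modulo 2, whereas orthogonality is an
  equation modulo 4. Instead of factoring x^n - 1 over Z_4 by Hensel lifting, the proof uses that 2p
  and the spectrum of p determine each other, so that equations between multiples of 2 are spectral.
  What remains is removed with idempotents: the square of a word with 0-1 spectrum is idempotent
  modulo x^n - 1. Orthogonality of p to the cyclic code generated by q says p(x) q(x^-1) = 0. For p
  in the hull and 2t in C this gives 2 p(x) t(x^-1) = 0, which is why the inverse of T, and not only
  that of S, is removed from S. One structure theorem for finite Z_4-modules suffices: afterwards
  |2C| and |C| determine the type, and both follow from counting the multiples of 2 whose halves
  have spectrum in a given set. Oddness of n makes x^n - 1 separable over K, makes squaring preserve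
  the orders of its roots, and makes n equal to 1 in K, so that Fourier inversion needs no
  division.\<close>

hide_const (open) Polynomials.degree Polynomials.lead_coeff

no_notation fps_nth (infixl "$" 75)

section \<open>Roots of unity and squaring orbits\<close>

text \<open>The derivative j x^(j-1) of x^j - 1 has no root other than 0, and 0 is not a root of x^j
  - 1. So no root is double, and the j linear factors are distinct.\<close>

lemma card_nth_roots_unity:
  assumes "of_nat j \<noteq> (0 :: 'a :: alg_closed_field)"
  shows "card {z :: 'a. z ^ j = 1} = j"
proof -
  have j: "j > 0" using assms by (cases j) auto
  define p :: "'a poly" where "p = monom 1 j + [:-1:]"
  have deg: "degree p = j" unfolding p_def using j
    by (subst degree_add_eq_left) (auto simp: degree_monom_eq)
  then have p0: "p \<noteq> 0" using j by auto
  have ev: "poly p z = z ^ j - 1" for z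
    by (simp add: p_def poly_monom)
  obtain A where A: "size A = degree p" "p = smult (lead_coeff p) (\<Prod>x\<in>#A. [:-x, 1:])"
    using alg_closed_imp_factorization[OF p0] by blast
  have "proots p = proots (\<Prod>x\<in>#A. [:-x, 1:])"
    by (subst A(2)) (use p0 in \<open>simp add: proots_smult\<close>)
  also have "\<dots> = (\<Sum>x\<in>#A. {#x#})"
  proof (induction A)
    case (add x A)
    have "(\<Prod>x\<in>#A. [:-x, 1:]) \<noteq> 0" by (auto simp: prod_mset_zero_iff)
    then have "proots ([:-x, 1:] * (\<Prod>x\<in>#A. [:-x, 1:])) = {#x#} + proots (\<Prod>x\<in>#A. [:-x, 1:])"
      by (subst proots_mult) auto
    then show ?case using add.IH by (simp del: mult_pCons_left)
  qed simp
  also have "\<dots> = A" by simp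
  finally have pr: "proots p = A" .
  have ord1: "order z p \<le> 1" for z
  proof (rule ccontr)
    assume "\<not> order z p \<le> 1"
    then have "[:-z, 1:] ^ 2 dvd p" by (subst order_divides) auto
    then obtain q where q: "p = [:-z, 1:] ^ 2 * q" by (rule dvdE)
    have "p = [:-z, 1:] * ([:-z, 1:] * q)" unfolding q by (simp only: power2_eq_square mult.assoc)
    then have "poly (pderiv p) z = 0" by (simp add: pderiv_mult del: mult_pCons_left)
    moreover have "pderiv p = monom (of_nat j) (j - 1)"
      by (simp add: p_def pderiv_add pderiv_monom pderiv_pCons)
    ultimately have "z ^ (j - 1) = 0" using assms by (simp add: poly_monom)
    then have "z ^ j = 0" using j by (metis mult_zero_right power_eq_if neq0_conv)
    moreover have "poly p z = 0" by (simp add: q)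
    ultimately show False by (simp only: ev) simp
  qed
  have "size A = (\<Sum>z\<in>set_mset A. count A z)" by (rule size_multiset_overloaded_eq)
  also have "\<dots> = (\<Sum>z\<in>set_mset A. 1)"
  proof (rule sum.cong[OF refl])
    fix z assume "z \<in> set_mset A"
    then have "count A z > 0" by (simp only: count_greater_zero_iff)
    moreover have "count A z \<le> 1" using ord1[of z] p0 by (simp flip: pr)
    ultimately show "count A z = 1" by linarith
  qed
  also have "\<dots> = card (set_mset A)" by simp
  also have "set_mset A = {z. z ^ j = 1}" using p0 by (simp flip: pr add: ev)
  finally show ?thesis using A(1) deg by simp
qed

definition prim_roots :: "nat \<Rightarrow> 'a :: field set" where
  "prim_roots j = {z. \<forall>i. z ^ i = 1 \<longleftrightarrow> j dvd i}"

lemma ex_prim_roots: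
  fixes z :: "'a :: field"
  assumes "z ^ n = 1" "n > 0"
  shows "\<exists>j. j dvd n \<and> z \<in> prim_roots j"
proof -
  define j where "j = (LEAST k. k > 0 \<and> z ^ k = 1)"
  have j: "j > 0" "z ^ j = 1"
    using LeastI[of "\<lambda>k. k > 0 \<and> z ^ k = 1" n] assms by (auto simp: j_def)
  have "z ^ i = 1 \<longleftrightarrow> j dvd i" for i
  proof -
    have "z ^ i = z ^ (j * (i div j) + i mod j)" by simp
    also have "\<dots> = z ^ (i mod j)" by (simp only: power_add power_mult j) simp
    finally have eq: "z ^ i = z ^ (i mod j)" .
    have "z ^ (i mod j) = 1 \<longleftrightarrow> i mod j = 0"
      using not_less_Least[of "i mod j" "\<lambda>k. k > 0 \<and> z ^ k = 1"] j by (auto simp: j_def[symmetric])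
    then show ?thesis using eq by (simp add: dvd_eq_mod_eq_0)
  qed
  then show ?thesis using assms by (auto simp: prim_roots_def)
qed

lemma mem_prim_roots_iff: "z \<in> prim_roots j \<longleftrightarrow> (\<forall>i. z ^ i = 1 \<longleftrightarrow> j dvd i)"
  by (simp add: prim_roots_def)

lemma prim_roots_disjoint: "z \<in> prim_roots i \<Longrightarrow> z \<in> prim_roots j \<Longrightarrow> i = j"
  unfolding mem_prim_roots_iff by (metis dvd_antisym dvd_refl)

lemma nth_roots_eq_UN_prim_roots:
  "n > 0 \<Longrightarrow> {z :: 'a :: field. z ^ n = 1} = (\<Union>j\<in>{j. j dvd n}. prim_roots j)"
  using ex_prim_roots[of _ n] mem_prim_roots_iff by blast

lemma finite_nth_roots_unity: "n > 0 \<Longrightarrow> finite {z :: 'a :: field. z ^ n = 1}"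
  using poly_roots_finite[of "monom (1 :: 'a) n + [:-1:]"] degree_add_eq_left[of "[:-1:]" "monom (1 :: 'a) n"]
  by (force simp: poly_monom degree_monom_eq)

lemma finite_prim_roots: "j > 0 \<Longrightarrow> finite (prim_roots j :: 'a :: field set)"
  by (rule finite_subset[OF _ finite_nth_roots_unity[of j]]) (use mem_prim_roots_iff dvd_refl in blast)

text \<open>Gauss's argument: over the divisors d of j, the numbers of primitive d-th roots and the
  totients have the same sum j, and by induction they agree at every proper divisor.\<close>

lemma card_prim_roots:
  assumes "of_nat j \<noteq> (0 :: 'a :: alg_closed_field)"
  shows "card (prim_roots j :: 'a set) = totient j"
  using assms
proof (induction j rule: less_induct)
  case (less j)
  have j: "j > 0" using less.prems by (cases j) auto
  let ?D = "{d. d dvd j}"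
  have finD: "finite ?D" using j by simp
  have nz: "of_nat d \<noteq> (0 :: 'a)" if "d dvd j" for d
    using that less.prems by (auto elim!: dvdE)
  have "j = card {z :: 'a. z ^ j = 1}" using card_nth_roots_unity[OF less.prems] by simp
  also have "\<dots> = (\<Sum>d\<in>?D. card (prim_roots d :: 'a set))"
    unfolding nth_roots_eq_UN_prim_roots[OF j]
  proof (rule card_UN_disjoint[OF finD])
    show "\<forall>d\<in>?D. finite (prim_roots d :: 'a set)"
    proof
      fix d assume "d \<in> ?D"
      then have "d > 0" using j by (auto intro: Nat.gr0I)
      then show "finite (prim_roots d :: 'a set)" by (rule finite_prim_roots)
    qed
    show "\<forall>d\<in>?D. \<forall>e\<in>?D. d \<noteq> e \<longrightarrow> prim_roots d \<inter> (prim_roots e :: 'a set) = {}"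
      using prim_roots_disjoint by blast
  qed
  also have "\<dots> = card (prim_roots j :: 'a set) + (\<Sum>d\<in>?D - {j}. card (prim_roots d :: 'a set))"
    using finD by (intro sum.remove) auto
  also have "(\<Sum>d\<in>?D - {j}. card (prim_roots d :: 'a set)) = (\<Sum>d\<in>?D - {j}. totient d)"
  proof (rule sum.cong[OF refl])
    fix d assume "d \<in> ?D - {j}"
    then have "d dvd j" "d < j" using dvd_imp_le[of d j] j by auto
    then show "card (prim_roots d :: 'a set) = totient d" using less.IH nz by blast
  qed
  finally have "card (prim_roots j :: 'a set) + (\<Sum>d\<in>?D - {j}. totient d) = j" ..
  moreover have "totient j + (\<Sum>d\<in>?D - {j}. totient d) = j"
    using totient_divisor_sum[of j] sum.remove[OF finD, of j totient] by simp
  ultimately show ?case by simp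
qed

lemma prim_roots_power_eq_iff:
  assumes "z \<in> prim_roots j" "j > 0"
  shows "z ^ a = z ^ b \<longleftrightarrow> [a = b] (mod j)"
proof -
  have pr: "z ^ i = 1 \<longleftrightarrow> j dvd i" for i using assms(1) mem_prim_roots_iff by blast
  have z: "z \<noteq> 0"
  proof
    assume "z = 0"
    then have "z ^ j = 0" using assms(2) by (simp add: power_0_left)
    then show False using pr[of j] by (metis dvd_refl zero_neq_one)
  qed
  have *: "z ^ a = z ^ b \<longleftrightarrow> [a = b] (mod j)" if "a \<le> b" for a b
  proof -
    have "z ^ b = z ^ a * z ^ (b - a)" using that by (simp flip: power_add)
    then have "z ^ a = z ^ b \<longleftrightarrow> z ^ (b - a) = 1" using z by simp
    also have "\<dots> \<longleftrightarrow> [b = a] (mod j)" by (simp only: pr cong_altdef_nat[OF that])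
    finally show ?thesis by (simp only: cong_sym_eq[of a b])
  qed
  show ?thesis
  proof (cases "a \<le> b")
    case True
    then show ?thesis by (rule *)
  next
    case False
    then have "z ^ b = z ^ a \<longleftrightarrow> [b = a] (mod j)" by (intro *) simp
    then show ?thesis by (metis cong_sym)
  qed
qed

lemma inverse_prim_roots: "z \<in> prim_roots j \<Longrightarrow> inverse z \<in> prim_roots j"
  unfolding prim_roots_def by (simp add: power_inverse)

text \<open>For a root of unity of odd order in characteristic 2, these are the conjugates of
  \<open>z\<close> over the prime field. On exponents this is a 2-cyclotomic coset modulo the order
  of \<open>z\<close>.\<close>

definition sq_orbit :: "'a :: field \<Rightarrow> 'a set" where
  "sq_orbit z = range (\<lambda>i. z ^ (2 ^ i))"

text \<open>Forward closure suffices: on roots of odd order squaring is periodic, so that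
  differences are closed too, see \<open>sq_closed_Diff\<close>.\<close>

definition sq_closed :: "'a :: field set \<Rightarrow> bool" where
  "sq_closed U \<longleftrightarrow> (\<forall>z\<in>U. z ^ 2 \<in> U)"

lemma self_in_sq_orbit: "z \<in> sq_orbit z"
  unfolding sq_orbit_def by (rule range_eqI[of _ _ 0]) simp

lemma sq_closed_power: "sq_closed U \<Longrightarrow> z \<in> U \<Longrightarrow> z ^ (2 ^ i) \<in> U"
proof (induction i)
  case (Suc i)
  have "z ^ 2 ^ Suc i = (z ^ 2 ^ i) ^ 2" by (simp only: power_Suc2 power_mult)
  then show ?case using Suc by (simp only: sq_closed_def)
qed simp

lemma sq_orbit_subset: "sq_closed U \<Longrightarrow> z \<in> U \<Longrightarrow> sq_orbit z \<subseteq> U"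
  by (auto simp: sq_orbit_def sq_closed_power)

lemma sq_closed_sq_orbit: "sq_closed (sq_orbit z)"
proof -
  have "(z ^ 2 ^ i) ^ 2 = z ^ 2 ^ Suc i" for i by (simp only: power_Suc2 power_mult)
  then have "(z ^ 2 ^ i) ^ 2 \<in> sq_orbit z" for i unfolding sq_orbit_def by (rule range_eqI)
  then show ?thesis by (auto simp: sq_closed_def sq_orbit_def)
qed

lemma inverse_sq_orbit: "inverse ` sq_orbit z = sq_orbit (inverse z)"
  unfolding sq_orbit_def by (simp only: power_inverse image_image)

lemma sq_closed_Un: "sq_closed U \<Longrightarrow> sq_closed V \<Longrightarrow> sq_closed (U \<union> V)"
  by (auto simp: sq_closed_def)

lemma sq_closed_inverse: "sq_closed U \<Longrightarrow> sq_closed (inverse ` U)"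
  unfolding sq_closed_def by (auto simp: power_inverse)

lemma mem_inverse_image_iff: "z \<in> inverse ` U \<longleftrightarrow> inverse z \<in> (U :: 'a :: field set)"
  by (metis image_iff inverse_inverse_eq)

lemma sq_closed_prim_roots:
  assumes "odd j" shows "sq_closed (prim_roots j)"
  unfolding sq_closed_def
proof
  fix z :: 'a assume "z \<in> prim_roots j"
  then have z: "z ^ i = 1 \<longleftrightarrow> j dvd i" for i by (simp only: mem_prim_roots_iff)
  have "j dvd 2 * i \<longleftrightarrow> j dvd i" for i
    using assms by (intro coprime_dvd_mult_right_iff) simp
  then have "(z ^ 2) ^ i = 1 \<longleftrightarrow> j dvd i" for i
    using z[of "2 * i"] by (simp only: power_mult)
  then show "z ^ 2 \<in> prim_roots j" unfolding mem_prim_roots_iff by blast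
qed

lemma ord_2_pos: "odd j \<Longrightarrow> ord j (2 :: nat) > 0"
  by simp

context
  fixes j :: nat
  assumes odd_j: "odd j"
begin

text \<open>As 2 to the power \<open>ord j 2 * i\<close> is 1 modulo j, another
  \<open>ord j 2 * i - i\<close> squarings after the first \<open>i\<close> lead back to
  \<open>z\<close>. The order is positive, so this subtraction is not truncated.\<close>

lemma sq_orbit_periodic:
  assumes "z \<in> prim_roots j" shows "\<exists>k. (z ^ 2 ^ i) ^ 2 ^ k = z"
proof -
  have "[2 ^ (ord j 2 * i) = (1 :: nat)] (mod j)" using ord_divides[of 2 "ord j 2 * i" j] by simp
  then have e: "z ^ 2 ^ (ord j 2 * i) = z" using prim_roots_power_eq_iff[OF assms odd_pos[OF odd_j], of "2 ^ (ord j 2 * i)" 1] by simp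
  have "1 * i \<le> ord j 2 * i" using ord_2_pos[OF odd_j] by (intro mult_le_mono1) linarith
  then have "i + (ord j 2 * i - i) = ord j 2 * i" by simp
  then have "(z ^ 2 ^ i) ^ 2 ^ (ord j 2 * i - i) = z" using e by (metis power_add power_mult)
  then show ?thesis by blast
qed

lemma sq_orbit_sym: "z \<in> prim_roots j \<Longrightarrow> w \<in> sq_orbit z \<Longrightarrow> z \<in> sq_orbit w"
  unfolding sq_orbit_def by (erule rangeE) (use sq_orbit_periodic[of z] in \<open>metis rangeI\<close>)

lemma sq_orbit_eq:
  assumes "z \<in> prim_roots j" "w \<in> sq_orbit z" shows "sq_orbit w = sq_orbit z"
  using sq_orbit_subset[OF sq_closed_sq_orbit] sq_orbit_sym[OF assms] assms(2) by blast

text \<open>Equality of the powers with exponents 2^a and 2^b means 2^a = 2^b modulo j, that is a =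
  b modulo the order of 2. So the exponents below \<open>ord j 2\<close> enumerate the orbit without
  repetition.\<close>

lemma card_sq_orbit:
  assumes "z \<in> prim_roots j" shows "card (sq_orbit z) = ord j 2"
proof -
  have eq: "z ^ 2 ^ a = z ^ 2 ^ b \<longleftrightarrow> [a = b] (mod ord j 2)" for a b
    unfolding prim_roots_power_eq_iff[OF assms odd_pos[OF odd_j]] using order_divides_expdiff[of j 2 a b] odd_j by simp
  have "sq_orbit z = (\<lambda>i. z ^ 2 ^ i) ` {..<ord j 2}"
  proof -
    have "z ^ 2 ^ i = z ^ 2 ^ (i mod ord j 2)" for i using eq by simp
    then show ?thesis using ord_2_pos[OF odd_j] by (force simp: sq_orbit_def)
  qed
  moreover have "inj_on (\<lambda>i. z ^ 2 ^ i) {..<ord j 2}"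
    by (auto intro!: inj_onI simp: eq cong_less_modulus_unique_nat)
  ultimately show ?thesis by (simp add: card_image)
qed

lemma sq_orbit_subset_prim: "z \<in> prim_roots j \<Longrightarrow> sq_orbit z \<subseteq> prim_roots j"
  using sq_orbit_subset sq_closed_prim_roots[OF odd_j] by blast

text \<open>If \<open>z ^ 2\<close> were in \<open>V\<close>, so would be \<open>z\<close>, which
  lies on the orbit of \<open>z ^ 2\<close> by periodicity.\<close>

lemma sq_closed_Diff:
  assumes "sq_closed U" "sq_closed V" "U \<subseteq> prim_roots j" shows "sq_closed (U - V)"
  unfolding sq_closed_def
proof
  fix z assume z: "z \<in> U - V"
  have "z ^ 2 \<in> sq_orbit z" using self_in_sq_orbit sq_closed_sq_orbit by (auto simp: sq_closed_def)
  then have "z \<in> sq_orbit (z ^ 2)" using sq_orbit_sym z assms(3) by blast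
  then have "z ^ 2 \<notin> V" using sq_orbit_subset[OF assms(2)] z by blast
  then show "z ^ 2 \<in> U - V" using z assms(1) by (auto simp: sq_closed_def)
qed

text \<open>Squaring orbits partition \<open>U\<close>, and all of them have size
  \<open>ord j 2\<close>.\<close>

lemma ord_dvd_card_sq_closed:
  fixes U :: "'a :: field set"
  assumes "sq_closed U" "U \<subseteq> prim_roots j" shows "ord j 2 dvd card U"
proof -
  have fin: "finite U" using finite_subset[OF assms(2) finite_prim_roots[OF odd_pos[OF odd_j]]] .
  define r :: "('a \<times> 'a) set" where "r = {(z, w). z \<in> U \<and> w \<in> sq_orbit z}"
  have r: "equiv U r"
  proof (rule equivI)
    show "r \<subseteq> U \<times> U" using sq_orbit_subset[OF assms(1)] by (auto simp: r_def)
    show "refl_on U r" by (auto simp: r_def refl_on_def self_in_sq_orbit)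
    show "sym r" using sq_orbit_subset[OF assms(1)] sq_orbit_sym assms(2) unfolding r_def sym_def by blast
    show "trans r" using sq_orbit_eq assms(2) by (auto simp: r_def trans_def)
  qed
  show ?thesis
  proof (rule equiv_imp_dvd_card[OF fin r])
    fix P assume "P \<in> U // r"
    then obtain z where "z \<in> U" "P = sq_orbit z" by (auto simp: quotient_def r_def)
    then show "ord j 2 dvd card P" using card_sq_orbit[of z] assms(2) by auto
  qed
qed

text \<open>Orbits are added greedily: a point of \<open>Y\<close> outside a squaring-closed
  \<open>U\<close> has its whole orbit in \<open>Y - U\<close>.\<close>

lemma sq_closed_subset_of_card:
  assumes "sq_closed Y" "Y \<subseteq> prim_roots j" "ord j 2 * t \<le> card Y"
  shows "\<exists>U\<subseteq>Y. sq_closed U \<and> card U = ord j 2 * t"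
  using assms(3)
proof (induction t)
  case 0
  then show ?case by (intro exI[of _ "{}"]) (auto simp: sq_closed_def)
next
  case (Suc t)
  then obtain U where U: "U \<subseteq> Y" "sq_closed U" "card U = ord j 2 * t" by auto
  have fin: "finite Y" using finite_subset[OF assms(2) finite_prim_roots[OF odd_pos[OF odd_j]]] .
  have "card U < card Y" using U(3) Suc.prems ord_2_pos[OF odd_j] by (simp only: mult_Suc_right)
  then obtain z where z: "z \<in> Y" "z \<notin> U" using U(1) by (metis order_less_irrefl subsetI subset_antisym)
  have "sq_orbit z \<subseteq> Y - U"
    using z sq_closed_Diff[OF assms(1) U(2) assms(2)] sq_orbit_subset by blast
  moreover from this have "card (U \<union> sq_orbit z) = card U + card (sq_orbit z)"
    using fin U(1) by (intro card_Un_disjoint) (auto intro: finite_subset)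
  ultimately show ?case using U z card_sq_orbit[of z] assms(2) sq_closed_Un[OF U(2) sq_closed_sq_orbit]
    by (intro exI[of _ "U \<union> sq_orbit z"]) auto
qed

end

text \<open>That the inverse of \<open>z\<close> is the power with exponent 2^i means that the power
  with exponent 2^i + 1 is 1, hence that j divides 2^i + 1.\<close>

lemma inverse_in_sq_orbit_iff:
  assumes "odd j" "z \<in> prim_roots j"
  shows "inverse z \<in> sq_orbit z \<longleftrightarrow> j \<in> N2"
proof -
  have j: "j > 0" using assms(1) by (cases j) auto
  have "z ^ j = 1" using assms(2) mem_prim_roots_iff dvd_refl by blast
  then have z: "z \<noteq> 0" using j by (metis power_0_left neq0_conv zero_neq_one)
  have "inverse z = z ^ 2 ^ i \<longleftrightarrow> z ^ (2 ^ i + 1) = 1" for i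
    using z by (auto simp: field_simps)
  then have "inverse z = z ^ 2 ^ i \<longleftrightarrow> j dvd 2 ^ i + 1" for i
    using assms(2) mem_prim_roots_iff by blast
  then have "inverse z \<in> sq_orbit z \<longleftrightarrow> (\<exists>i. j dvd 2 ^ i + 1)"
    by (auto simp: sq_orbit_def)
  also have "\<dots> \<longleftrightarrow> j \<in> N2"
  proof
    assume "\<exists>i. j dvd 2 ^ i + 1"
    then obtain i where i: "j dvd 2 ^ i + 1" by blast
    show "j \<in> N2"
    proof (cases "i = 0")
      \<comment> \<open>Membership in \<open>N2\<close> asks for a positive exponent. Exponent 0
        gives that j divides 2, so j = 1 by oddness, and 1 is in \<open>N2\<close>.\<close>
      case True
      then have "j dvd 2" using i by (simp add: numeral_2_eq_2)
      then have "j = 1" using assms(1) by (metis coprime_common_divisor_nat coprime_right_2_iff_odd dvd_refl)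
      then show ?thesis by (auto simp: N2_def)
    next
      case False
      then show ?thesis using i j by (auto simp: N2_def)
    qed
  qed (auto simp: N2_def)
  finally show ?thesis .
qed

lemma totient_eq_ord_times_gamma:
  assumes "odd j" shows "totient j = ord j 2 * gamma j"
  using assms order_divides_totient[of j 2] by (simp add: gamma_def)

section \<open>Squaring-closed sets of roots of one order under inversion\<close>

context
  fixes j :: nat and A :: "'a :: alg_closed_field itself"
  assumes odd_j: "odd j" and j_nz: "of_nat j \<noteq> (0 :: 'a)"
begin

lemma fin_prim: "finite (prim_roots j :: 'a set)" by (rule finite_prim_roots[OF odd_pos[OF odd_j]])

lemma card_prim: "card (prim_roots j :: 'a set) = totient j" by (rule card_prim_roots[OF j_nz])

lemma inverse_sq_closed_N2:
  fixes U :: "'a set"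
  assumes "j \<in> N2" "sq_closed U" "U \<subseteq> prim_roots j"
  shows "inverse ` U = U"
proof -
  have "inverse z \<in> U" if "z \<in> U" for z
    using that inverse_in_sq_orbit_iff[OF odd_j] sq_orbit_subset[OF assms(2)] assms by blast
  then show ?thesis using mem_inverse_image_iff by blast
qed

lemma sq_orbit_inverse_disjoint:
  fixes z :: 'a
  assumes "j \<notin> N2" "z \<in> prim_roots j"
  shows "sq_orbit z \<inter> sq_orbit (inverse z) = {}"
proof (rule ccontr)
  assume "sq_orbit z \<inter> sq_orbit (inverse z) \<noteq> {}"
  then obtain w where "w \<in> sq_orbit z" "w \<in> sq_orbit (inverse z)" by blast
  then have "sq_orbit z = sq_orbit (inverse z)"
    using sq_orbit_eq[OF odd_j] assms(2) inverse_prim_roots by metis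
  then have "inverse z \<in> sq_orbit z" using self_in_sq_orbit by metis
  then show False using inverse_in_sq_orbit_iff[OF odd_j assms(2)] assms(1) by simp
qed

text \<open>This is the exactness of the division in \<open>beta\<close>. Inversion pairs distinct
  orbits, so the roots of order j fall into blocks \<open>O2 z\<close> of size
  \<open>2 * ord j 2\<close>, which therefore divides the totient.\<close>

lemma gamma_eq_2_beta:
  assumes "j \<notin> N2" shows "gamma j = 2 * beta j"
proof -
  let ?P = "prim_roots j :: 'a set"
  define O2 where "O2 z = sq_orbit z \<union> sq_orbit (inverse z)" for z :: 'a
  define r :: "('a \<times> 'a) set" where "r = {(z, w). z \<in> ?P \<and> w \<in> O2 z}"
  have eq: "O2 w = O2 z" if "z \<in> ?P" "w \<in> O2 z" for z w
  proof -
    from that(2) consider "w \<in> sq_orbit z" | "w \<in> sq_orbit (inverse z)" by (auto simp: O2_def)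
    then show ?thesis
    proof cases
      case 1
      then have "inverse w \<in> sq_orbit (inverse z)" by (auto simp flip: inverse_sq_orbit)
      then show ?thesis unfolding O2_def
        using 1 sq_orbit_eq[OF odd_j] that(1) inverse_prim_roots by metis
    next
      case 2
      then have "inverse w \<in> sq_orbit z" by (metis inverse_sq_orbit inverse_inverse_eq imageI)
      then show ?thesis unfolding O2_def
        using 2 sq_orbit_eq[OF odd_j] that(1) inverse_prim_roots by (metis Un_commute)
    qed
  qed
  have self: "z \<in> O2 z" for z by (simp add: O2_def self_in_sq_orbit)
  have sub: "O2 z \<subseteq> ?P" if "z \<in> ?P" for z
    using that sq_orbit_subset_prim[OF odd_j] inverse_prim_roots unfolding O2_def by blast
  have r: "equiv ?P r"
  proof (rule equivI)
    show "r \<subseteq> ?P \<times> ?P" using sub unfolding r_def by blast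
    show "refl_on ?P r" using self unfolding r_def refl_on_def by blast
    show "sym r" using sub self eq unfolding r_def sym_def by blast
    show "trans r" using eq unfolding r_def trans_def by blast
  qed
  have "2 * ord j 2 dvd card ?P"
  proof (rule equiv_imp_dvd_card[OF fin_prim r])
    fix P assume "P \<in> ?P // r"
    then obtain z where z: "z \<in> ?P" "P = O2 z" by (auto simp: quotient_def r_def)
    have "card P = card (sq_orbit z) + card (sq_orbit (inverse z))"
      unfolding z O2_def
      using finite_subset[OF sq_orbit_subset_prim[OF odd_j] fin_prim] z(1) inverse_prim_roots[OF z(1)]
      by (intro card_Un_disjoint sq_orbit_inverse_disjoint[OF assms]) auto
    also have "\<dots> = 2 * ord j 2"
      using card_sq_orbit[OF odd_j z(1)] card_sq_orbit[OF odd_j inverse_prim_roots[OF z(1)]] by simp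
    finally show "2 * ord j 2 dvd card P" by simp
  qed
  then obtain k where k: "totient j = 2 * ord j 2 * k" unfolding card_prim by (rule dvdE)
  then have "totient j = ord j 2 * (2 * k)" by simp
  then have "gamma j = 2 * k" "beta j = k"
    using k ord_2_pos[OF odd_j] unfolding gamma_def beta_def by (metis neq0_conv nonzero_mult_div_cancel_left mult_eq_0_iff zero_neq_numeral)+
  then show ?thesis by simp
qed

text \<open>Inversion fixes both sets, so the differences are S - T, which is empty, and T - S, a
  union of at most \<open>gamma j\<close> orbits.\<close>

lemma sq_closed_cards_N2:
  fixes S T :: "'a set"
  assumes "j \<in> N2" "sq_closed S" "sq_closed T" "S \<subseteq> T" "T \<subseteq> prim_roots j"
  shows "S - inverse ` T = {} \<and> (\<exists>b\<le>gamma j. card (T - inverse ` S) = ord j 2 * b)"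
proof -
  have "ord j 2 dvd card (T - S)"
    using assms sq_closed_Diff[OF odd_j] by (intro ord_dvd_card_sq_closed[OF odd_j]) auto
  then obtain b where b: "card (T - S) = ord j 2 * b" by (rule dvdE)
  have "card (T - S) \<le> totient j"
    unfolding card_prim[symmetric] using assms fin_prim by (intro card_mono) auto
  then have "b \<le> gamma j" using ord_2_pos[OF odd_j] unfolding totient_eq_ord_times_gamma[OF odd_j] b by simp
  then show ?thesis using b assms inverse_sq_closed_N2[of S] inverse_sq_closed_N2[of T] by auto
qed

lemma ex_sq_closed_cards_N2:
  assumes "j \<in> N2" "b \<le> gamma j"
  shows "\<exists>S T :: 'a set. sq_closed S \<and> sq_closed T \<and> S \<subseteq> T \<and> T \<subseteq> prim_roots j \<and>
    card (S - inverse ` T) = 0 \<and> card (T - inverse ` S) = ord j 2 * b"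
proof -
  have "ord j 2 * b \<le> card (prim_roots j :: 'a set)"
    unfolding card_prim totient_eq_ord_times_gamma[OF odd_j] using assms(2) by simp
  then obtain U :: "'a set" where "U \<subseteq> prim_roots j" "sq_closed U" "card U = ord j 2 * b"
    using sq_closed_subset_of_card[OF odd_j sq_closed_prim_roots[OF odd_j] subset_refl] by blast
  then show ?thesis by (intro exI[of _ "{}"] exI[of _ U]) (auto simp: sq_closed_def)
qed

text \<open>The bound on \<open>c\<close> comes from disjointness: a point of \<open>E\<close> whose
  inverse is in \<open>D\<close>, hence in \<open>S\<close>, would lie in the inverse of
  \<open>S\<close>, which \<open>E\<close> excludes. So |E| + |D| is at most the totient, that is 2a
  + c is at most 2 beta j.\<close>

lemma sq_closed_cards_not_N2:
  fixes S T :: "'a set"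
  assumes "j \<notin> N2" "sq_closed S" "sq_closed T" "S \<subseteq> T" "T \<subseteq> prim_roots j"
  shows "\<exists>a c. a \<le> beta j \<and> c \<le> 2 * (beta j - a) \<and>
    card (S - inverse ` T) = ord j 2 * a \<and> card (T - inverse ` S) = ord j 2 * (a + c)"
proof -
  define D where "D = S - inverse ` T"
  define E where "E = T - inverse ` S"
  have DE: "D \<subseteq> E" using assms(4) by (auto simp: D_def E_def)
  have sub: "E \<subseteq> prim_roots j" "D \<subseteq> prim_roots j" using assms by (auto simp: D_def E_def)
  have cl: "sq_closed D" "sq_closed E"
    using assms by (auto simp: D_def E_def intro!: sq_closed_Diff[OF odd_j] sq_closed_inverse)
  have fin: "finite D" "finite E" using sub finite_subset[OF _ fin_prim] by auto
  have "ord j 2 dvd card D" by (rule ord_dvd_card_sq_closed[OF odd_j cl(1) sub(2)])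
  then obtain a where a: "card D = ord j 2 * a" by (rule dvdE)
  have "ord j 2 dvd card (E - D)"
    using sq_closed_Diff[OF odd_j cl(2,1) sub(1)] sub by (intro ord_dvd_card_sq_closed[OF odd_j]) auto
  then obtain c where c: "card (E - D) = ord j 2 * c" by (rule dvdE)
  have card_E: "card E = ord j 2 * (a + c)"
    using card_Diff_subset[OF fin(1) DE] card_mono[OF fin(2) DE] a c by (simp add: algebra_simps)
  have "E \<inter> inverse ` D = {}"
  proof -
    have "inverse z \<notin> D" if "z \<in> E" for z
      using that unfolding D_def E_def by (auto simp: mem_inverse_image_iff)
    then show ?thesis by (metis disjoint_iff mem_inverse_image_iff)
  qed
  then have "card E + card (inverse ` D) = card (E \<union> inverse ` D)"
    using fin by (intro card_Un_disjoint[symmetric]) auto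
  also have "\<dots> \<le> totient j"
    unfolding card_prim[symmetric] using sub inverse_prim_roots by (intro card_mono fin_prim) blast
  also have "card (inverse ` D) = card D" by (intro card_image inj_onI) simp
  finally have "ord j 2 * (2 * a + c) \<le> ord j 2 * (2 * beta j)"
    unfolding totient_eq_ord_times_gamma[OF odd_j] gamma_eq_2_beta[OF assms(1)] card_E a
    by (simp add: algebra_simps)
  then have "2 * a + c \<le> 2 * beta j" using ord_2_pos[OF odd_j] by simp
  then show ?thesis using a card_E unfolding D_def E_def
    by (intro exI[of _ a] exI[of _ c]) auto
qed

text \<open>One orbit is taken from each of \<open>a\<close> mutually inverse pairs. While fewer
  than \<open>beta j\<close> pairs are used, \<open>U\<close> and its inverse do not exhaust the
  roots of order j.\<close>

lemma ex_antisymmetric_sq_closed: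
  assumes "j \<notin> N2" "a \<le> beta j"
  shows "\<exists>U\<subseteq>(prim_roots j :: 'a set). sq_closed U \<and> U \<inter> inverse ` U = {} \<and> card U = ord j 2 * a"
  using assms(2)
proof (induction a)
  case 0
  then show ?case by (intro exI[of _ "{}"]) (auto simp: sq_closed_def)
next
  case (Suc a)
  then obtain U :: "'a set" where U: "U \<subseteq> prim_roots j" "sq_closed U" "U \<inter> inverse ` U = {}" "card U = ord j 2 * a"
    by auto
  let ?V = "U \<union> inverse ` U"
  have fin: "finite U" using U(1) finite_subset[OF _ fin_prim] by auto
  have clV: "sq_closed ?V" by (intro sq_closed_Un sq_closed_inverse U)
  have "card ?V \<le> card U + card (inverse ` U)" by (rule card_Un_le)
  also have "card (inverse ` U) = card U" by (intro card_image inj_onI) simp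
  also have "card U + card U = ord j 2 * (2 * a)" using U(4) by simp
  also have "\<dots> < ord j 2 * (2 * beta j)" using Suc.prems ord_2_pos[OF odd_j] by (intro mult_strict_left_mono) auto
  also have "\<dots> = card (prim_roots j :: 'a set)"
    unfolding card_prim totient_eq_ord_times_gamma[OF odd_j] gamma_eq_2_beta[OF assms(1)] ..
  finally have "\<not> prim_roots j \<subseteq> ?V" using card_mono[of ?V "prim_roots j"] fin by auto
  then obtain z where z: "z \<in> prim_roots j" "z \<notin> ?V" by blast
  then have "sq_orbit z \<subseteq> prim_roots j - ?V"
    using sq_closed_Diff[OF odd_j sq_closed_prim_roots[OF odd_j] clV subset_refl] sq_orbit_subset by blast
  then have dis: "sq_orbit z \<inter> U = {}" "sq_orbit z \<inter> inverse ` U = {}" and sub: "sq_orbit z \<subseteq> prim_roots j"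
    by auto
  have dis2: "U \<inter> inverse ` sq_orbit z = {}"
    using dis(2) by (auto simp: mem_inverse_image_iff)
  have dis3: "sq_orbit z \<inter> inverse ` sq_orbit z = {}"
    using sq_orbit_inverse_disjoint[OF assms(1) z(1)] by (simp add: inverse_sq_orbit)
  have "card (U \<union> sq_orbit z) = card U + card (sq_orbit z)"
    using dis fin sub finite_subset[OF _ fin_prim] by (intro card_Un_disjoint) auto
  then have "card (U \<union> sq_orbit z) = ord j 2 * Suc a" using U(4) card_sq_orbit[OF odd_j z(1)] by simp
  moreover have "(U \<union> sq_orbit z) \<inter> inverse ` (U \<union> sq_orbit z) = {}"
    using U(3) dis(2) dis2 dis3 by (simp only: image_Un Int_Un_distrib Int_Un_distrib2 Un_empty_left Un_empty_right)
  moreover have "sq_closed (U \<union> sq_orbit z)" by (rule sq_closed_Un[OF U(2) sq_closed_sq_orbit])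
  moreover have "U \<union> sq_orbit z \<subseteq> prim_roots j" using U(1) sub by blast
  ultimately show ?case by (intro exI[of _ "U \<union> sq_orbit z"] conjI)
qed

text \<open>\<open>S\<close> is a set \<open>U\<close> of \<open>a\<close> orbits that is disjoint
  from its inverse, and \<open>T\<close> adds \<open>c\<close> orbits that avoid both
  \<open>U\<close> and its inverse. Then nothing is lost in either difference: they are
  \<open>S\<close> and \<open>T\<close> themselves.\<close>

lemma ex_sq_closed_cards_not_N2:
  assumes "j \<notin> N2" "a \<le> beta j" "c \<le> 2 * (beta j - a)"
  shows "\<exists>S T :: 'a set. sq_closed S \<and> sq_closed T \<and> S \<subseteq> T \<and> T \<subseteq> prim_roots j \<and>
    card (S - inverse ` T) = ord j 2 * a \<and> card (T - inverse ` S) = ord j 2 * (a + c)"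
proof -
  obtain U :: "'a set" where U: "U \<subseteq> prim_roots j" "sq_closed U" "U \<inter> inverse ` U = {}" "card U = ord j 2 * a"
    using ex_antisymmetric_sq_closed[OF assms(1,2)] by blast
  let ?V = "U \<union> inverse ` U"
  let ?W = "prim_roots j - ?V"
  have fin: "finite U" using U(1) finite_subset[OF _ fin_prim] by auto
  have clV: "sq_closed ?V" by (intro sq_closed_Un sq_closed_inverse U)
  have clW: "sq_closed ?W"
    by (rule sq_closed_Diff[OF odd_j sq_closed_prim_roots[OF odd_j] clV subset_refl])
  have subV: "?V \<subseteq> prim_roots j" using U(1) inverse_prim_roots by blast
  have "card ?V = card U + card (inverse ` U)" using U(3) fin by (intro card_Un_disjoint) auto
  also have "card (inverse ` U) = card U" by (intro card_image inj_onI) simp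
  finally have "card ?V = ord j 2 * (2 * a)" using U(4) by simp
  then have "card ?W = ord j 2 * (2 * beta j) - ord j 2 * (2 * a)"
    using card_Diff_subset[of ?V "prim_roots j"] subV fin
    unfolding card_prim totient_eq_ord_times_gamma[OF odd_j] gamma_eq_2_beta[OF assms(1)] by simp
  also have "\<dots> = ord j 2 * (2 * (beta j - a))" by (simp add: algebra_simps flip: right_diff_distrib')
  finally have W: "ord j 2 * c \<le> card ?W" using assms(3) by simp
  then obtain Q where Q: "Q \<subseteq> ?W" "sq_closed Q" "card Q = ord j 2 * c"
    using sq_closed_subset_of_card[OF odd_j clW Diff_subset W] by (elim exE conjE)
  have disj: "Q \<inter> U = {}" "Q \<inter> inverse ` U = {}" using Q(1) by auto
  have finQ: "finite Q" using Q(1) finite_subset[OF _ fin_prim] by auto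
  have "U \<inter> inverse ` Q = {}" using disj(2) by (auto simp: mem_inverse_image_iff)
  then have "U - inverse ` (U \<union> Q) = U" using U(3) by (auto simp: image_Un)
  moreover have "U \<union> Q - inverse ` U = U \<union> Q" using U(3) disj(2) by auto
  moreover have "card (U \<union> Q) = card U + card Q" using disj fin finQ by (intro card_Un_disjoint) auto
  moreover have "U \<union> Q \<subseteq> prim_roots j" using U(1) Q(1) by blast
  ultimately show ?thesis using U(2,4) Q(3) sq_closed_Un[OF U(2) Q(2)]
    by (intro exI[of _ U] exI[of _ "U \<union> Q"]) (simp add: distrib_left)
qed

end

section \<open>Sets of roots closed under squaring\<close>

text \<open>Substituting x^-1 for x leaves v alone, so the component, which tells v = 0 from v = 1,
  is kept.\<close>

definition pair_inverse :: "'a :: field \<times> bool \<Rightarrow> 'a \<times> bool" where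
  "pair_inverse = map_prod inverse id"

definition pair_sq_closed :: "('a :: field \<times> bool) set \<Rightarrow> bool" where
  "pair_sq_closed U \<longleftrightarrow> (\<forall>(z, e)\<in>U. (z ^ 2, e) \<in> U)"

definition slice :: "('a :: field \<times> bool) set \<Rightarrow> bool \<Rightarrow> nat \<Rightarrow> 'a set" where
  "slice U e j = {z \<in> prim_roots j. (z, e) \<in> U}"

lemma pair_inverse_simp [simp]: "pair_inverse (z, e) = (inverse z, e)"
  by (simp add: pair_inverse_def)

lemma pair_inverse_idem [simp]: "pair_inverse (pair_inverse m) = m"
  by (cases m) simp

lemma mem_pair_inverse_image_iff: "m \<in> pair_inverse ` U \<longleftrightarrow> pair_inverse m \<in> U"
  by (metis image_iff pair_inverse_idem)

lemma slice_subset: "slice U e j \<subseteq> prim_roots j"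
  by (auto simp: slice_def)

lemma slice_mono: "S \<subseteq> T \<Longrightarrow> slice S e j \<subseteq> slice T e j"
  by (auto simp: slice_def)

lemma inverse_prim_roots_iff: "inverse z \<in> prim_roots j \<longleftrightarrow> z \<in> prim_roots j"
  using inverse_prim_roots[of z j] inverse_prim_roots[of "inverse z" j] by auto

lemma slice_Diff_inverse: "slice (S - pair_inverse ` T) e j = slice S e j - inverse ` slice T e j"
  unfolding slice_def
  by (auto simp only: mem_pair_inverse_image_iff mem_inverse_image_iff pair_inverse_simp
      inverse_prim_roots_iff inverse_inverse_eq Diff_iff mem_Collect_eq)

lemma sq_closed_slice: "pair_sq_closed U \<Longrightarrow> odd j \<Longrightarrow> sq_closed (slice U e j)"
  using sq_closed_prim_roots[of j] unfolding sq_closed_def pair_sq_closed_def slice_def by blast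

lemma card_eq_sum_slices:
  fixes U :: "('a :: field \<times> bool) set"
  assumes "n > 0" "U \<subseteq> {z. z ^ n = 1} \<times> UNIV"
  shows "card U = (\<Sum>e\<in>UNIV. \<Sum>j | j dvd n. card (slice U e j))"
proof -
  have fin: "finite U" by (rule finite_subset[OF assms(2)]) (simp add: finite_nth_roots_unity[OF assms(1)])
  have finD: "finite {j. j dvd n}" using assms(1) by simp
  have finS: "finite (slice U e j)" for e j
    by (rule finite_subset[of _ "fst ` U"]) (use fin in \<open>force simp: slice_def\<close>)+
  have "U = (\<Union>e\<in>UNIV. (\<lambda>z. (z, e)) ` {z. (z, e) \<in> U})" by auto
  then have "card U = card (\<Union>e\<in>UNIV. (\<lambda>z. (z, e)) ` {z. (z, e) \<in> U})" by simp
  also have "\<dots> = (\<Sum>e\<in>UNIV. card ((\<lambda>z. (z, e)) ` {z. (z, e) \<in> U}))"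
    by (rule card_UN_disjoint) (auto intro!: finite_imageI finite_subset[of _ "fst ` U"] simp: fin image_iff Bex_def)
  also have "\<dots> = (\<Sum>e\<in>UNIV. card {z. (z, e) \<in> U})"
    by (intro sum.cong refl card_image) (auto simp: inj_on_def)
  also have "\<dots> = (\<Sum>e\<in>UNIV. \<Sum>j | j dvd n. card (slice U e j))"
  proof (rule sum.cong[OF refl])
    fix e :: bool
    have "{z. (z, e) \<in> U} = (\<Union>j\<in>{j. j dvd n}. slice U e j)"
      using assms(2) nth_roots_eq_UN_prim_roots[OF assms(1), where 'a = 'a] unfolding slice_def by blast
    then show "card {z. (z, e) \<in> U} = (\<Sum>j | j dvd n. card (slice U e j))"
      using prim_roots_disjoint slice_subset
      by (simp only:) (rule card_UN_disjoint, use finD finS in \<open>auto simp: slice_def dest: prim_roots_disjoint\<close>)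
  qed
  finally show ?thesis .
qed

definition hull_types :: "nat \<Rightarrow> (nat \<times> nat) set" where
  "hull_types n = {(k1, k2). \<exists>a1 a2 b1 b2 c1 c2 :: nat \<Rightarrow> nat.
       (\<forall>j. j dvd n \<and> j \<notin> N2 \<longrightarrow>
          a1 j \<le> beta j \<and> a2 j \<le> beta j \<and>
          c1 j \<le> 2 * (beta j - a1 j) \<and> c2 j \<le> 2 * (beta j - a2 j)) \<and>
       (\<forall>j. j dvd n \<and> j \<in> N2 \<longrightarrow> b1 j \<le> gamma j \<and> b2 j \<le> gamma j) \<and>
       k1 = (\<Sum>j | j dvd n \<and> j \<notin> N2. ord j 2 * a1 j)
          + (\<Sum>j | j dvd n \<and> j \<notin> N2. ord j 2 * a2 j) \<and>
       k2 = (\<Sum>j | j dvd n \<and> j \<in> N2. ord j 2 * b1 j)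
          + (\<Sum>j | j dvd n \<and> j \<in> N2. ord j 2 * b2 j)
          + (\<Sum>j | j dvd n \<and> j \<notin> N2. ord j 2 * c1 j)
          + (\<Sum>j | j dvd n \<and> j \<notin> N2. ord j 2 * c2 j)}"

lemma sum_divisors_split_N2:
  fixes f :: "nat \<Rightarrow> nat"
  assumes "n > 0"
  shows "(\<Sum>j | j dvd n. f j) = (\<Sum>j | j dvd n \<and> j \<in> N2. f j) + (\<Sum>j | j dvd n \<and> j \<notin> N2. f j)"
proof -
  have "(\<Sum>j | j dvd n. f j) = sum f ({j. j dvd n \<and> j \<in> N2} \<union> {j. j dvd n \<and> j \<notin> N2})"
    by (rule arg_cong[of _ _ "sum f"]) auto
  also have "\<dots> = (\<Sum>j | j dvd n \<and> j \<in> N2. f j) + (\<Sum>j | j dvd n \<and> j \<notin> N2. f j)"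
    using assms by (intro sum.union_disjoint) auto
  finally show ?thesis .
qed

lemma of_nat_odd_neq_0:
  assumes "(2 :: 'a :: comm_ring_1) = 0" "odd j"
  shows "of_nat j = (1 :: 'a)"
proof -
  obtain k where "j = 2 * k + 1" using assms(2) by (rule oddE)
  then show ?thesis using assms(1) by simp
qed

text \<open>Slicing by order and component commutes with inversion and differences. So a pair (S, T)
  is an independent choice of one squaring-closed pair per slice, and the cardinalities add
  up.\<close>

lemma hull_types_iff:
  assumes n: "n > 0" "odd n" and two: "(2 :: 'a :: alg_closed_field) = 0"
  shows "(k1, k2) \<in> hull_types n \<longleftrightarrow>
    (\<exists>S T :: ('a \<times> bool) set. pair_sq_closed S \<and> pair_sq_closed T \<and> S \<subseteq> T \<and>
       T \<subseteq> {z. z ^ n = 1} \<times> UNIV \<and>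
       card (S - pair_inverse ` T) = k1 \<and> card (T - pair_inverse ` S) = k1 + k2)"
    (is "_ \<longleftrightarrow> ?R")
proof
  have odd_dvd: "odd j" if "j dvd n" for j using that n(2) dvd_trans by blast
  have nz: "of_nat j \<noteq> (0 :: 'a)" if "j dvd n" for j
    using of_nat_odd_neq_0[OF two odd_dvd[OF that]] by simp
  {
    assume "(k1, k2) \<in> hull_types n"
    then obtain a1 a2 b1 b2 c1 c2 where par:
      "\<And>j. j dvd n \<Longrightarrow> j \<notin> N2 \<Longrightarrow> a1 j \<le> beta j \<and> a2 j \<le> beta j \<and>
          c1 j \<le> 2 * (beta j - a1 j) \<and> c2 j \<le> 2 * (beta j - a2 j)"
      "\<And>j. j dvd n \<Longrightarrow> j \<in> N2 \<Longrightarrow> b1 j \<le> gamma j \<and> b2 j \<le> gamma j"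
      and k1: "k1 = (\<Sum>j | j dvd n \<and> j \<notin> N2. ord j 2 * a1 j)
          + (\<Sum>j | j dvd n \<and> j \<notin> N2. ord j 2 * a2 j)"
      and k2: "k2 = (\<Sum>j | j dvd n \<and> j \<in> N2. ord j 2 * b1 j)
          + (\<Sum>j | j dvd n \<and> j \<in> N2. ord j 2 * b2 j)
          + (\<Sum>j | j dvd n \<and> j \<notin> N2. ord j 2 * c1 j)
          + (\<Sum>j | j dvd n \<and> j \<notin> N2. ord j 2 * c2 j)"
      unfolding hull_types_def by blast
    \<comment> \<open>Index 1 belongs to the component v = 0 and index 2 to v = 1.\<close>
    define a where "a e = (if e then a2 else a1)" for e
    define b where "b e = (if e then b2 else b1)" for e
    define c where "c e = (if e then c2 else c1)" for e
    \<comment> \<open>The prescribed slice sizes of the two hull sets. The second set is counted by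
      k1 + k2, hence the \<open>a e j + c e j\<close> in \<open>q\<close>.\<close>
    define p where "p e j = (if j \<in> N2 then 0 else ord j 2 * a e j)" for e j
    define q where "q e j = (if j \<in> N2 then ord j 2 * b e j else ord j 2 * (a e j + c e j))" for e j
    \<comment> \<open>Vacuous unless j divides n, so that the choice functions \<open>S\<close> and
      \<open>T\<close> become total.\<close>
    define P where "P e j S T \<longleftrightarrow> (j dvd n \<longrightarrow> sq_closed S \<and> sq_closed T \<and> S \<subseteq> T \<and> T \<subseteq> prim_roots j \<and>
      card (S - inverse ` T) = p e j \<and> card (T - inverse ` S) = q e j)" for e j and S T :: "'a set"
    have ex: "\<exists>S T. P e j S T" for e j
    proof (cases "j dvd n")
      case True
      show ?thesis
      proof (cases "j \<in> N2")
        case N2: True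
        have "b e j \<le> gamma j" using par(2)[OF True N2] by (simp add: b_def)
        then show ?thesis using ex_sq_closed_cards_N2[OF odd_dvd nz N2, OF True True] N2
          by (simp add: p_def q_def P_def)
      next
        case N2: False
        have "a e j \<le> beta j" "c e j \<le> 2 * (beta j - a e j)"
          using par(1)[OF True N2] by (simp_all add: a_def c_def)
        then show ?thesis using ex_sq_closed_cards_not_N2[OF odd_dvd nz N2, OF True True] N2
          by (simp add: p_def q_def P_def)
      qed
    qed (simp add: P_def)
    obtain S T where "\<And>e j. P e j (S e j) (T e j)" using ex by metis
    then have ST:
      "j dvd n \<Longrightarrow> sq_closed (S e j) \<and> sq_closed (T e j) \<and> S e j \<subseteq> T e j \<and> T e j \<subseteq> prim_roots j \<and>
      card (S e j - inverse ` T e j) = p e j \<and> card (T e j - inverse ` S e j) = q e j" for e j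
      unfolding P_def by blast
    \<comment> \<open>Reassembles the sets chosen for each order and component into one set of
      pairs.\<close>
    define glue where "glue F = {(z, e). \<exists>j. j dvd n \<and> z \<in> F e j}" for F :: "bool \<Rightarrow> nat \<Rightarrow> 'a set"
    have slice_glue: "slice (glue F) e j = F e j"
      if "\<And>e j. j dvd n \<Longrightarrow> F e j \<subseteq> prim_roots j" "j dvd n" for F e j
      using that prim_roots_disjoint unfolding slice_def glue_def by blast
    have sub: "S e j \<subseteq> prim_roots j" "T e j \<subseteq> prim_roots j" if "j dvd n" for e j
      using ST[OF that] by blast+
    have sl: "slice (glue S) e j = S e j" "slice (glue T) e j = T e j" if "j dvd n" for e j
      using slice_glue that sub by blast+
    have mu: "glue T \<subseteq> {z. z ^ n = 1} \<times> UNIV"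
      using sub(2) unfolding nth_roots_eq_UN_prim_roots[OF n(1)] glue_def by blast
    have ST': "glue S \<subseteq> glue T" using ST unfolding glue_def by blast
    have UB: "(UNIV :: bool set) = {False, True}" by auto
    have "card (glue S - pair_inverse ` glue T) = (\<Sum>e\<in>UNIV. \<Sum>j | j dvd n. p e j)"
      using mu ST' ST by (subst card_eq_sum_slices[OF n(1)]) (auto simp: slice_Diff_inverse sl intro!: sum.cong)
    also have "\<dots> = k1" unfolding sum_divisors_split_N2[OF n(1)] k1 p_def a_def UB by simp
    finally have K1: "card (glue S - pair_inverse ` glue T) = k1" .
    have "card (glue T - pair_inverse ` glue S) = (\<Sum>e\<in>UNIV. \<Sum>j | j dvd n. q e j)"
      using mu ST' ST by (subst card_eq_sum_slices[OF n(1)]) (auto simp: slice_Diff_inverse sl intro!: sum.cong)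
    also have "\<dots> = k1 + k2" unfolding sum_divisors_split_N2[OF n(1)] k1 k2 q_def a_def b_def c_def UB
      by (simp add: sum.distrib distrib_left)
    finally have K2: "card (glue T - pair_inverse ` glue S) = k1 + k2" .
    have "pair_sq_closed (glue S)" "pair_sq_closed (glue T)"
      using ST unfolding pair_sq_closed_def sq_closed_def glue_def by blast+
    then show ?R using ST' mu K1 K2 by blast
  }
  {
    assume ?R
    then obtain S T :: "('a \<times> bool) set" where ST: "pair_sq_closed S" "pair_sq_closed T" "S \<subseteq> T"
      and mu: "T \<subseteq> {z. z ^ n = 1} \<times> UNIV"
      and K: "card (S - pair_inverse ` T) = k1" "card (T - pair_inverse ` S) = k1 + k2" by blast
    define p where "p e j = card (slice S e j - inverse ` slice T e j)" for e j
    define q where "q e j = card (slice T e j - inverse ` slice S e j)" for e j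
    have k1: "k1 = (\<Sum>e\<in>UNIV. \<Sum>j | j dvd n. p e j)"
      using mu ST(3) unfolding p_def K(1)[symmetric] slice_Diff_inverse[symmetric]
      by (intro card_eq_sum_slices[OF n(1)]) blast
    have k2: "k1 + k2 = (\<Sum>e\<in>UNIV. \<Sum>j | j dvd n. q e j)"
      using mu ST(3) unfolding q_def K(2)[symmetric] slice_Diff_inverse[symmetric]
      by (intro card_eq_sum_slices[OF n(1)]) blast
    define P where "P e j a b c \<longleftrightarrow> (j dvd n \<longrightarrow> (j \<notin> N2 \<longrightarrow> a \<le> beta j \<and> c \<le> 2 * (beta j - a) \<and>
        p e j = ord j 2 * a \<and> q e j = ord j 2 * (a + c)) \<and>
      (j \<in> N2 \<longrightarrow> b \<le> gamma j \<and> p e j = 0 \<and> q e j = ord j 2 * b))" for e j a b c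
    have ex: "\<exists>a b c. P e j a b c" for e j
    proof (cases "j dvd n")
      case True
      note cl = sq_closed_slice[OF ST(1) odd_dvd[OF True], of e] sq_closed_slice[OF ST(2) odd_dvd[OF True], of e]
        slice_mono[OF ST(3)] slice_subset[of T e j]
      show ?thesis
      proof (cases "j \<in> N2")
        case N2: True
        obtain b where b: "slice S e j - inverse ` slice T e j = {}" "b \<le> gamma j" "q e j = ord j 2 * b"
          using sq_closed_cards_N2[OF odd_dvd nz N2 cl, OF True True] unfolding q_def by blast
        have "p e j = 0" unfolding p_def b(1) by simp
        then show ?thesis using b N2 unfolding P_def by blast
      next
        case N2: False
        show ?thesis using sq_closed_cards_not_N2[OF odd_dvd nz N2 cl, OF True True] N2
          unfolding p_def q_def P_def by blast
      qed
    qed (simp add: P_def)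
    obtain a b c where "\<And>e j. P e j (a e j) (b e j) (c e j)" using ex by metis
    then have abc:
      "j dvd n \<Longrightarrow> j \<notin> N2 \<Longrightarrow> a e j \<le> beta j \<and> c e j \<le> 2 * (beta j - a e j) \<and>
        p e j = ord j 2 * a e j \<and> q e j = ord j 2 * (a e j + c e j)"
      "j dvd n \<Longrightarrow> j \<in> N2 \<Longrightarrow> b e j \<le> gamma j \<and> p e j = 0 \<and> q e j = ord j 2 * b e j" for e j
      unfolding P_def by blast+
    have UB: "(UNIV :: bool set) = {False, True}" by auto
    have K1: "k1 = (\<Sum>j | j dvd n \<and> j \<notin> N2. ord j 2 * a False j)
          + (\<Sum>j | j dvd n \<and> j \<notin> N2. ord j 2 * a True j)"
      unfolding k1 sum_divisors_split_N2[OF n(1)] UB using abc by simp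
    have "k1 + k2 = (\<Sum>j | j dvd n \<and> j \<in> N2. ord j 2 * b False j)
          + (\<Sum>j | j dvd n \<and> j \<in> N2. ord j 2 * b True j)
          + (\<Sum>j | j dvd n \<and> j \<notin> N2. ord j 2 * (a False j + c False j))
          + (\<Sum>j | j dvd n \<and> j \<notin> N2. ord j 2 * (a True j + c True j))"
      unfolding k2 sum_divisors_split_N2[OF n(1)] UB using abc by simp
    then have K2: "k2 = (\<Sum>j | j dvd n \<and> j \<in> N2. ord j 2 * b False j)
          + (\<Sum>j | j dvd n \<and> j \<in> N2. ord j 2 * b True j)
          + (\<Sum>j | j dvd n \<and> j \<notin> N2. ord j 2 * c False j)
          + (\<Sum>j | j dvd n \<and> j \<notin> N2. ord j 2 * c True j)"
      using K1 by (simp add: distrib_left sum.distrib)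
    show "(k1, k2) \<in> hull_types n"
      unfolding hull_types_def mem_Collect_eq prod.case
      by (rule exI[of _ "a False"], rule exI[of _ "a True"], rule exI[of _ "b False"],
          rule exI[of _ "b True"], rule exI[of _ "c False"], rule exI[of _ "c True"])
        (use abc K1 K2 in blast)
  }
qed

section \<open>Types of codes as modules over \<open>Z_4\<close>\<close>

lemma four_cases: "(a :: 4) \<in> {0, 1, 2, 3}"
proof (cases a rule: bit0_cases)
  case (of_int z)
  then have "z = 0 \<or> z = 1 \<or> z = 2 \<or> z = 3" by simp arith
  then show ?thesis using of_int by auto
qed

lemma two_cases: "(b :: 2) \<in> {0, 1}"
proof (cases b rule: bit0_cases)
  case (of_int z)
  then have "z = 0 \<or> z = 1" by simp arith
  then show ?thesis using of_int by auto
qed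

lemma const_z4v_0 [simp]: "const_z4v 0 = 0" by transfer simp
lemma const_z4v_1 [simp]: "const_z4v 1 = 1" by transfer (simp add: one_pCons)
lemma const_z4v_add: "const_z4v (a + b) = const_z4v a + const_z4v b" by transfer simp
lemma const_z4v_mult: "const_z4v (a * b) = const_z4v a * const_z4v b" by transfer simp

lemma four_eq_0_z4v [simp]: "(4 :: z4v) = 0"
proof -
  have "(4 :: z4v) = const_z4v (1 + 1 + 1 + 1)" unfolding const_z4v_add by simp
  also have "(1 + 1 + 1 + 1 :: 4) = 0" by simp
  finally show ?thesis by simp
qed

lemma red2_values: "red2 0 = 0" "red2 1 = 1" "red2 2 = 0" "red2 3 = 1"
  using red2_of_int[of 0] red2_of_int[of 1] red2_of_int[of 2] red2_of_int[of 3] by simp_all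

lemma red2_add: "red2 (a + b) = red2 a + red2 b"
proof -
  obtain y z where "a = of_int y" "b = of_int z" by (metis bit0_cases)
  then show ?thesis by (metis red2_of_int of_int_add)
qed

lemma add_self_two [simp]: "(b :: 2) + b = 0"
  using two_cases[of b] by auto

lemma card_vec_entries:
  fixes A :: "'a set"
  shows "finite A \<Longrightarrow> card {v \<in> carrier_vec k. \<forall>i<k. v $ i \<in> A} = card A ^ k"
  "finite A \<Longrightarrow> finite {v \<in> carrier_vec k. \<forall>i<k. v $ i \<in> A}"
proof -
  have bij: "bij_betw (\<lambda>f. vec k f) ({..<k} \<rightarrow>\<^sub>E A) {v \<in> carrier_vec k. \<forall>i<k. v $ i \<in> A}"
  proof (rule bij_betw_byWitness[where f' = "\<lambda>v :: 'a vec. \<lambda>i\<in>{..<k}. v $ i"])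
    show "\<forall>f\<in>{..<k} \<rightarrow>\<^sub>E A. (\<lambda>i\<in>{..<k}. vec k f $ i) = f"
    proof
      fix f assume f: "f \<in> {..<k} \<rightarrow>\<^sub>E A"
      have "(\<lambda>i\<in>{..<k}. vec k f $ i) i = f i" for i
        using PiE_arb[OF f, of i] by (cases "i < k") simp_all
      then show "(\<lambda>i\<in>{..<k}. vec k f $ i) = f" by blast
    qed
    show "\<forall>v\<in>{v \<in> carrier_vec k. \<forall>i<k. v $ i \<in> A}. vec k (\<lambda>i\<in>{..<k}. v $ i) = v"
      by (intro ballI eq_vecI) auto
    show "(\<lambda>f. vec k f) ` ({..<k} \<rightarrow>\<^sub>E A) \<subseteq> {v \<in> carrier_vec k. \<forall>i<k. v $ i \<in> A}"
    proof (rule image_subsetI)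
      fix f assume f: "f \<in> {..<k} \<rightarrow>\<^sub>E A"
      have "f i \<in> A" if "i < k" for i using PiE_mem[OF f, of i] that by simp
      then show "vec k f \<in> {v \<in> carrier_vec k. \<forall>i<k. v $ i \<in> A}" by simp
    qed
    show "(\<lambda>v :: 'a vec. \<lambda>i\<in>{..<k}. v $ i) ` {v \<in> carrier_vec k. \<forall>i<k. v $ i \<in> A} \<subseteq> {..<k} \<rightarrow>\<^sub>E A"
      by (intro image_subsetI PiE_I) simp_all
  qed
  show "finite A \<Longrightarrow> card {v \<in> carrier_vec k. \<forall>i<k. v $ i \<in> A} = card A ^ k"
    using bij_betw_same_card[OF bij] by (simp add: card_PiE)
  show "finite A \<Longrightarrow> finite {v \<in> carrier_vec k. \<forall>i<k. v $ i \<in> A}"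
    using bij_betw_finite[OF bij] by (simp add: finite_PiE)
qed

lemma card_carrier_vec_finite:
  "card (carrier_vec k :: 'a :: finite vec set) = CARD('a) ^ k"
  "finite (carrier_vec k :: 'a :: finite vec set)"
  using card_vec_entries[of "UNIV :: 'a set" k] by (simp_all)

lemma card_double_carrier_vec:
  "card ((\<lambda>a. a + a) ` (carrier_vec k :: 4 vec set)) = 2 ^ k"
proof -
  have "(\<lambda>a. a + a) ` (carrier_vec k :: 4 vec set) = {v \<in> carrier_vec k. \<forall>i<k. v $ i \<in> {0, 2}}"
  proof (intro equalityI subsetI)
    fix v :: "4 vec" assume "v \<in> (\<lambda>a. a + a) ` carrier_vec k"
    then obtain a where a: "a \<in> carrier_vec k" "v = a + a" by blast
    have "a $ i + a $ i \<in> {0, 2}" for i using four_cases[of "a $ i"] by auto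
    then show "v \<in> {v \<in> carrier_vec k. \<forall>i<k. v $ i \<in> {0, 2}}" using a by auto
  next
    fix v :: "4 vec" assume v: "v \<in> {v \<in> carrier_vec k. \<forall>i<k. v $ i \<in> {0, 2}}"
    let ?a = "vec k (\<lambda>i. if v $ i = 0 then 0 else 1) :: 4 vec"
    have "v = ?a + ?a" using v by (intro eq_vecI) auto
    then show "v \<in> (\<lambda>a. a + a) ` carrier_vec k" by (intro image_eqI[of _ _ ?a]) auto
  qed
  also have "card \<dots> = card {0, 2 :: 4} ^ k" by (rule card_vec_entries) simp
  finally show ?thesis by (simp add: numeral_2_eq_2)
qed

section \<open>Structure of finite Z_4-modules\<close>

definition add_closed :: "'g :: ab_group_add set \<Rightarrow> bool" where
  "add_closed H \<longleftrightarrow> 0 \<in> H \<and> (\<forall>x\<in>H. \<forall>y\<in>H. x + y \<in> H \<and> x - y \<in> H)"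

lemma add_closedD:
  assumes "add_closed H"
  shows "0 \<in> H" "x \<in> H \<Longrightarrow> y \<in> H \<Longrightarrow> x + y \<in> H" "x \<in> H \<Longrightarrow> y \<in> H \<Longrightarrow> x - y \<in> H"
  using assms by (auto simp: add_closed_def)

lemma add_closed_sum: "add_closed H \<Longrightarrow> (\<And>i. i \<in> I \<Longrightarrow> f i \<in> H) \<Longrightarrow> sum f I \<in> H"
  by (induction I rule: infinite_finite_induct) (auto simp: add_closed_def)

text \<open>All nonempty fibres of doubling are cosets of its kernel.\<close>

lemma card_eq_card_double_times_kernel:
  fixes H :: "'g :: ab_group_add set"
  assumes H: "add_closed H" and fin: "finite H"
  shows "card H = card ((\<lambda>h. h + h) ` H) * card {h \<in> H. h + h = 0}"
proof -
  let ?K = "{h \<in> H. h + h = 0}"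
  have "card H = (\<Sum>d\<in>(\<lambda>h. h + h) ` H. card {h \<in> H. h + h = d})"
    using sum.image_gen[OF fin, of "\<lambda>_. 1 :: nat" "\<lambda>h. h + h"] by simp
  also have "\<dots> = (\<Sum>d\<in>(\<lambda>h. h + h) ` H. card ?K)"
  proof (rule sum.cong[OF refl])
    fix d assume "d \<in> (\<lambda>h. h + h) ` H"
    then obtain x where x: "x \<in> H" "d = x + x" by blast
    have "bij_betw (\<lambda>h. h + x) ?K {h \<in> H. h + h = d}"
      by (rule bij_betw_byWitness[where f' = "\<lambda>h. h - x"])
        (use x add_closedD[OF H] in \<open>auto simp: algebra_simps\<close>)
    then show "card {h \<in> H. h + h = d} = card ?K" by (simp add: bij_betw_same_card)
  qed
  finally show ?thesis by simp
qed

text \<open>Linear algebra over the field with two elements: adjoining an element outside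
  \<open>L\<close> doubles \<open>L\<close>. Independence of the \<open>y i\<close> is encoded in
  the cardinality equation, which together with spanning is all that is used later.\<close>

lemma ex_complement_basis:
  fixes G L :: "'g :: ab_group_add set"
  assumes "finite G" "add_closed G" "add_closed L" "L \<subseteq> G" "\<And>g. g \<in> G \<Longrightarrow> g + g = 0"
  shows "\<exists>k y. (\<forall>i<k. y i \<in> G) \<and> card G = card L * 2 ^ k \<and>
    (\<forall>g\<in>G. \<exists>l\<in>L. \<exists>B\<subseteq>{..<k}. g = l + (\<Sum>i\<in>B. y i))"
  using assms(3,4)
proof (induction "card G - card L" arbitrary: L rule: less_induct)
  case less
  note L = less.prems(1) and LG = less.prems(2)
  show ?case
  proof (cases "L = G")
    case True
    then show ?thesis by (intro exI[of _ 0] exI[of _ "\<lambda>_. 0"]) auto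
  next
    case False
    then obtain z where z: "z \<in> G" "z \<notin> L" using LG by blast
    let ?M = "(\<lambda>l. l + z) ` L"
    have zz: "z + z = 0" using assms(5) z(1) by blast
    have finL: "finite L" using LG assms(1) finite_subset by blast
    have disj: "L \<inter> ?M = {}"
    proof -
      have "l + z \<notin> L" if "l \<in> L" for l
        using add_closedD(3)[OF L, of "l + z" l] that z(2) by auto
      then show ?thesis by auto
    qed
    have "card (L \<union> ?M) = card L + card ?M" using disj finL by (intro card_Un_disjoint) auto
    also have "card ?M = card L" by (intro card_image inj_onI) simp
    finally have card: "card (L \<union> ?M) = card L * 2" by simp
    have eqs: "x + z + (y + z) = x + y" "x - (y + z) = x - y + z" "x + z - (y + z) = x - y" for x y
      using zz by (simp_all add: algebra_simps)
    have mem: "l \<in> L \<union> ?M" "l + z \<in> L \<union> ?M" if "l \<in> L" for l using that by simp_all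
    have M: "add_closed (L \<union> ?M)"
      unfolding add_closed_def
    proof (intro conjI ballI)
      show "0 \<in> L \<union> ?M" using add_closedD[OF L] by blast
      fix x y assume "x \<in> L \<union> ?M" "y \<in> L \<union> ?M"
      then obtain u v where uv: "u \<in> L" "x = u \<or> x = u + z" "v \<in> L" "y = v \<or> y = v + z" by blast
      have "x + y = u + v \<or> x + y = u + v + z"
        using uv(2,4) by (elim disjE) (simp_all only: eqs, simp_all add: ac_simps)
      then show "x + y \<in> L \<union> ?M" using mem[OF add_closedD(2)[OF L uv(1,3)]] by metis
      have "x - y = u - v \<or> x - y = u - v + z"
        using uv(2,4) by (elim disjE) (simp_all only: eqs, simp_all add: algebra_simps zz)
      then show "x - y \<in> L \<union> ?M" using mem[OF add_closedD(3)[OF L uv(1,3)]] by metis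
    qed
    have MG: "L \<union> ?M \<subseteq> G" using LG z(1) add_closedD(2)[OF assms(2)] by auto
    have "card L < card (L \<union> ?M)" using card finL add_closedD(1)[OF L] by (auto simp: card_gt_0_iff)
    moreover have "card (L \<union> ?M) \<le> card G" by (rule card_mono[OF assms(1) MG])
    ultimately have "card G - card (L \<union> ?M) < card G - card L" by linarith
    from less.hyps[OF this M MG] obtain k y where y: "\<forall>i<k. y i \<in> G" "card G = card (L \<union> ?M) * 2 ^ k"
      "\<forall>g\<in>G. \<exists>l\<in>L \<union> ?M. \<exists>B\<subseteq>{..<k}. g = l + (\<Sum>i\<in>B. y i)" by (elim exE conjE)
    define y' where "y' = y(k := z)"
    have "\<exists>l\<in>L. \<exists>B\<subseteq>{..<Suc k}. g = l + (\<Sum>i\<in>B. y' i)" if g: "g \<in> G" for g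
    proof -
      obtain l B where l: "l \<in> L \<union> ?M" "B \<subseteq> {..<k}" "g = l + (\<Sum>i\<in>B. y i)" using bspec[OF y(3) g] by (elim bexE exE conjE)
      have eq: "(\<Sum>i\<in>B. y' i) = (\<Sum>i\<in>B. y i)" using l(2) by (intro sum.cong) (auto simp: y'_def)
      from l(1) show ?thesis
      proof
        assume "l \<in> L"
        then show ?thesis using l eq by (intro bexI[of _ l] exI[of _ B]) auto
      next
        assume "l \<in> ?M"
        then obtain m where m: "m \<in> L" "l = m + z" by blast
        have "finite B" "k \<notin> B" using l(2) finite_subset by auto
        then have "(\<Sum>i\<in>insert k B. y' i) = z + (\<Sum>i\<in>B. y i)" by (simp add: eq) (simp add: y'_def)
        then have "g = m + (\<Sum>i\<in>insert k B. y' i)" using l(3) m(2) by (simp add: add.assoc)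
        moreover have "insert k B \<subseteq> {..<Suc k}" using l(2) by auto
        ultimately show ?thesis using m(1) by blast
      qed
    qed
    moreover have "\<forall>i<Suc k. y' i \<in> G" using y(1) z(1) by (auto simp: y'_def less_Suc_eq)
    moreover have "card G = card L * 2 ^ Suc k" using y(2) card by simp
    ultimately show ?thesis by (intro exI[of _ "Suc k"] exI[of _ y'] conjI ballI)
  qed
qed

lemma smult_sum_right: "smult c (\<Sum>i\<in>I. f i) = (\<Sum>i\<in>I. smult c (f i))"
  by (induction I rule: infinite_finite_induct) (simp_all add: smult_add_right)

lemma smult_const_z4v_values:
  "smult (const_z4v 2) h = h + h" "smult (const_z4v 3) h = h + h + h"
proof -
  have "const_z4v 2 = 1 + 1" "const_z4v 3 = 1 + 1 + 1"
    using const_z4v_add[of 1 1] const_z4v_add[of 2 1] by simp_all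
  then show "smult (const_z4v 2) h = h + h" "smult (const_z4v 3) h = h + h + h"
    by (simp_all only: smult_add_left smult_1_left)
qed

lemma smult_const_z4v_in:
  assumes "add_closed H" "h \<in> H" shows "smult (const_z4v a) h \<in> H"
proof -
  have "h + h \<in> H" by (rule add_closedD(2)[OF assms(1) assms(2) assms(2)])
  moreover from this have "h + h + h \<in> H" by (rule add_closedD(2)[OF assms(1) _ assms(2)])
  ultimately show ?thesis using four_cases[of a] add_closedD(1)[OF assms(1)] assms(2)
    by (auto simp: smult_const_z4v_values)
qed

lemma smult_z4v_four: "h + h + (h + h) = (0 :: z4v poly)"
proof -
  have "h + h + (h + h) = smult (1 + 1 + (1 + 1)) h" by (simp only: smult_add_left smult_1_left)
  then show ?thesis by simp
qed

text \<open>The candidate isomorphism. In the second sum an element of Z_2 acts on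
  \<open>y j\<close>, which is additive only if \<open>y j + y j = 0\<close>; hence that hypothesis
  in the two lemmas below.\<close>

definition z4_comb :: "nat \<Rightarrow> nat \<Rightarrow> (nat \<Rightarrow> z4v poly) \<Rightarrow> (nat \<Rightarrow> z4v poly) \<Rightarrow> 4 vec \<times> 2 vec \<Rightarrow> z4v poly" where
  "z4_comb k1 k2 x y = (\<lambda>(a, b). (\<Sum>i<k1. smult (const_z4v (a $ i)) (x i)) + (\<Sum>j<k2. if b $ j = 0 then 0 else y j))"

lemma z4_comb_add:
  assumes "a \<in> carrier_vec k1" "a' \<in> carrier_vec k1" "b \<in> carrier_vec k2" "b' \<in> carrier_vec k2"
    and y: "\<And>j. j < k2 \<Longrightarrow> y j + y j = 0"
  shows "z4_comb k1 k2 x y (a + a', b + b') = z4_comb k1 k2 x y (a, b) + z4_comb k1 k2 x y (a', b')"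
proof -
  have 1: "(\<Sum>i<k1. smult (const_z4v ((a + a') $ i)) (x i)) =
      (\<Sum>i<k1. smult (const_z4v (a $ i)) (x i)) + (\<Sum>i<k1. smult (const_z4v (a' $ i)) (x i))"
    unfolding sum.distrib[symmetric] using assms by (intro sum.cong) (auto simp: const_z4v_add smult_add_left)
  have "(if b $ j + b' $ j = 0 then 0 else y j) = (if b $ j = 0 then 0 else y j) + (if b' $ j = 0 then 0 else y j)"
    if "j < k2" for j
    using two_cases[of "b $ j"] two_cases[of "b' $ j"] y[OF that] by auto
  then have 2: "(\<Sum>j<k2. if (b + b') $ j = 0 then 0 else y j) =
      (\<Sum>j<k2. if b $ j = 0 then 0 else y j) + (\<Sum>j<k2. if b' $ j = 0 then 0 else y j)"
    unfolding sum.distrib[symmetric] using assms by (intro sum.cong) auto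
  show ?thesis by (simp add: z4_comb_def 1 2 algebra_simps)
qed

lemma z4_comb_smult:
  assumes "a \<in> carrier_vec k1" "b \<in> carrier_vec k2" and y: "\<And>j. j < k2 \<Longrightarrow> y j + y j = 0"
  shows "z4_comb k1 k2 x y (c \<cdot>\<^sub>v a, red2 c \<cdot>\<^sub>v b) = smult (const_z4v c) (z4_comb k1 k2 x y (a, b))"
proof -
  have 1: "(\<Sum>i<k1. smult (const_z4v ((c \<cdot>\<^sub>v a) $ i)) (x i)) =
      smult (const_z4v c) (\<Sum>i<k1. smult (const_z4v (a $ i)) (x i))"
    unfolding smult_sum_right using assms by (intro sum.cong) (auto simp: const_z4v_mult)
  have "(if red2 c * b $ j = 0 then 0 else y j) = smult (const_z4v c) (if b $ j = 0 then 0 else y j)"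
    if "j < k2" for j
  proof -
    have "smult (const_z4v 2) (y j) = 0" "smult (const_z4v 3) (y j) = y j"
      unfolding smult_const_z4v_values y[OF that] by simp_all
    then show ?thesis
      using four_cases[of c] two_cases[of "b $ j"] by (auto simp: red2_values)
  qed
  then have 2: "(\<Sum>j<k2. if (red2 c \<cdot>\<^sub>v b) $ j = 0 then 0 else y j) =
      smult (const_z4v c) (\<Sum>j<k2. if b $ j = 0 then 0 else y j)"
    unfolding smult_sum_right using assms by (intro sum.cong) auto
  show ?thesis by (simp add: z4_comb_def 1 2 smult_add_right)
qed

lemma sum_subset_if:
  "B \<subseteq> {..<k} \<Longrightarrow> (\<Sum>i<(k::nat). if i \<in> B then f i else 0) = (\<Sum>i\<in>B. f i :: 'g :: comm_monoid_add)"
  by (subst sum.inter_restrict[symmetric]) (auto simp: Int_absorb1)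

text \<open>Let D = 2H, contained in the kernel K of doubling. A basis of D is lifted to elements
  x_i with z_i = 2 x_i, and D is extended to K by elements y_j. Surjectivity is shown directly;
  injectivity follows because |H| = |D| |K| = 4^k1 2^k2.\<close>

lemma ex_z4_comb_bij:
  assumes H: "add_closed H" and fin: "finite H"
  shows "\<exists>k1 k2 x y. (\<forall>j<k2. y j + y j = 0) \<and>
    bij_betw (z4_comb k1 k2 x y) (carrier_vec k1 \<times> carrier_vec k2) H"
proof -
  define D where "D = (\<lambda>h. h + h) ` H"
  define K where "K = {h \<in> H. h + h = 0}"
  have clD: "add_closed D"
    unfolding add_closed_def
  proof (intro conjI ballI)
    show "0 \<in> D" unfolding D_def using add_closedD(1)[OF H] by force
    fix d e assume "d \<in> D" "e \<in> D"
    then obtain g h where gh: "g \<in> H" "h \<in> H" "d = g + g" "e = h + h" unfolding D_def by blast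
    have "d + e = (g + h) + (g + h)" "d - e = (g - h) + (g - h)" using gh by (simp_all add: algebra_simps)
    then show "d + e \<in> D" "d - e \<in> D" unfolding D_def using gh(1,2) add_closedD[OF H] by blast+
  qed
  have clK: "add_closed K"
    unfolding add_closed_def
  proof (intro conjI ballI)
    show "0 \<in> K" unfolding K_def using add_closedD(1)[OF H] by simp
    fix d e assume de: "d \<in> K" "e \<in> K"
    have "d + e + (d + e) = (d + d) + (e + e)" "d - e + (d - e) = (d + d) - (e + e)" by (simp_all add: algebra_simps)
    then show "d + e \<in> K" "d - e \<in> K" using de add_closedD[OF H] unfolding K_def by auto
  qed
  have DK: "D \<subseteq> K"
    unfolding D_def
  proof (rule image_subsetI)
    fix h assume "h \<in> H"
    then have "h + h \<in> H" by (intro add_closedD(2)[OF H])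
    then show "h + h \<in> K" unfolding K_def using smult_z4v_four[of h] by (intro CollectI conjI)
  qed
  have finD: "finite D" and finK: "finite K" using fin by (simp_all add: D_def K_def)
  have kill: "g + g = 0" if "g \<in> K" for g using that unfolding K_def by blast
  have zero: "add_closed {0 :: z4v poly}" by (simp add: add_closed_def)
  have "\<exists>k y. (\<forall>i<k. y i \<in> D) \<and> card D = card {0 :: z4v poly} * 2 ^ k \<and>
      (\<forall>g\<in>D. \<exists>l\<in>{0}. \<exists>B\<subseteq>{..<k}. g = l + (\<Sum>i\<in>B. y i))"
    by (rule ex_complement_basis) (use finD clD zero add_closedD(1)[OF clD] DK kill in auto)
  then obtain k1 z where z': "\<forall>i<k1. z i \<in> D" "card D = card {0 :: z4v poly} * 2 ^ k1"
      "\<forall>g\<in>D. \<exists>l\<in>{0}. \<exists>B\<subseteq>{..<k1}. g = l + (\<Sum>i\<in>B. z i)" by (elim exE conjE)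
  have z: "i < k1 \<Longrightarrow> z i \<in> D" "card D = 2 ^ k1" "g \<in> D \<Longrightarrow> \<exists>B\<subseteq>{..<k1}. g = (\<Sum>i\<in>B. z i)" for i g
    using z' by simp_all
  have "\<exists>k y. (\<forall>i<k. y i \<in> K) \<and> card K = card D * 2 ^ k \<and>
      (\<forall>g\<in>K. \<exists>l\<in>D. \<exists>B\<subseteq>{..<k}. g = l + (\<Sum>i\<in>B. y i))"
    by (rule ex_complement_basis) (use finK clD clK DK kill in auto)
  then obtain k2 y where y': "\<forall>i<k2. y i \<in> K" "card K = card D * 2 ^ k2"
      "\<forall>g\<in>K. \<exists>l\<in>D. \<exists>B\<subseteq>{..<k2}. g = l + (\<Sum>i\<in>B. y i)" by (elim exE conjE)
  have y: "i < k2 \<Longrightarrow> y i \<in> K" "card K = card D * 2 ^ k2"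
      "g \<in> K \<Longrightarrow> \<exists>l\<in>D. \<exists>B\<subseteq>{..<k2}. g = l + (\<Sum>i\<in>B. y i)" for i g
    using y' by simp_all
  have "\<forall>i. \<exists>x. i < k1 \<longrightarrow> x \<in> H \<and> z i = x + x" using z(1) unfolding D_def by blast
  then obtain x where x: "\<And>i. i < k1 \<Longrightarrow> x i \<in> H \<and> z i = x i + x i" by metis
  let ?V = "carrier_vec k1 \<times> carrier_vec k2 :: (4 vec \<times> 2 vec) set"
  have "z4_comb k1 k2 x y ` ?V = H"
  proof (intro equalityI subsetI)
    fix h assume "h \<in> z4_comb k1 k2 x y ` ?V"
    then obtain a b where h: "h = z4_comb k1 k2 x y (a, b)" by auto
    have "(if b $ j = 0 then 0 else y j) \<in> H" if "j < k2" for j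
      using y(1)[OF that] add_closedD(1)[OF H] unfolding K_def by simp
    then show "h \<in> H" unfolding h z4_comb_def using x smult_const_z4v_in[OF H]
      by (auto intro!: add_closedD(2)[OF H] add_closed_sum[OF H])
  next
    fix h assume h: "h \<in> H"
    then have "h + h \<in> D" unfolding D_def by blast
    then obtain B where B: "B \<subseteq> {..<k1}" "h + h = (\<Sum>i\<in>B. z i)" using z(3) by blast
    \<comment> \<open>Since 2h is the sum of the z_i = 2 x_i over \<open>B\<close>, subtracting
      these x_i leaves an element killed by 2.\<close>
    define g where "g = h - (\<Sum>i\<in>B. x i)"
    have zx: "(\<Sum>i\<in>C. z i) = (\<Sum>i\<in>C. x i + x i)" if "C \<subseteq> {..<k1}" for C
      using that x by (intro sum.cong) auto
    have "g + g = (h + h) - ((\<Sum>i\<in>B. x i) + (\<Sum>i\<in>B. x i))" by (simp add: g_def algebra_simps)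
    also have "\<dots> = 0" unfolding B(2) zx[OF B(1)] sum.distrib by simp
    finally have "g + g = 0" .
    moreover have "g \<in> H" unfolding g_def using h B(1) x
      by (intro add_closedD(3)[OF H] add_closed_sum[OF H]) auto
    ultimately have "g \<in> K" unfolding K_def by blast
    then obtain l B2 where l: "l \<in> D" "B2 \<subseteq> {..<k2}" "g = l + (\<Sum>i\<in>B2. y i)" using y(3) by blast
    then obtain B1 where B1: "B1 \<subseteq> {..<k1}" "l = (\<Sum>i\<in>B1. z i)" using z(3) by blast
    \<comment> \<open>Coefficient 1 comes from \<open>h - g\<close>, and coefficient 2 from the
      component \<open>l\<close> of \<open>g\<close> in \<open>D\<close>, a sum of elements 2
      x_i.\<close>
    define a where "a = vec k1 (\<lambda>i. (if i \<in> B then 1 else 0) + (if i \<in> B1 then 2 else 0) :: 4)"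
    define b where "b = vec k2 (\<lambda>j. if j \<in> B2 then 1 else 0 :: 2)"
    have "(\<Sum>i<k1. smult (const_z4v (a $ i)) (x i)) =
        (\<Sum>i<k1. (if i \<in> B then x i else 0) + (if i \<in> B1 then x i + x i else 0))"
      by (intro sum.cong) (auto simp: a_def const_z4v_add smult_add_left smult_const_z4v_values)
    also have "\<dots> = (\<Sum>i\<in>B. x i) + l"
      unfolding sum.distrib[of "\<lambda>i. if i \<in> B then x i else 0"] B1(2) zx[OF B1(1)]
        sum_subset_if[OF B(1)] sum_subset_if[OF B1(1)] ..
    finally have 1: "(\<Sum>i<k1. smult (const_z4v (a $ i)) (x i)) = (\<Sum>i\<in>B. x i) + l" .
    have "(\<Sum>j<k2. if b $ j = 0 then 0 else y j) = (\<Sum>j<k2. if j \<in> B2 then y j else 0)"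
      by (intro sum.cong) (auto simp: b_def)
    also have "\<dots> = (\<Sum>i\<in>B2. y i)" by (rule sum_subset_if[OF l(2)])
    finally have "h = z4_comb k1 k2 x y (a, b)"
      using 1 l(3) by (simp add: z4_comb_def g_def algebra_simps)
    moreover have "(a, b) \<in> ?V" by (simp add: a_def b_def)
    ultimately show "h \<in> z4_comb k1 k2 x y ` ?V" by blast
  qed
  moreover have "card ?V = card H"
    unfolding card_eq_card_double_times_kernel[OF H fin] D_def[symmetric] K_def[symmetric] y(2) z(2) card_cartesian_product card_carrier_vec_finite
    by (simp add: power_mult_distrib [symmetric])
  ultimately have "bij_betw (z4_comb k1 k2 x y) ?V H"
    by (intro bij_betw_imageI eq_card_imp_inj_on) (auto simp: card_carrier_vec_finite)
  then show ?thesis using y(1) kill by blast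
qed

section \<open>Words as polynomials, and types read off from cardinalities\<close>

definition vec_poly :: "'a :: comm_ring_1 vec \<Rightarrow> 'a poly" where
  "vec_poly v = (\<Sum>i<dim_vec v. monom (v $ i) i)"

lemma coeff_vec_poly: "coeff (vec_poly v) i = (if i < dim_vec v then v $ i else 0)"
  by (simp add: vec_poly_def coeff_sum if_distrib sum.delta cong: if_cong) 

lemma vec_poly_inj: "u \<in> carrier_vec n \<Longrightarrow> v \<in> carrier_vec n \<Longrightarrow> vec_poly u = vec_poly v \<Longrightarrow> u = v"
  by (rule eq_vecI) (metis carrier_vecD coeff_vec_poly)+

lemma vec_poly_add: "u \<in> carrier_vec n \<Longrightarrow> v \<in> carrier_vec n \<Longrightarrow> vec_poly (u + v) = vec_poly u + vec_poly v"
  by (rule poly_eqI) (simp add: coeff_vec_poly)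

lemma vec_poly_minus: "u \<in> carrier_vec n \<Longrightarrow> v \<in> carrier_vec n \<Longrightarrow> vec_poly (u - v) = vec_poly u - vec_poly v"
  by (rule poly_eqI) (simp add: coeff_vec_poly)

lemma vec_poly_smult: "vec_poly (c \<cdot>\<^sub>v u) = smult c (vec_poly u)"
  by (rule poly_eqI) (simp add: coeff_vec_poly)

lemma vec_poly_zero [simp]: "vec_poly (0\<^sub>v n) = 0"
  by (rule poly_eqI) (simp add: coeff_vec_poly)

lemma linear_codeD:
  assumes "linear_code n C"
  shows "C \<subseteq> carrier_vec n" "0\<^sub>v n \<in> C" "u \<in> C \<Longrightarrow> v \<in> C \<Longrightarrow> u + v \<in> C" "v \<in> C \<Longrightarrow> c \<cdot>\<^sub>v v \<in> C"
  using assms unfolding linear_code_def LinearCombinations.submodule_def module_vec_simps by auto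

lemma linear_code_minus:
  assumes "linear_code n C" "u \<in> C" "v \<in> C" shows "u - v \<in> C"
proof -
  have "u - v = u + (-1) \<cdot>\<^sub>v v" using linear_codeD(1)[OF assms(1)] assms(2,3) by (intro eq_vecI) auto
  then show ?thesis using linear_codeD[OF assms(1)] assms(2,3) by simp
qed

lemma add_closed_vec_poly:
  assumes "linear_code n C" shows "add_closed (vec_poly ` C)"
  unfolding add_closed_def
proof (intro conjI ballI)
  show "0 \<in> vec_poly ` C" using imageI[OF linear_codeD(2)[OF assms], of vec_poly] by simp
  fix p q assume "p \<in> vec_poly ` C" "q \<in> vec_poly ` C"
  then obtain u v where uv: "u \<in> C" "v \<in> C" "p = vec_poly u" "q = vec_poly v" by blast
  have "u \<in> carrier_vec n" "v \<in> carrier_vec n" using uv linear_codeD(1)[OF assms] by auto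
  then have "p + q = vec_poly (u + v)" "p - q = vec_poly (u - v)"
    using uv by (simp_all add: vec_poly_add vec_poly_minus)
  then show "p + q \<in> vec_poly ` C" "p - q \<in> vec_poly ` C"
    using uv linear_codeD[OF assms] linear_code_minus[OF assms] by auto
qed

lemma finite_UNIV_z4v: "finite (UNIV :: z4v set)"
proof -
  have "(UNIV :: z4v set) = (\<lambda>(a, b). const_z4v a + v_z4v * const_z4v b) ` UNIV"
  proof -
    have "x \<in> (\<lambda>(a, b). const_z4v a + v_z4v * const_z4v b) ` UNIV" for x
      using z4v_ex1[of x] by (auto dest!: ex1_implies_ex simp: image_iff)
    then show ?thesis by blast
  qed
  then show ?thesis by (metis finite_imageI finite)
qed

instance z4v :: finite by standard (rule finite_UNIV_z4v)

lemma finite_linear_code: "linear_code n C \<Longrightarrow> finite C"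
  using linear_codeD(1) card_carrier_vec_finite(2) finite_subset by blast

text \<open>The isomorphism is \<open>vec_poly\<close> followed by the inverse of
  \<open>z4_comb\<close>; its linearity is checked on the other side of that bijection.\<close>

lemma ex_of_type:
  assumes C: "linear_code n C" shows "\<exists>k1 k2. of_type n C k1 k2"
proof -
  have fin: "finite (vec_poly ` C)" using finite_linear_code[OF C] by simp
  obtain k1 k2 x y where y: "\<And>j. j < k2 \<Longrightarrow> y j + y j = 0"
    and bij: "bij_betw (z4_comb k1 k2 x y) (carrier_vec k1 \<times> carrier_vec k2) (vec_poly ` C)"
    using ex_z4_comb_bij[OF add_closed_vec_poly[OF C] fin] by blast
  let ?V = "carrier_vec k1 \<times> carrier_vec k2 :: (4 vec \<times> 2 vec) set"
  define g where "g = inv_into ?V (z4_comb k1 k2 x y)"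
  define f where "f = g \<circ> vec_poly"
  have sub: "C \<subseteq> carrier_vec n" by (rule linear_codeD(1)[OF C])
  have "inj_on vec_poly C" using vec_poly_inj sub by (intro inj_onI) blast
  then have "bij_betw vec_poly C (vec_poly ` C)" by (rule inj_on_imp_bij_betw)
  then have f: "bij_betw f C ?V"
    unfolding f_def using bij_betw_inv_into[OF bij] unfolding g_def by (rule bij_betw_trans)
  have fV: "f u \<in> ?V" if "u \<in> C" for u using f that bij_betwE by blast
  have g_right: "z4_comb k1 k2 x y (f u) = vec_poly u" if "u \<in> C" for u
    using that bij_betw_inv_into_right[OF bij, of "vec_poly u"] unfolding f_def g_def by simp
  have g_left: "f u = m" if "m \<in> ?V" "u \<in> C" "z4_comb k1 k2 x y m = vec_poly u" for m u
    using that bij_betw_inv_into_left[OF bij, of m] unfolding f_def g_def by simp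
  have add: "f (u + v) = (fst (f u) + fst (f v), snd (f u) + snd (f v))" if "u \<in> C" "v \<in> C" for u v
  proof (rule g_left)
    show "(fst (f u) + fst (f v), snd (f u) + snd (f v)) \<in> ?V" using fV[OF that(1)] fV[OF that(2)] by auto
    show "u + v \<in> C" by (rule linear_codeD(3)[OF C that])
    have "z4_comb k1 k2 x y (fst (f u) + fst (f v), snd (f u) + snd (f v)) =
        z4_comb k1 k2 x y (f u) + z4_comb k1 k2 x y (f v)"
      using fV[OF that(1)] fV[OF that(2)] z4_comb_add[where a = "fst (f u)" and a' = "fst (f v)" and b = "snd (f u)" and b' = "snd (f v)"
          and ?k1.0 = k1 and ?k2.0 = k2 and x = x and y = y, OF _ _ _ _ y]
      by (auto simp: mem_Times_iff)
    also have "\<dots> = vec_poly (u + v)" using that sub by (simp add: g_right vec_poly_add[of u n v] subset_iff)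
    finally show "z4_comb k1 k2 x y (fst (f u) + fst (f v), snd (f u) + snd (f v)) = vec_poly (u + v)" .
  qed
  have smult: "f (const_z4v c \<cdot>\<^sub>v u) = (c \<cdot>\<^sub>v fst (f u), red2 c \<cdot>\<^sub>v snd (f u))" if "u \<in> C" for c u
  proof (rule g_left)
    show "(c \<cdot>\<^sub>v fst (f u), red2 c \<cdot>\<^sub>v snd (f u)) \<in> ?V" using fV[OF that] by auto
    show "const_z4v c \<cdot>\<^sub>v u \<in> C" by (rule linear_codeD(4)[OF C that])
    show "z4_comb k1 k2 x y (c \<cdot>\<^sub>v fst (f u), red2 c \<cdot>\<^sub>v snd (f u)) = vec_poly (const_z4v c \<cdot>\<^sub>v u)"
      using fV[OF that] z4_comb_smult[where a = "fst (f u)" and b = "snd (f u)" and c = c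
          and ?k1.0 = k1 and ?k2.0 = k2 and x = x and y = y, OF _ _ y] g_right[OF that]
      by (auto simp: mem_Times_iff vec_poly_smult)
  qed
  have "f \<in> module_hom class_ring (code_z4_module n C) (direct_sum (module_vec TYPE(4) k1) (z2_power_z4_module k2))"
    unfolding module_hom_def code_z4_module_def direct_sum_def z2_power_z4_module_def module_vec_simps
    using fV add smult by auto
  then show ?thesis using f unfolding of_type_def by blast
qed

text \<open>Doubling kills the Z_2 part, and its image on Z_4^k1 has 2^k1 elements.\<close>

lemma of_type_cards:
  assumes C: "linear_code n C" and "of_type n C k1 k2"
  shows "card C = 4 ^ k1 * 2 ^ k2" "card ((\<lambda>c. c + c) ` C) = 2 ^ k1"
proof -
  obtain f where f: "f \<in> module_hom class_ring (code_z4_module n C) (direct_sum (module_vec TYPE(4) k1) (z2_power_z4_module k2))"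
    and bij: "bij_betw f C (carrier_vec k1 \<times> carrier_vec k2)"
    using assms(2) unfolding of_type_def by blast
  show "card C = 4 ^ k1 * 2 ^ k2"
    using bij_betw_same_card[OF bij] by (simp add: card_cartesian_product card_carrier_vec_finite)
  have add: "f (u + v) = (fst (f u) + fst (f v), snd (f u) + snd (f v))" if "u \<in> C" "v \<in> C" for u v
    using f that unfolding module_hom_def code_z4_module_def direct_sum_def z2_power_z4_module_def module_vec_simps
    by auto
  have im: "f ` C = carrier_vec k1 \<times> carrier_vec k2" using bij by (simp add: bij_betw_def)
  have dbl: "f (u + u) = (fst (f u) + fst (f u), 0\<^sub>v k2)" if "u \<in> C" for u
  proof -
    have "f u \<in> carrier_vec k1 \<times> carrier_vec k2" using im that by blast
    then have "snd (f u) + snd (f u) = 0\<^sub>v k2" by (intro eq_vecI) auto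
    then show ?thesis using add[OF that that] by simp
  qed
  have "inj_on f ((\<lambda>c. c + c) ` C)"
    using bij linear_codeD(3)[OF C] by (auto simp: bij_betw_def intro: inj_on_subset)
  then have "card ((\<lambda>c. c + c) ` C) = card (f ` (\<lambda>c. c + c) ` C)" by (simp add: card_image)
  also have "f ` (\<lambda>c. c + c) ` C = (\<lambda>m. (fst m + fst m, 0\<^sub>v k2)) ` (f ` C)"
    by (simp add: image_image dbl cong: image_cong)
  also have "\<dots> = (\<lambda>a. (a + a, 0\<^sub>v k2)) ` carrier_vec k1"
  proof -
    have ne: "carrier_vec k2 \<noteq> ({} :: 2 vec set)" using zero_carrier_vec by blast
    have "(\<lambda>m. (fst m + fst m, 0\<^sub>v k2)) ` f ` C = (\<lambda>a. (a + a, 0\<^sub>v k2)) ` fst ` (f ` C)"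
      by (simp only: image_image)
    then show ?thesis unfolding im using ne by (simp add: fst_image_times)
  qed
  also have "\<dots> = (\<lambda>a. (a, 0\<^sub>v k2)) ` (\<lambda>a. a + a) ` carrier_vec k1" by (simp add: image_image)
  also have "card \<dots> = 2 ^ k1"
    by (subst card_image) (auto simp: card_double_carrier_vec intro: inj_onI)
  finally show "card ((\<lambda>c. c + c) ` C) = 2 ^ k1" .
qed

text \<open>Some type exists, and the two cardinalities determine it. From here on types are a
  matter of counting.\<close>

lemma of_type_iff_cards:
  assumes C: "linear_code n C"
  shows "of_type n C k1 k2 \<longleftrightarrow> card ((\<lambda>c. c + c) ` C) = 2 ^ k1 \<and> card C = 4 ^ k1 * 2 ^ k2"
proof
  assume "of_type n C k1 k2"
  then show "card ((\<lambda>c. c + c) ` C) = 2 ^ k1 \<and> card C = 4 ^ k1 * 2 ^ k2"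
    using of_type_cards[OF C] by blast
next
  assume cards: "card ((\<lambda>c. c + c) ` C) = 2 ^ k1 \<and> card C = 4 ^ k1 * 2 ^ k2"
  obtain l1 l2 where l: "of_type n C l1 l2" using ex_of_type[OF C] by blast
  have "l1 = k1" using of_type_cards(2)[OF C l] cards by simp
  moreover from this have "l2 = k2" using of_type_cards(1)[OF C l] cards by simp
  ultimately show "of_type n C k1 k2" using l by simp
qed

section \<open>Spectra of words\<close>

text \<open>Many identities for \<open>hat\<close>, \<open>rc\<close> and \<open>star\<close> are
  thereby checked on monomials only.\<close>

lemma poly_additive_eqI:
  fixes F G :: "'a :: comm_ring_1 poly \<Rightarrow> 'b :: ab_group_add"
  assumes F: "\<And>p q. F (p + q) = F p + F q" and G: "\<And>p q. G (p + q) = G p + G q"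
    and eq: "\<And>c i. F (monom c i) = G (monom c i)"
  shows "F p = G p"
proof -
  have F0: "F 0 = 0" using F[of 0 0] by simp
  have G0: "G 0 = 0" using G[of 0 0] by simp
  have Fs: "F (sum f I) = (\<Sum>i\<in>I. F (f i))" if "finite I" for f and I :: "nat set"
    using that by induction (simp_all add: F F0)
  have Gs: "G (sum f I) = (\<Sum>i\<in>I. G (f i))" if "finite I" for f and I :: "nat set"
    using that by induction (simp_all add: G G0)
  have "F (\<Sum>i\<le>degree p. monom (coeff p i) i) = G (\<Sum>i\<le>degree p. monom (coeff p i) i)"
    by (simp only: Fs Gs finite_atMost eq)
  then show ?thesis by (simp only: poly_as_sum_of_monoms)
qed

lemma red2_mult: "red2 (a * b) = red2 a * red2 b"
proof -
  obtain y z where "a = of_int y" "b = of_int z" by (metis bit0_cases)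
  then show ?thesis by (metis red2_of_int of_int_mult)
qed

text \<open>Well defined because 0 and 1 are roots of v^2 - v. Together the two evaluations identify
  R with Z_4 x Z_4.\<close>

lift_definition z4v_eval :: "bool \<Rightarrow> z4v \<Rightarrow> 4" is "\<lambda>e p. poly p (of_bool e)"
proof -
  fix e :: bool and p q :: "4 poly"
  assume "[:0, -1, 1:] dvd p - q"
  then obtain r where "p - q = [:0, -1, 1:] * r" by (rule dvdE)
  from arg_cong[OF this, of "\<lambda>p. poly p (of_bool e)"] have "poly p (of_bool e) - poly q (of_bool e) = 0"
    by (cases e) simp_all
  then show "poly p (of_bool e) = poly q (of_bool e)" by simp
qed

lemma z4v_eval_0: "z4v_eval e 0 = 0" by transfer simp
lemma z4v_eval_1: "z4v_eval e 1 = 1" by transfer simp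
lemma z4v_eval_add: "z4v_eval e (x + y) = z4v_eval e x + z4v_eval e y" by transfer simp
lemma z4v_eval_mult: "z4v_eval e (x * y) = z4v_eval e x * z4v_eval e y" by transfer simp
lemma z4v_eval_const: "z4v_eval e (const_z4v a) = a" by transfer simp
lemma z4v_eval_v: "z4v_eval e v_z4v = of_bool e" by transfer simp

text \<open>Reduction modulo 2, after \<open>v \<mapsto> 0\<close> or \<open>v \<mapsto> 1\<close>, into the prime field of a field of
  characteristic 2.\<close>

definition phi :: "bool \<Rightarrow> z4v \<Rightarrow> 'k :: field" where
  "phi e r = (if red2 (z4v_eval e r) = 0 then 0 else 1)"

lemma phi_0 [simp]: "phi e 0 = 0" by (simp add: phi_def z4v_eval_0 red2_values)
lemma phi_1 [simp]: "phi e 1 = 1" by (simp add: phi_def z4v_eval_1 red2_values)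

lemma phi_mult: "phi e (r * s) = phi e r * phi e s"
  using two_cases[of "red2 (z4v_eval e r)"] two_cases[of "red2 (z4v_eval e s)"]
  by (auto simp: phi_def z4v_eval_mult red2_mult)

lemma phi_sq: "phi e r ^ 2 = phi e r" by (simp add: phi_def)

lemma phi_add:
  assumes "(2 :: 'k :: field) = 0"
  shows "(phi e (r + s) :: 'k) = phi e r + phi e s"
  using two_cases[of "red2 (z4v_eval e r)"] two_cases[of "red2 (z4v_eval e s)"] assms
  by (auto simp: phi_def z4v_eval_add red2_add)

lemma phi_eq_0_iff: "phi e r = (0 :: 'k :: field) \<longleftrightarrow> z4v_eval e r \<in> {0, 2}"
  using four_cases[of "z4v_eval e r"] by (auto simp: phi_def red2_values)

lemma z4v_decomp: "\<exists>a b. r = const_z4v a + v_z4v * const_z4v b"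
  using ex1_implies_ex[OF z4v_ex1[of r]] by auto

text \<open>With r = a + v b, vanishing at v = 0 and at v = 1 makes a and a + b even, hence also
  b.\<close>

lemma phi_zero_imp_double:
  assumes "\<And>e. phi e r = (0 :: 'k :: field)" shows "\<exists>s. r = s + s"
proof -
  obtain a b where r: "r = const_z4v a + v_z4v * const_z4v b" using z4v_decomp by blast
  have a: "a \<in> {0, 2}" and ab: "a + b \<in> {0, 2}"
    using assms[of False] assms[of True] unfolding phi_eq_0_iff
    by (simp_all add: r z4v_eval_add z4v_eval_mult z4v_eval_const z4v_eval_v)
  have b: "b \<in> {0, 2}" using a ab four_cases[of b] by auto
  have dbl: "\<exists>s. x = s + s" if "x \<in> {0, 2}" for x :: 4
    using that by (auto intro: exI[of _ 0] exI[of _ 1])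
  obtain a' b' where "a = a' + a'" "b = b' + b'" using dbl[OF a] dbl[OF b] by blast
  then have "r = (const_z4v a' + v_z4v * const_z4v b') + (const_z4v a' + v_z4v * const_z4v b')"
    by (simp only: r const_z4v_add distrib_left add_ac)
  then show ?thesis by blast
qed

lemma phi_zero_if_double_zero:
  assumes "r + r = 0" shows "phi e r = (0 :: 'k :: field)"
proof -
  have "z4v_eval e r + z4v_eval e r = 0" using assms z4v_eval_add[of e r r] z4v_eval_0 by simp
  then show ?thesis unfolding phi_eq_0_iff using four_cases[of "z4v_eval e r"] by auto
qed

lemma double_double_z4v: "s + s + (s + s) = (0 :: z4v)"
proof -
  have "s + s + (s + s) = 4 * s" by simp
  then show ?thesis by simp
qed

lemma ex_phi: "\<exists>r. \<forall>e. phi e r = (of_bool (f e) :: 'k :: field)"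
proof -
  define a where "a = (of_bool (f False) :: 4)"
  \<comment> \<open>Interpolation in v: the value is \<open>a\<close> at v = 0 and the other
    prescribed value at v = 1.\<close>
  define r where "r = const_z4v a + v_z4v * const_z4v (of_bool (f True) - a)"
  have "phi e r = (of_bool (f e) :: 'k)" for e
    by (cases e; cases "f e") (simp_all add: phi_def r_def a_def z4v_eval_add z4v_eval_mult z4v_eval_const z4v_eval_v z4v_eval_0 z4v_eval_1 red2_values)
  then show ?thesis by blast
qed

text \<open>After reduction modulo 2, the discrete Fourier (Mattson-Solomon) transform of a word,
  with \<open>snd m\<close> selecting v = 0 or v = 1.\<close>

definition hat :: "'k :: field \<times> bool \<Rightarrow> z4v poly \<Rightarrow> 'k" where
  "hat m p = poly (map_poly (phi (snd m)) p) (fst m)"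

lemma hat_monom: "hat (z, e) (monom c i) = phi e c * z ^ i"
  by (simp add: hat_def map_poly_monom poly_monom)

lemma hat_1 [simp]: "hat m 1 = 1" by (simp add: hat_def)

definition poly_ideal :: "z4v poly set \<Rightarrow> bool" where
  "poly_ideal I \<longleftrightarrow> 0 \<in> I \<and> (\<forall>p\<in>I. \<forall>q\<in>I. p + q \<in> I) \<and> (\<forall>p\<in>I. \<forall>q. q * p \<in> I)"

lemma poly_idealD:
  assumes "poly_ideal I"
  shows "0 \<in> I" "p \<in> I \<Longrightarrow> q \<in> I \<Longrightarrow> p + q \<in> I" "p \<in> I \<Longrightarrow> q * p \<in> I" "p \<in> I \<Longrightarrow> p * q \<in> I"
    "p \<in> I \<Longrightarrow> - p \<in> I" "p \<in> I \<Longrightarrow> q \<in> I \<Longrightarrow> p - q \<in> I"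
proof -
  show *: "0 \<in> I" "p \<in> I \<Longrightarrow> q \<in> I \<Longrightarrow> p + q \<in> I" "p \<in> I \<Longrightarrow> q * p \<in> I" for p q
    using assms by (auto simp: poly_ideal_def)
  show "p \<in> I \<Longrightarrow> p * q \<in> I" using *(3)[of p q] by (simp add: mult.commute)
  show neg: "p \<in> I \<Longrightarrow> - p \<in> I" for p using *(3)[of p "-1"] by simp
  show "p \<in> I \<Longrightarrow> q \<in> I \<Longrightarrow> p - q \<in> I" using *(2)[of p "- q"] neg[of q] by simp
qed

locale odd_length =
  fixes n :: nat and ty :: "'k :: alg_closed_field itself"
  assumes n_pos: "n > 0" and odd_n: "odd n" and two_eq_0: "(2 :: 'k) = 0"
begin

lemma add_self_k [simp]: "(x :: 'k) + x = 0"
proof -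
  have "x + x = 2 * x" by simp
  then show ?thesis using two_eq_0 by simp
qed

lemma k_minus: "- (x :: 'k) = x" using add_self_k[of x] by (metis add_eq_0_iff)

lemma k_sq_add: "((x :: 'k) + y) ^ 2 = x ^ 2 + y ^ 2"
  by (simp add: power2_sum two_eq_0)

lemma hat_add: "hat (m :: 'k \<times> bool) (p + q) = hat m p + hat m q"
proof -
  have "map_poly (phi (snd m) :: _ \<Rightarrow> 'k) (p + q) = map_poly (phi (snd m)) p + map_poly (phi (snd m)) q"
    by (rule poly_eqI) (simp add: coeff_map_poly phi_add[OF two_eq_0])
  then show ?thesis by (simp add: hat_def)
qed

lemma hat_mult: "hat (m :: 'k \<times> bool) (p * q) = hat m p * hat m q"
proof -
  have phi_sum: "(phi e (sum f I) :: 'k) = (\<Sum>i\<in>I. phi e (f i))" if "finite I" for e f and I :: "nat set"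
    using that by induction (simp_all add: phi_add[OF two_eq_0])
  have "map_poly (phi (snd m) :: _ \<Rightarrow> 'k) (p * q) = map_poly (phi (snd m)) p * map_poly (phi (snd m)) q"
    by (rule poly_eqI) (simp add: coeff_map_poly coeff_mult phi_sum phi_mult)
  then show ?thesis by (simp add: hat_def)
qed

lemma hat_0 [simp]: "hat m 0 = 0" by (simp add: hat_def)

lemma hat_double: "hat (m :: 'k \<times> bool) (p + p) = 0" by (simp only: hat_add add_self_k)

lemma hat_uminus: "hat (m :: 'k \<times> bool) (- p) = hat m p"
proof -
  have "hat m (- p) + hat m p = 0" using hat_add[of m "- p" p] by simp
  then show ?thesis using k_minus by (metis add_eq_0_iff)
qed

lemma hat_diff: "hat (m :: 'k \<times> bool) (p - q) = hat m p - hat m q"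
  using hat_add[of m p "- q"] by (simp add: hat_uminus k_minus)

text \<open>The reduced coefficients lie in the prime field and are fixed by squaring. This is the
  only constraint on spectra, see \<open>ex_hat_eq\<close>.\<close>

lemma hat_sq: "hat (z ^ 2, e) p = (hat (z :: 'k, e) p) ^ 2"
proof -
  have "(\<lambda>p. hat (z ^ 2, e) p) p = (\<lambda>p. (hat (z, e) p) ^ 2) p"
  proof (rule poly_additive_eqI)
    show "hat (z\<^sup>2, e) (monom c i) = (hat (z, e) (monom c i))\<^sup>2" for c i
      by (simp add: hat_monom power_mult_distrib phi_sq flip: power_mult) (simp add: mult.commute)
  qed (simp_all add: hat_add k_sq_add)
  then show ?thesis .
qed

section \<open>Points of the spectrum, and words modulo x^n - 1\<close>

definition mu :: "'k set" where "mu = {z. z ^ n = 1}"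

definition M :: "('k \<times> bool) set" where "M = mu \<times> UNIV"

lemma finite_mu: "finite mu" unfolding mu_def by (rule finite_nth_roots_unity[OF n_pos])

lemma of_nat_n: "of_nat n = (1 :: 'k)" by (rule of_nat_odd_neq_0[OF two_eq_0 odd_n])

lemma card_mu: "card mu = n" unfolding mu_def by (rule card_nth_roots_unity) (simp add: of_nat_n)

lemma finite_M: "finite M" by (simp add: M_def finite_mu)

lemma card_M: "card M = 2 * n" by (simp add: M_def card_mu card_cartesian_product card_UNIV_bool)

lemma mu_nz: "z \<in> mu \<Longrightarrow> z \<noteq> 0" using n_pos by (auto simp: mu_def power_0_left)

lemma mu_inverse: "z \<in> mu \<Longrightarrow> inverse z \<in> mu" by (simp add: mu_def power_inverse)

lemma mu_sq: "z \<in> mu \<Longrightarrow> z ^ 2 \<in> mu" unfolding mu_def by (simp add: power_commuting_commutes flip: power_mult) (simp add: mult.commute power_mult)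

lemma M_inverse: "m \<in> M \<Longrightarrow> pair_inverse m \<in> M" by (auto simp: M_def mu_inverse)

lemma sq_inj: "(z :: 'k) ^ 2 = w ^ 2 \<Longrightarrow> z = w"
proof -
  assume "z ^ 2 = w ^ 2"
  then have "(z + w) ^ 2 = 0" by (simp add: k_sq_add)
  then have "z + w = 0" by simp
  then show "z = w" using k_minus[of w] by (simp add: add_eq_0_iff2)
qed

lemma sq_bij_mu: "bij_betw (\<lambda>z. z ^ 2) mu mu"
proof (rule bij_betw_imageI)
  show "inj_on (\<lambda>z. z ^ 2) mu" using sq_inj by (rule inj_onI)
  then show "(\<lambda>z. z ^ 2) ` mu = mu"
    using mu_sq finite_mu by (intro endo_inj_surj) auto
qed

text \<open>Squaring is injective in characteristic 2, so it maps the finite set \<open>U\<close>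
  onto itself.\<close>

lemma pair_sq_closed_iff:
  assumes "pair_sq_closed U" "U \<subseteq> M"
  shows "(z ^ 2, e) \<in> U \<longleftrightarrow> (z, e) \<in> U"
proof
  let ?f = "\<lambda>(z, e). (z ^ 2, e) :: 'k \<times> bool"
  have "inj_on ?f U" by (rule inj_onI) (auto dest: sq_inj)
  moreover have "?f ` U \<subseteq> U" using assms(1) by (auto simp: pair_sq_closed_def)
  ultimately have im: "?f ` U = U" using finite_subset[OF assms(2) finite_M] by (intro endo_inj_surj)
  assume "(z ^ 2, e) \<in> U"
  then obtain w where "w \<in> U" "?f w = (z ^ 2, e)" using im by (metis (no_types, lifting) imageE)
  moreover obtain u f where "w = (u, f)" by (cases w)
  ultimately have "(u, f) \<in> U" "u ^ 2 = z ^ 2" "f = e" by simp_all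
  then show "(z, e) \<in> U" using sq_inj by blast
qed (use assms(1) in \<open>auto simp: pair_sq_closed_def\<close>)

text \<open>The coefficient of \<open>x^l\<close> modulo \<open>x^n - 1\<close>.\<close>

definition rc :: "nat \<Rightarrow> z4v poly \<Rightarrow> z4v" where
  "rc l p = (\<Sum>k\<le>degree p. if k mod n = l then coeff p k else 0)"

definition rho :: "z4v poly \<Rightarrow> z4v vec" where "rho p = vec n (\<lambda>l. rc l p)"

lemma rc_bound:
  assumes "degree p \<le> N" shows "rc l p = (\<Sum>k\<le>N. if k mod n = l then coeff p k else 0)"
  unfolding rc_def using assms by (intro sum.mono_neutral_left) (auto simp: coeff_eq_0)

lemma rc_add: "rc l (p + q) = rc l p + rc l q"
proof -
  let ?N = "max (degree p) (degree q)"
  have "rc l (p + q) = (\<Sum>k\<le>?N. (if k mod n = l then coeff p k else 0) + (if k mod n = l then coeff q k else 0))"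
    by (subst rc_bound[OF degree_add_le_max]) (intro sum.cong, auto)
  also have "\<dots> = rc l p + rc l q"
    unfolding sum.distrib by (simp add: rc_bound[of p ?N] rc_bound[of q ?N])
  finally show ?thesis .
qed

lemma rc_monom: "rc l (monom c k) = (if k mod n = l then c else 0)"
proof -
  have "rc l (monom c k) = (\<Sum>i\<le>k. if i = k then (if k mod n = l then c else 0) else 0)"
    by (subst rc_bound[OF degree_monom_le]) (intro sum.cong, auto)
  then show ?thesis by simp
qed

lemma rc_smult: "rc l (smult c p) = c * rc l p"
  by (subst rc_bound[OF degree_smult_le]) (auto simp: rc_def sum_distrib_left intro!: sum.cong)

lemma rc_0 [simp]: "rc l 0 = 0" by (simp add: rc_def)

lemma rc_sum: "finite I \<Longrightarrow> rc l (sum f I) = (\<Sum>i\<in>I. rc l (f i))"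
  by (induction rule: finite_induct) (simp_all add: rc_add)

lemma rho_carrier [simp]: "rho p \<in> carrier_vec n" by (simp add: rho_def)

lemma rho_eq_iff: "rho p = rho q \<longleftrightarrow> (\<forall>l<n. rc l p = rc l q)"
  by (auto simp: rho_def vec_eq_iff)

lemma rho_add: "rho (p + q) = rho p + rho q" by (rule eq_vecI) (simp_all add: rho_def rc_add)

lemma rho_smult: "rho (smult c p) = c \<cdot>\<^sub>v rho p" by (rule eq_vecI) (simp_all add: rho_def rc_smult)

lemma rho_0 [simp]: "rho 0 = 0\<^sub>v n" by (rule eq_vecI) (simp_all add: rho_def)

lemma rho_eq_0_iff: "rho p = 0\<^sub>v n \<longleftrightarrow> (\<forall>l<n. rc l p = 0)"
  using rho_eq_iff[of p 0] by simp

lemma rc_sum_monom: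
  assumes "l < n" shows "rc l (\<Sum>i<n. monom (f i) i) = f l"
proof -
  have "rc l (\<Sum>i<n. monom (f i) i) = (\<Sum>i<n. if i = l then f i else 0)"
    unfolding rc_sum[OF finite_lessThan] rc_monom by (intro sum.cong) auto
  then show ?thesis using assms by simp
qed

lemma rho_vec_poly: "v \<in> carrier_vec n \<Longrightarrow> rho (vec_poly v) = v"
  by (rule eq_vecI) (auto simp: rho_def vec_poly_def rc_sum_monom)

lemma mod_Suc_eq_iff: "i < n \<Longrightarrow> Suc k mod n = i \<longleftrightarrow> k mod n = (i + n - 1) mod n"
proof -
  assume i: "i < n"
  have "Suc k mod n = i \<longleftrightarrow> [Suc k = i] (mod n)" using i by (simp add: cong_def)
  also have "\<dots> \<longleftrightarrow> [Suc k = Suc (i + n - 1)] (mod n)" using n_pos by (simp add: cong_def)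
  also have "\<dots> \<longleftrightarrow> [k = i + n - 1] (mod n)" using cong_add_rcancel_nat[of k 1 "i + n - 1" n] by simp
  finally show ?thesis by (simp add: cong_def)
qed

lemma rc_shift: "i < n \<Longrightarrow> rc i (monom 1 1 * p) = rc ((i + n - 1) mod n) p"
  by (rule poly_additive_eqI[of "\<lambda>p. rc i (monom 1 1 * p)"])
    (simp_all add: rc_add rc_monom distrib_left mult_monom mod_Suc_eq_iff)

text \<open>Multiplication by x is the shift, which is what turns cyclic codes into ideals.\<close>

lemma rho_shift: "rho (monom 1 1 * p) = cyclic_shift n (rho p)"
  unfolding cyclic_shift_def rho_def using n_pos by (intro eq_vecI) (simp_all add: rc_shift[unfolded One_nat_def])

text \<open>At an n-th root of unity only exponents modulo n matter, so the spectrum depends on the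
  word \<open>rho p\<close> alone.\<close>

lemma hat_rc:
  assumes "z \<in> mu" shows "hat (z, e) p = (\<Sum>l<n. phi e (rc l p) * z ^ l)"
proof (rule poly_additive_eqI[of "hat (z, e)"])
  show "hat (z, e) (p + q) = hat (z, e) p + hat (z, e) q" for p q by (rule hat_add)
  show "(\<Sum>l<n. phi e (rc l (p + q)) * z ^ l) = (\<Sum>l<n. phi e (rc l p) * z ^ l) + (\<Sum>l<n. phi e (rc l q) * z ^ l)" for p q
    by (simp add: rc_add phi_add[OF two_eq_0] distrib_right sum.distrib)
  fix c i
  have "z ^ i = z ^ (n * (i div n) + i mod n)" by simp
  also have "\<dots> = z ^ (i mod n)" using assms by (simp only: power_add power_mult mu_def mem_Collect_eq) simp
  finally have "z ^ i = z ^ (i mod n)" .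
  moreover have "(\<Sum>l<n. phi e (rc l (monom c i)) * z ^ l) = (\<Sum>l<n. if l = i mod n then phi e c * z ^ l else 0)"
    by (intro sum.cong) (auto simp: rc_monom)
  ultimately show "hat (z, e) (monom c i) = (\<Sum>l<n. phi e (rc l (monom c i)) * z ^ l)"
    using n_pos by (simp add: hat_monom)
qed

lemma hat_cong_rho: "m \<in> M \<Longrightarrow> rho p = rho q \<Longrightarrow> hat m p = hat m q"
  by (cases m) (auto simp: M_def hat_rc rho_eq_iff)

text \<open>The reduction modulo 2 is a polynomial of degree less than n with n distinct
  roots.\<close>

lemma hat_zero_imp_phi_zero:
  assumes "\<And>m. m \<in> M \<Longrightarrow> hat m p = 0" "l < n"
  shows "phi e (rc l p) = (0 :: 'k)"
proof -
  let ?q = "\<Sum>l<n. monom (phi e (rc l p) :: 'k) l"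
  have "poly ?q z = 0" if "z \<in> mu" for z
    using assms(1)[of "(z, e)"] that by (simp add: M_def hat_rc poly_sum poly_monom)
  moreover have "degree ?q < n"
    using n_pos by (intro le_less_trans[OF degree_sum_le[of _ _ "n - 1"]]) (auto intro: le_trans[OF degree_monom_le])
  ultimately have "?q = 0" using card_mu by (intro poly_eqI_degree[of mu]) auto
  then have "coeff ?q l = 0" by simp
  then show ?thesis using assms(2) by (simp add: coeff_sum sum.delta if_distrib cong: if_cong)
qed

text \<open>In R, being killed by 2 and being a multiple of 2 coincide. The first form is stated
  here; \<open>hats_zero_imp_double\<close> supplies the half.\<close>

lemma hats_zero_iff: "(\<forall>m\<in>M. hat m p = 0) \<longleftrightarrow> rho (p + p) = 0\<^sub>v n"
proof
  assume "\<forall>m\<in>M. hat m p = 0"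
  then have "phi e (rc l p) = (0 :: 'k)" if "l < n" for e l using hat_zero_imp_phi_zero that by blast
  then have "\<exists>s. rc l p = s + s" if "l < n" for l using phi_zero_imp_double[where 'k = 'k] that by blast
  then have "rc l p + rc l p = 0" if "l < n" for l using that double_double_z4v by metis
  then show "rho (p + p) = 0\<^sub>v n" by (simp only: rho_eq_0_iff rc_add) simp
next
  assume "rho (p + p) = 0\<^sub>v n"
  then have "rc l p + rc l p = 0" if "l < n" for l using that by (simp only: rho_eq_0_iff rc_add)
  then have "phi e (rc l p) = (0 :: 'k)" if "l < n" for l e using that phi_zero_if_double_zero by blast
  then show "\<forall>m\<in>M. hat m p = 0" by (auto simp: M_def hat_rc)
qed

lemma hats_zero_imp_double:
  assumes "\<And>m. m \<in> M \<Longrightarrow> hat m p = 0" shows "\<exists>q. rho p = rho (q + q)"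
proof -
  have "\<exists>s. rc l p = s + s" if "l < n" for l
    using phi_zero_imp_double[where 'k = 'k] hat_zero_imp_phi_zero[OF assms that] by blast
  then obtain s where s: "\<And>l. l < n \<Longrightarrow> rc l p = s l + s l" by metis
  have "rho p = rho ((\<Sum>i<n. monom (s i) i) + (\<Sum>i<n. monom (s i) i))"
    unfolding rho_eq_iff rc_add using s rc_sum_monom by metis
  then show ?thesis by blast
qed


text \<open>Equivariance under the Frobenius map. Spectra satisfy it by \<open>hat_sq\<close>, and
  every such function is a spectrum by \<open>ex_hat_eq\<close>.\<close>

definition frobenius_fun :: "('k \<times> bool \<Rightarrow> 'k) \<Rightarrow> bool" where
  "frobenius_fun g \<longleftrightarrow> (\<forall>z\<in>mu. \<forall>e. g (z ^ 2, e) = g (z, e) ^ 2)"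

text \<open>Orthogonality relation, from the geometric sum. At z = 1 the sum is n, which is 1 in the
  field because n is odd; so Fourier inversion needs no factor 1/n.\<close>

lemma sum_powers_mu:
  assumes "z \<in> mu" shows "(\<Sum>i<n. z ^ i) = (if z = 1 then 1 else 0)"
proof (cases "z = 1")
  case True
  then show ?thesis by (simp add: of_nat_n)
next
  case False
  have "(z - 1) * (\<Sum>i<n. z ^ i) = z ^ n - 1" by (rule power_diff_1_eq[symmetric])
  also have "\<dots> = 0" using assms by (simp add: mu_def)
  finally show ?thesis using False by simp
qed

text \<open>Discrete Fourier inversion; the coefficients obtained are fixed by the Frobenius map, hence
  lie in the prime field.\<close>

lemma ex_hat_eq:
  assumes "frobenius_fun g" shows "\<exists>p. \<forall>m\<in>M. hat m p = g m"
proof -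
  define c where "c e i = (\<Sum>z\<in>mu. g (z, e) * inverse z ^ i)" for e i
  have sq: "(sum f A) ^ 2 = (\<Sum>x\<in>A. f x ^ 2)" if "finite A" for f :: "'k \<Rightarrow> 'k" and A
    using that by induction (simp_all add: k_sq_add)
  have "c e i ^ 2 = c e i" for e i
  proof -
    have "c e i ^ 2 = (\<Sum>z\<in>mu. g (z ^ 2, e) * inverse (z ^ 2) ^ i)"
      unfolding c_def sq[OF finite_mu] using assms
      by (intro sum.cong) (simp_all add: frobenius_fun_def power_mult_distrib power_inverse power_commutes
          flip: power_mult, simp add: mult.commute)
    also have "\<dots> = c e i" unfolding c_def
      by (rule sum.reindex_bij_betw[OF sq_bij_mu, of "\<lambda>z. g (z, e) * inverse z ^ i"])
    finally show ?thesis .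
  qed
  then have c01: "c e i = 0 \<or> c e i = 1" for e i
    by (metis mult_cancel_left1 power2_eq_square)
  have "\<exists>r. \<forall>e. phi e r = c e i" for i
  proof -
    obtain r where r: "\<And>e. phi e r = (of_bool (c e i = 1) :: 'k)" using ex_phi[of "\<lambda>e. c e i = 1"] by blast
    have "phi e r = c e i" for e using r[of e] c01[of e i] by auto
    then show ?thesis by blast
  qed
  then obtain r where r: "\<And>i e. phi e (r i) = c e i" by metis
  define p where "p = (\<Sum>i<n. monom (r i) i)"
  have "hat (w, e) p = g (w, e)" if w: "w \<in> mu" for w e
  proof -
    have "hat (w, e) p = (\<Sum>i<n. c e i * w ^ i)"
      unfolding hat_rc[OF w] p_def by (intro sum.cong) (simp_all add: rc_sum_monom r)
    also have "\<dots> = (\<Sum>i<n. \<Sum>z\<in>mu. g (z, e) * (inverse z * w) ^ i)"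
      unfolding c_def sum_distrib_right by (simp add: power_mult_distrib mult.assoc)
    also have "\<dots> = (\<Sum>z\<in>mu. g (z, e) * (\<Sum>i<n. (inverse z * w) ^ i))"
      unfolding sum_distrib_left by (rule sum.swap)
    also have "\<dots> = (\<Sum>z\<in>mu. if z = w then g (z, e) else 0)"
    proof (rule sum.cong[OF refl])
      fix z assume z: "z \<in> mu"
      have "inverse z * w \<in> mu" using mu_inverse[OF z] w by (simp add: mu_def power_mult_distrib)
      moreover have "inverse z * w = 1 \<longleftrightarrow> z = w" using mu_nz[OF z] by (auto simp: field_simps)
      ultimately show "g (z, e) * (\<Sum>i<n. (inverse z * w) ^ i) = (if z = w then g (z, e) else 0)"
        using sum_powers_mu by simp
    qed
    also have "\<dots> = g (w, e)" using w finite_mu by simp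
    finally show ?thesis .
  qed
  then show ?thesis unfolding M_def by blast
qed

lemma frobenius_indicator:
  assumes "pair_sq_closed U" "U \<subseteq> M" shows "frobenius_fun (\<lambda>m. of_bool (m \<in> U))"
  using pair_sq_closed_iff[OF assms] by (simp add: frobenius_fun_def)

lemma ex_hat_indicator:
  assumes "pair_sq_closed U" "U \<subseteq> M" shows "\<exists>p. \<forall>m\<in>M. hat m p = of_bool (m \<in> U)"
  by (rule ex_hat_eq[OF frobenius_indicator[OF assms]])

section \<open>Counting multiples of 2 by the spectra of their halves\<close>

definition W :: "('k \<times> bool) set \<Rightarrow> z4v vec set" where
  "W U = {rho (p + p) |p. \<forall>m\<in>M - U. hat m p = 0}"

text \<open>Values off \<open>U\<close>, also those outside \<open>M\<close>, are pinned to 0, so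
  that different members differ at a point of \<open>U\<close>.\<close>

definition G :: "('k \<times> bool) set \<Rightarrow> ('k \<times> bool \<Rightarrow> 'k) set" where
  "G U = {g. frobenius_fun g \<and> (\<forall>m. m \<notin> U \<longrightarrow> g m = 0)}"

text \<open>Hence the spectrum of a half is an invariant of the doubled word, and membership in
  \<open>W\<close> does not depend on the half chosen.\<close>

lemma double_eq_iff: "rho (p + p) = rho (q + q) \<longleftrightarrow> (\<forall>m\<in>M. hat m p = hat m q)"
proof -
  have "rho (p + p) = rho (q + q) \<longleftrightarrow> rho ((p - q) + (p - q)) = 0\<^sub>v n"
  proof -
    have "rc l (p + p) = rc l (q + q) \<longleftrightarrow> rc l ((p - q) + (p - q)) = 0" for l
      using rc_add[of l "(p - q) + (p - q)" "q + q"] by (simp add: algebra_simps)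
    then show ?thesis unfolding rho_eq_iff rho_eq_0_iff by simp
  qed
  also have "\<dots> \<longleftrightarrow> (\<forall>m\<in>M. hat m (p - q) = 0)" by (rule hats_zero_iff[symmetric])
  finally show ?thesis by (simp add: hat_diff)
qed

lemma bij_betw_W_G:
  assumes "U \<subseteq> M" shows "\<exists>F. bij_betw F (G U) (W U)"
proof -
  have "\<forall>g. \<exists>p. frobenius_fun g \<longrightarrow> (\<forall>m\<in>M. hat m p = g m)" using ex_hat_eq by blast
  then obtain P where P: "\<And>g m. frobenius_fun g \<Longrightarrow> m \<in> M \<Longrightarrow> hat m (P g) = g m" by metis
  have "bij_betw (\<lambda>g. rho (P g + P g)) (G U) (W U)"
  proof (rule bij_betw_imageI)
    show "inj_on (\<lambda>g. rho (P g + P g)) (G U)"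
    proof (rule inj_onI)
      fix g h assume gh: "g \<in> G U" "h \<in> G U" "rho (P g + P g) = rho (P h + P h)"
      have "g m = h m" for m
      proof (cases "m \<in> U")
        case True
        then have "m \<in> M" using assms by blast
        then show ?thesis using gh P[of g m] P[of h m] unfolding double_eq_iff G_def by simp
      next
        case False
        then have "g m = 0" "h m = 0" using gh(1,2) unfolding G_def by blast+
        then show ?thesis by simp
      qed
      then show "g = h" by blast
    qed
    show "(\<lambda>g. rho (P g + P g)) ` G U = W U"
    proof (intro equalityI subsetI)
      fix v assume "v \<in> (\<lambda>g. rho (P g + P g)) ` G U"
      then obtain g where "g \<in> G U" "v = rho (P g + P g)" by blast
      then show "v \<in> W U" unfolding W_def G_def using P by auto
    next
      fix v assume "v \<in> W U"
      then obtain p where p: "v = rho (p + p)" "\<And>m. m \<in> M - U \<Longrightarrow> hat m p = 0" unfolding W_def by blast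
      define g where "g m = (if m \<in> M then hat m p else 0)" for m
      have "frobenius_fun g" unfolding frobenius_fun_def
        by (auto simp: g_def hat_sq M_def mu_sq)
      moreover from this have "v = rho (P g + P g)"
        unfolding p(1) double_eq_iff using P by (simp add: g_def)
      moreover have "g m = 0" if "m \<notin> U" for m using p(2) that by (simp add: g_def)
      ultimately show "v \<in> (\<lambda>g. rho (P g + P g)) ` G U" unfolding G_def by blast
    qed
  qed
  then show ?thesis by blast
qed

lemma card_G_eq_card_W: "U \<subseteq> M \<Longrightarrow> card (G U) = card (W U)"
  using bij_betw_W_G bij_betw_same_card by blast

lemma finite_W: "finite (W U)"
  by (rule finite_subset[OF _ card_carrier_vec_finite(2)[of n]]) (auto simp: W_def)

lemma finite_G: "U \<subseteq> M \<Longrightarrow> finite (G U)"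
  using bij_betw_W_G bij_betw_finite finite_W by blast

text \<open>Restricting polynomials over the prime field of degree less than the number of points gives
  sufficiently many Frobenius-equivariant functions.\<close>

lemma card_G_ge:
  assumes "pair_sq_closed U" "U \<subseteq> M" shows "2 ^ card U \<le> card (G U)"
proof -
  define U' where "U' e = {z. (z, e) \<in> U}" for e
  have U'mu: "U' e \<subseteq> mu" for e using assms(2) by (auto simp: U'_def M_def)
  have fin: "finite (U' e)" for e using finite_subset[OF U'mu finite_mu] .
  \<comment> \<open>\<open>B\<close> encodes a polynomial over the prime field by the exponents
    whose coefficient is 1.\<close>
  define f where "f B z = (\<Sum>i\<in>B. z ^ i)" for B :: "nat set" and z :: 'k
  define g where "g = (\<lambda>(B1, B2). \<lambda>(z, e). if (z, e) \<in> U then f (if e then B1 else B2) z else 0)"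
  let ?D = "Pow {..<card (U' True)} \<times> Pow {..<card (U' False)}"
  have f_inj: "B = C" if BC: "B \<subseteq> {..<card (U' e)}" "C \<subseteq> {..<card (U' e)}" "\<And>z. z \<in> U' e \<Longrightarrow> f B z = f C z" for B C e
  proof -
    have ev: "poly (\<Sum>i\<in>B. monom 1 i) z = f B z" for B z by (simp add: poly_sum poly_monom f_def)
    \<comment> \<open>If a component of \<open>U\<close> is empty, no degree can be below 0, but
      then \<open>B\<close> is empty as well.\<close>
    have deg: "degree (\<Sum>i\<in>B. monom (1 :: 'k) i) < card (U' e) \<or> B = {}" if "B \<subseteq> {..<card (U' e)}" for B
    proof (cases "card (U' e)")
      case 0
      then show ?thesis using that by auto
    next
      case (Suc k)
      have "degree (\<Sum>i\<in>B. monom (1 :: 'k) i) \<le> k"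
        using that Suc finite_subset[OF that] by (intro degree_sum_le) (auto simp: degree_monom_eq)
      then show ?thesis using Suc by simp
    qed
    have "(\<Sum>i\<in>B. monom (1 :: 'k) i) = (\<Sum>i\<in>C. monom 1 i)"
    proof (cases "card (U' e) = 0")
      case True
      then show ?thesis using BC by auto
    next
      case False
      then have "degree (\<Sum>i\<in>B. monom (1 :: 'k) i) < card (U' e)" "degree (\<Sum>i\<in>C. monom (1 :: 'k) i) < card (U' e)"
        using deg[OF BC(1)] deg[OF BC(2)] by auto
      then show ?thesis using BC(3) by (intro poly_eqI_degree[of "U' e"]) (simp_all add: ev)
    qed
    then have "coeff (\<Sum>i\<in>B. monom (1 :: 'k) i) k = coeff (\<Sum>i\<in>C. monom 1 i) k" for k by simp
    moreover have "coeff (\<Sum>i\<in>B. monom (1 :: 'k) i) k = of_bool (k \<in> B)" if "finite B" for B k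
    proof -
      have "coeff (\<Sum>i\<in>B. monom (1 :: 'k) i) k = (\<Sum>i\<in>B. if i = k then 1 else 0)" by (simp add: coeff_sum)
      then show ?thesis using that by simp
    qed
    ultimately have "k \<in> B \<longleftrightarrow> k \<in> C" for k
      using BC(1,2) finite_subset by (metis finite_lessThan of_bool_eq_iff)
    then show "B = C" by blast
  qed
  have "g ` ?D \<subseteq> G U"
  proof (rule image_subsetI)
    fix BB assume "BB \<in> ?D"
    have fsq: "f B (z ^ 2) = f B z ^ 2" if "finite B" for B z
      unfolding f_def using that by induction (simp_all add: k_sq_add flip: power_mult, simp add: mult.commute)
    obtain B1 B2 where BB: "BB = (B1, B2)" by (cases BB)
    have finB: "finite B1" "finite B2" using \<open>BB \<in> ?D\<close> finite_subset unfolding BB by auto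
    show "g BB \<in> G U" unfolding G_def frobenius_fun_def g_def BB
      using fsq finB by (auto simp: pair_sq_closed_iff[OF assms])
  qed
  moreover have "inj_on g ?D"
  proof (rule inj_onI)
    fix BB CC assume D: "BB \<in> ?D" "CC \<in> ?D" and eq: "g BB = g CC"
    obtain B1 B2 C1 C2 where BC: "BB = (B1, B2)" "CC = (C1, C2)" by (cases BB, cases CC)
    have "f B1 z = f C1 z" if "z \<in> U' True" for z
      using fun_cong[OF eq, of "(z, True)"] that by (simp add: g_def BC U'_def)
    moreover have "f B2 z = f C2 z" if "z \<in> U' False" for z
      using fun_cong[OF eq, of "(z, False)"] that by (simp add: g_def BC U'_def)
    ultimately show "BB = CC" using f_inj[of B1 True C1] f_inj[of B2 False C2] D unfolding BC by simp
  qed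
  ultimately have "card ?D \<le> card (G U)" using card_inj_on_le finite_G[OF assms(2)] by blast
  moreover have "card ?D = 2 ^ (card (U' True) + card (U' False))"
    by (simp add: card_cartesian_product card_Pow power_add)
  moreover have "card U = card (U' True) + card (U' False)"
  proof -
    have "U = (\<lambda>z. (z, True)) ` U' True \<union> (\<lambda>z. (z, False)) ` U' False"
    proof (rule Set.set_eqI)
      fix m :: "'k \<times> bool"
      obtain z e where "m = (z, e)" by (cases m)
      then show "m \<in> U \<longleftrightarrow> m \<in> (\<lambda>z. (z, True)) ` U' True \<union> (\<lambda>z. (z, False)) ` U' False"
        by (cases e) (auto simp: U'_def)
    qed
    then have "card U = card ((\<lambda>z. (z, True)) ` U' True \<union> (\<lambda>z. (z, False)) ` U' False)" by simp
    also have "\<dots> = card ((\<lambda>z. (z, True)) ` U' True) + card ((\<lambda>z. (z, False)) ` U' False)"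
      using fin by (intro card_Un_disjoint) auto
    also have "\<dots> = card (U' True) + card (U' False)" by (simp add: card_image inj_on_def)
    finally show ?thesis .
  qed
  ultimately show ?thesis by simp
qed

text \<open>A function is the sum of its restrictions to \<open>U\<close> and to the complement.
  Restriction keeps equivariance because membership in \<open>U\<close> is both preserved and
  reflected by squaring.\<close>

lemma card_G_complement:
  assumes "pair_sq_closed U" "U \<subseteq> M" shows "card (G M) = card (G U) * card (G (M - U))"
proof -
  have MU: "m \<notin> U" if "m \<notin> M" for m using that assms(2) by blast
  have "bij_betw (\<lambda>(g, h). \<lambda>m. g m + h m) (G U \<times> G (M - U)) (G M)"
  proof (rule bij_betw_byWitness[where f' = "\<lambda>g. (\<lambda>m. if m \<in> U then g m else 0, \<lambda>m. if m \<in> U then 0 else g m)"])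
    show "\<forall>gh\<in>G U \<times> G (M - U). (\<lambda>g. (\<lambda>m. if m \<in> U then g m else 0, \<lambda>m. if m \<in> U then 0 else g m))
        ((\<lambda>(g, h). \<lambda>m. g m + h m) gh) = gh"
      by (auto simp: G_def fun_eq_iff)
    show "\<forall>g\<in>G M. (\<lambda>(g, h). \<lambda>m. g m + h m) (\<lambda>m. if m \<in> U then g m else 0, \<lambda>m. if m \<in> U then 0 else g m) = g"
      by (auto simp: fun_eq_iff)
    show "(\<lambda>(g, h). \<lambda>m. g m + h m) ` (G U \<times> G (M - U)) \<subseteq> G M"
      using MU by (auto simp: G_def frobenius_fun_def k_sq_add)
    show "(\<lambda>g. (\<lambda>m. if m \<in> U then g m else 0, \<lambda>m. if m \<in> U then 0 else g m)) ` G M \<subseteq> G U \<times> G (M - U)"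
      by (auto simp: G_def frobenius_fun_def pair_sq_closed_iff[OF assms])
  qed
  from bij_betw_same_card[OF this] show ?thesis by (simp add: card_cartesian_product)
qed

text \<open>An element 2s corresponds to the two reductions of s, at v = 0 and v = 1, and all four
  combinations occur.\<close>

lemma card_doubles_z4v: "card ((\<lambda>s. s + s) ` (UNIV :: z4v set)) = 4"
proof -
  have *: "s + s = t + t \<longleftrightarrow> (\<forall>e. phi e s = (phi e t :: 'k))" for s t :: z4v
  proof -
    have pm: "phi e (s - t) = (phi e s - phi e t :: 'k)" for e
      using phi_add[OF two_eq_0, of e "s - t" t] by (simp add: algebra_simps)
    have "s + s = t + t \<longleftrightarrow> (s - t) + (s - t) = 0" by (simp add: algebra_simps)
    also have "\<dots> \<longleftrightarrow> (\<forall>e. phi e (s - t) = (0 :: 'k))"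
    proof
      assume "(s - t) + (s - t) = 0"
      then show "\<forall>e. phi e (s - t) = (0 :: 'k)" using phi_zero_if_double_zero by blast
    next
      assume "\<forall>e. phi e (s - t) = (0 :: 'k)"
      then obtain r where "s - t = r + r" using phi_zero_imp_double[where 'k = 'k] by blast
      then show "(s - t) + (s - t) = 0" using double_double_z4v by simp
    qed
    finally show ?thesis by (simp add: pm)
  qed
  have "\<forall>b :: bool \<Rightarrow> bool. \<exists>r. \<forall>e. phi e r = (of_bool (b e) :: 'k)" using ex_phi by blast
  then obtain R where R: "\<And>b e. phi e (R b) = (of_bool (b e) :: 'k)" by metis
  have "bij_betw (\<lambda>b. R b + R b) (UNIV :: (bool \<Rightarrow> bool) set) ((\<lambda>s. s + s) ` UNIV)"
  proof (rule bij_betw_imageI)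
    show "inj (\<lambda>b. R b + R b)" by (rule injI) (simp only: * R of_bool_eq_iff, blast)
    show "range (\<lambda>b. R b + R b) = range (\<lambda>s. s + s)"
    proof (intro equalityI subsetI)
      fix x :: z4v assume "x \<in> range (\<lambda>s. s + s)"
      then obtain s where s: "x = s + s" by blast
      have "phi e s = (of_bool (phi e s = (1 :: 'k)) :: 'k)" for e by (simp add: phi_def)
      then have "x = R (\<lambda>e. phi e s = (1 :: 'k)) + R (\<lambda>e. phi e s = (1 :: 'k))" unfolding s * R by blast
      then show "x \<in> range (\<lambda>b. R b + R b)" by blast
    qed blast
  qed
  from bij_betw_same_card[OF this] show ?thesis by (simp add: card_fun card_UNIV_bool)
qed

text \<open>With no condition on the spectrum, these are all words with entries in 2R, which has 4
  elements; and |M| = 2n.\<close>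

lemma card_W_M: "card (W M) = 2 ^ card M"
proof -
  have "W M = {v \<in> carrier_vec n. \<forall>i<n. v $ i \<in> range (\<lambda>s. s + s)}"
  proof (intro equalityI subsetI)
    fix v assume "v \<in> W M"
    then obtain p where p: "v = rho (p + p)" unfolding W_def by blast
    have "rc i (p + p) \<in> range (\<lambda>s. s + s)" for i unfolding rc_add by blast
    then show "v \<in> {v \<in> carrier_vec n. \<forall>i<n. v $ i \<in> range (\<lambda>s. s + s)}"
      unfolding p by (simp add: rho_def)
  next
    fix v :: "z4v vec" assume v: "v \<in> {v \<in> carrier_vec n. \<forall>i<n. v $ i \<in> range (\<lambda>s. s + s)}"
    then have "\<exists>s. v $ i = s + s" if "i < n" for i using that by blast
    then obtain s where s: "\<And>i. i < n \<Longrightarrow> v $ i = s i + s i" by metis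
    let ?p = "\<Sum>i<n. monom (s i) i"
    have "v = rho (?p + ?p)"
    proof (rule eq_vecI)
      fix i assume "i < dim_vec (rho (?p + ?p))"
      then have i: "i < n" by (simp add: rho_def)
      then show "v $ i = rho (?p + ?p) $ i" unfolding rho_def by (simp only: index_vec rc_add rc_sum_monom s)
    qed (use v in \<open>simp add: rho_def\<close>)
    then show "v \<in> W M" unfolding W_def by blast
  qed
  also have "card \<dots> = card (range (\<lambda>s :: z4v. s + s)) ^ n"
    by (rule card_vec_entries) simp
  also have "\<dots> = 4 ^ n" by (simp only: card_doubles_z4v)
  also have "\<dots> = 2 ^ card M" by (simp add: card_M power_mult)
  finally show ?thesis .
qed

text \<open>For \<open>U\<close> and \<open>M - U\<close> only lower bounds are available, but their
  product is already the exact value for \<open>M\<close>, so both are sharp.\<close>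

lemma card_W:
  assumes "pair_sq_closed U" "U \<subseteq> M" shows "card (W U) = 2 ^ card U"
proof -
  have cl: "pair_sq_closed (M - U)"
    using pair_sq_closed_iff[OF assms] by (auto simp: pair_sq_closed_def M_def mu_sq)
  have "card (G U) * card (G (M - U)) = 2 ^ card M"
    using card_G_complement[OF assms] card_W_M card_G_eq_card_W[of M] by simp
  also have "card M = card U + card (M - U)"
    using card_Diff_subset[OF finite_subset[OF assms(2) finite_M] assms(2)] card_mono[OF finite_M assms(2)] by simp
  finally have eq: "card (G U) * card (G (M - U)) = 2 ^ card U * 2 ^ card (M - U)" by (simp add: power_add)
  have ge: "2 ^ card U \<le> card (G U)" "2 ^ card (M - U) \<le> card (G (M - U))"
    using card_G_ge[OF assms] card_G_ge[OF cl] by auto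
  have "card (G U) = 2 ^ card U"
  proof (rule ccontr)
    assume "card (G U) \<noteq> 2 ^ card U"
    then have "2 ^ card U < card (G U)" using ge(1) by simp
    then have "2 ^ card U * 2 ^ card (M - U) < card (G U) * card (G (M - U))"
      using ge(2) by (intro mult_less_le_imp_less) auto
    then show False using eq by simp
  qed
  then show ?thesis using card_G_eq_card_W[OF assms(2)] by simp
qed

end

section \<open>Cyclic codes and their hulls\<close>

context odd_length
begin

text \<open>The full preimage in R[x]. For a code it contains the multiples of x^n - 1, so that
  ideals of R[x] stand in for ideals of the quotient ring.\<close>

definition ideal_of :: "z4v vec set \<Rightarrow> z4v poly set" where "ideal_of C = {p. rho p \<in> C}"

text \<open>The colon ideal (I : 2). For the ideal of a code, reducing it modulo 2 gives the torsion
  code, with spectrum T; reducing \<open>I\<close> itself gives the residue code, with spectrum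
  S.\<close>

definition half :: "z4v poly set \<Rightarrow> z4v poly set" where "half I = {p. p + p \<in> I}"

definition spec :: "z4v poly set \<Rightarrow> ('k \<times> bool) set" where
  "spec I = {m \<in> M. \<exists>p\<in>I. hat m p \<noteq> 0}"

lemma cyclic_codeD:
  assumes "cyclic_code n C"
  shows "linear_code n C" "c \<in> C \<Longrightarrow> cyclic_shift n c \<in> C"
  using assms by (auto simp: cyclic_code_def)

lemma poly_ideal_ideal_of:
  assumes "cyclic_code n C" shows "poly_ideal (ideal_of C)"
proof -
  note lin = linear_codeD[OF cyclic_codeD(1)[OF assms]]
  have "rho (q * p) \<in> C" if p: "rho p \<in> C" for p q
  proof (induction q)
    case 0
    then show ?case using lin(2) by simp
  next
    case (pCons a q)
    have "pCons 0 (q * p) = monom 1 1 * (q * p)" by (simp add: monom_altdef)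
    then have "pCons a q * p = smult a p + monom 1 1 * (q * p)" by (simp only: mult_pCons_left)
    then show ?case using pCons.IH p lin cyclic_codeD(2)[OF assms] by (simp only: rho_add rho_smult rho_shift)
  qed
  then show ?thesis unfolding poly_ideal_def ideal_of_def using lin by (simp add: rho_add)
qed

lemma cyclic_code_rho_image:
  assumes "poly_ideal I" shows "cyclic_code n (rho ` I)"
proof -
  note I = poly_idealD[OF assms]
  have "linear_code n (rho ` I)"
    unfolding linear_code_def LinearCombinations.submodule_def module_vec_simps
  proof (intro conjI allI impI)
    show "Module.module class_ring (module_vec TYPE(z4v) n)"
      by unfold_locales (auto simp: module_vec_simps class_ring_simps Units_def add_smult_distrib_vec
        smult_add_distrib_vec intro!: bexI[of _ "- _"])
    show "rho ` I \<subseteq> carrier_vec n" by auto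
    show "0\<^sub>v n \<in> rho ` I" using imageI[OF I(1), of rho] by simp
    show "v + w \<in> rho ` I" if "v \<in> rho ` I" "w \<in> rho ` I" for v w
      using that I(2) by (auto simp flip: rho_add)
    show "c \<cdot>\<^sub>v v \<in> rho ` I" if v: "v \<in> rho ` I" for c v
    proof -
      obtain p where p: "p \<in> I" "v = rho p" using v by blast
      have "smult c p \<in> I" using I(3)[OF p(1), of "[:c:]"] by simp
      then show ?thesis unfolding p(2) rho_smult[symmetric] by (rule imageI)
    qed
  qed
  moreover have "cyclic_shift n c \<in> rho ` I" if "c \<in> rho ` I" for c
    using that I(3) by (auto simp flip: rho_shift)
  ultimately show ?thesis by (simp add: cyclic_code_def)
qed

lemma rho_image_ideal_of:
  assumes "C \<subseteq> carrier_vec n" shows "rho ` ideal_of C = C"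
proof -
  have "c \<in> rho ` ideal_of C" if "c \<in> C" for c
    using that assms rho_vec_poly[of c] unfolding ideal_of_def by (intro image_eqI[of _ _ "vec_poly c"]) auto
  then show ?thesis unfolding ideal_of_def by blast
qed

lemma poly_ideal_half:
  assumes "poly_ideal I" shows "poly_ideal (half I)"
  unfolding poly_ideal_def half_def mem_Collect_eq
proof (intro conjI ballI allI)
  note I = poly_idealD[OF assms]
  show "0 + 0 \<in> I" using I(1) by simp
  fix p assume "p \<in> {p. p + p \<in> I}"
  then have p: "p + p \<in> I" by blast
  have "q * p + q * p = q * (p + p)" for q by (simp only: distrib_left)
  then show "q * p + q * p \<in> I" for q using I(3)[OF p, of q] by (simp only:)
  fix q assume "q \<in> {p. p + p \<in> I}"
  then have q: "q + q \<in> I" by blast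
  have "(p + q) + (p + q) = (p + p) + (q + q)" by (simp only: ac_simps)
  then show "(p + q) + (p + q) \<in> I" using I(2)[OF p q] by (simp only:)
qed

text \<open>The kernel is the ideal of the zero code, so no division by x^n - 1 is required.\<close>

lemma poly_ideal_kernel: "poly_ideal {p. rho p = 0\<^sub>v n}"
proof -
  have "poly_ideal {0}" by (simp add: poly_ideal_def)
  then have "poly_ideal (ideal_of (rho ` {0}))" by (intro poly_ideal_ideal_of cyclic_code_rho_image)
  then show ?thesis by (simp add: ideal_of_def)
qed

lemma rho_eq_iff_diff: "rho p = rho q \<longleftrightarrow> rho (p - q) = 0\<^sub>v n"
proof -
  have "rc l p = rc l q \<longleftrightarrow> rc l (p - q) = 0" for l using rc_add[of l "p - q" q] by simp
  then show ?thesis by (simp add: rho_eq_iff rho_eq_0_iff)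
qed

lemma rho_mult_cong: "rho p = rho q \<Longrightarrow> rho (r * p) = rho (r * q)"
  using poly_idealD(3)[OF poly_ideal_kernel, of "p - q" r] unfolding rho_eq_iff_diff
  by (simp add: right_diff_distrib)

lemma specI: "p \<in> I \<Longrightarrow> m \<in> M \<Longrightarrow> hat m p \<noteq> 0 \<Longrightarrow> m \<in> spec I"
  by (auto simp: spec_def)

lemma spec_subset: "spec I \<subseteq> M" by (auto simp: spec_def)

lemma pair_sq_closed_spec: "pair_sq_closed (spec I)"
  by (auto simp: pair_sq_closed_def spec_def hat_sq M_def mu_sq)

lemma spec_mono: "I \<subseteq> J \<Longrightarrow> spec I \<subseteq> spec J" by (auto simp: spec_def)

lemma ideal_subset_half: "poly_ideal I \<Longrightarrow> I \<subseteq> half I"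
  unfolding half_def using poly_idealD(2) by blast

lemma hat_zero_off_spec: "p \<in> I \<Longrightarrow> m \<in> M \<Longrightarrow> m \<notin> spec I \<Longrightarrow> hat m p = 0"
  by (auto simp: spec_def)

text \<open>For d in the ideal, interpolating the inverse of its spectrum gives g such that g d has
  value 1 exactly where d does not vanish, and 0 elsewhere. Such indicators are combined until they
  cover the finite support.\<close>

lemma ex_spec_indicator:
  assumes "poly_ideal I" shows "\<exists>p\<in>I. \<forall>m\<in>M. hat m p = of_bool (m \<in> spec I)"
proof -
  note I = poly_idealD[OF assms]
  have "\<exists>p\<in>I. (\<forall>m\<in>M. hat m p \<in> {0, 1}) \<and> (\<forall>m\<in>F. hat m p = 1)" if "finite F" "F \<subseteq> spec I" for F
    using that
  proof (induction F rule: finite_induct)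
    case empty
    then show ?case using I(1) by (intro bexI[of _ 0]) auto
  next
    case (insert m F)
    then obtain p where p: "p \<in> I" "\<And>m. m \<in> M \<Longrightarrow> hat m p \<in> {0, 1}" "\<And>m. m \<in> F \<Longrightarrow> hat m p = 1" by auto
    obtain d where d: "d \<in> I" "hat m d \<noteq> 0" using insert.prems by (auto simp: spec_def)
    \<comment> \<open>With inverse 0 = 0 the function is defined and equivariant also at the zeros
      of \<open>d\<close>.\<close>
    have "frobenius_fun (\<lambda>m. inverse (hat m d))" by (simp add: frobenius_fun_def hat_sq power_inverse)
    then obtain g where g: "\<And>m. m \<in> M \<Longrightarrow> hat m g = inverse (hat m d)" using ex_hat_eq by blast
    \<comment> \<open>On 0-1 spectra this is the Boolean union of \<open>p\<close> and
      \<open>g * d\<close>.\<close>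
    define q where "q = p + (1 - p) * (g * d)"
    have q: "hat m' q = hat m' p + (1 - hat m' p) * (inverse (hat m' d) * hat m' d)" if "m' \<in> M" for m'
      using that by (simp add: q_def hat_add hat_mult hat_diff g)
    have "q \<in> I" unfolding q_def by (intro I(2)[OF p(1)] I(3) d(1))
    moreover have "hat m' q \<in> {0, 1}" if "m' \<in> M" for m'
      using p(2)[OF that] q[OF that] by (cases "hat m' d = 0") auto
    moreover have "hat m' q = 1" if "m' \<in> insert m F" for m'
    proof -
      have "m' \<in> M" using that insert.prems spec_subset by blast
      then show ?thesis using q[of m'] p(3)[of m'] d(2) that by auto
    qed
    ultimately show ?case by blast
  qed
  from this[OF finite_subset[OF spec_subset finite_M] subset_refl]
  obtain p where p: "p \<in> I" "\<And>m. m \<in> spec I \<Longrightarrow> hat m p = 1" by blast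
  then have "hat m p = of_bool (m \<in> spec I)" if "m \<in> M" for m
    using hat_zero_off_spec[OF p(1) that] by auto
  then show ?thesis using p(1) by blast
qed

text \<open>If the spectrum of \<open>p\<close> is supported in that of the ideal, multiplying
  \<open>p\<close> by the indicator \<open>e\<close> keeps its spectrum, hence 2p, and moves
  \<open>p\<close> into the ideal.\<close>

lemma doubles_in_ideal:
  assumes "poly_ideal I"
  shows "{rho (p + p) |p. p \<in> I} = W (spec I)"
proof (intro equalityI subsetI)
  fix v assume "v \<in> {rho (p + p) |p. p \<in> I}"
  then show "v \<in> W (spec I)" unfolding W_def using hat_zero_off_spec by blast
next
  fix v assume "v \<in> W (spec I)"
  then obtain p where p: "v = rho (p + p)" "\<And>m. m \<in> M - spec I \<Longrightarrow> hat m p = 0" unfolding W_def by blast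
  obtain e where e: "e \<in> I" "\<And>m. m \<in> M \<Longrightarrow> hat m e = of_bool (m \<in> spec I)" using ex_spec_indicator[OF assms] by blast
  have "hat m (e * p) = hat m p" if "m \<in> M" for m
    using e(2)[OF that] p(2)[of m] that by (auto simp: hat_mult)
  then have "v = rho (e * p + e * p)" unfolding p(1) double_eq_iff by simp
  then show "v \<in> {rho (p + p) |p. p \<in> I}" using poly_idealD(4)[OF assms e(1)] by blast
qed

lemma doubles_code:
  assumes "cyclic_code n C" shows "(\<lambda>c. c + c) ` C = W (spec (ideal_of C))"
proof -
  have "(\<lambda>c. c + c) ` C = (\<lambda>c. c + c) ` rho ` ideal_of C"
    using rho_image_ideal_of linear_codeD(1)[OF cyclic_codeD(1)[OF assms]] by simp
  also have "\<dots> = {rho (p + p) |p. p \<in> ideal_of C}" unfolding image_image rho_add[symmetric] by blast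
  finally show ?thesis by (simp only: doubles_in_ideal[OF poly_ideal_ideal_of[OF assms]])
qed

text \<open>Words killed by 2 are multiples of 2, and the halves of those in the code form the colon
  ideal.\<close>

lemma kernel_code:
  assumes "cyclic_code n C" shows "{c \<in> C. c + c = 0\<^sub>v n} = W (spec (half (ideal_of C)))"
proof -
  have "{c \<in> C. c + c = 0\<^sub>v n} = {rho (p + p) |p. p \<in> half (ideal_of C)}"
  proof (intro equalityI subsetI)
    fix c assume c: "c \<in> {c \<in> C. c + c = 0\<^sub>v n}"
    then obtain p where p: "c = rho p"
      using rho_image_ideal_of linear_codeD(1)[OF cyclic_codeD(1)[OF assms]] by blast
    then have "rho (p + p) = 0\<^sub>v n" using c by (simp only: rho_add mem_Collect_eq)
    then obtain q where "rho p = rho (q + q)" using hats_zero_imp_double hats_zero_iff by metis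
    then show "c \<in> {rho (p + p) |p. p \<in> half (ideal_of C)}"
      using c unfolding p half_def ideal_of_def by auto
  next
    fix c assume "c \<in> {rho (p + p) |p. p \<in> half (ideal_of C)}"
    then obtain p where p: "c = rho (p + p)" "rho (p + p) \<in> C" unfolding half_def ideal_of_def by blast
    have "c + c = rho ((p + p) + (p + p))" by (simp only: p(1) rho_add)
    also have "\<dots> = 0\<^sub>v n" using smult_z4v_four[of p] by simp
    finally show "c \<in> {c \<in> C. c + c = 0\<^sub>v n}" using p by simp
  qed
  then show ?thesis by (simp only: doubles_in_ideal[OF poly_ideal_half[OF poly_ideal_ideal_of[OF assms]]])
qed

lemma card_doubles_code:
  assumes "cyclic_code n C" shows "card ((\<lambda>c. c + c) ` C) = 2 ^ card (spec (ideal_of C))"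
  unfolding doubles_code[OF assms] by (rule card_W[OF pair_sq_closed_spec spec_subset])

text \<open>|C| is |2C| times the size of the kernel of doubling. The detour through
  \<open>vec_poly\<close> places the words in one additive group.\<close>

lemma card_code:
  assumes "cyclic_code n C"
  shows "card C = 2 ^ (card (spec (ideal_of C)) + card (spec (half (ideal_of C))))"
proof -
  note lin = cyclic_codeD(1)[OF assms]
  note sub = linear_codeD(1)[OF lin]
  have inj: "inj_on vec_poly A" if "A \<subseteq> carrier_vec n" for A :: "z4v vec set"
    using that vec_poly_inj by (intro inj_onI) blast
  have vp: "vec_poly (c + c) = vec_poly c + vec_poly c" if "c \<in> C" for c
    using that sub by (intro vec_poly_add) auto
  have CC: "(\<lambda>c. c + c) ` C \<subseteq> carrier_vec n" using sub by auto
  have "(\<lambda>h. h + h) ` vec_poly ` C = vec_poly ` (\<lambda>c. c + c) ` C"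
    unfolding image_image using vp by (intro image_cong) simp_all
  then have 1: "card ((\<lambda>h. h + h) ` vec_poly ` C) = card ((\<lambda>c. c + c) ` C)"
    using card_image[OF inj[OF CC]] by simp
  have "{h \<in> vec_poly ` C. h + h = 0} = vec_poly ` {c \<in> C. c + c = 0\<^sub>v n}"
  proof -
    have "vec_poly c + vec_poly c = 0 \<longleftrightarrow> c + c = 0\<^sub>v n" if "c \<in> C" for c
    proof
      assume "vec_poly c + vec_poly c = 0"
      then have "vec_poly (c + c) = vec_poly (0\<^sub>v n)" using vp[OF that] by simp
      then show "c + c = 0\<^sub>v n" using that CC by (intro vec_poly_inj[of _ n]) auto
    next
      assume "c + c = 0\<^sub>v n"
      then show "vec_poly c + vec_poly c = 0" using vp[OF that] by (metis vec_poly_zero)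
    qed
    then show ?thesis by blast
  qed
  moreover have "{c \<in> C. c + c = 0\<^sub>v n} \<subseteq> carrier_vec n" using sub by blast
  ultimately have 2: "card {h \<in> vec_poly ` C. h + h = 0} = card {c \<in> C. c + c = 0\<^sub>v n}"
    using card_image[OF inj] by simp
  have "card C = card (vec_poly ` C)" using card_image[OF inj[OF sub]] by simp
  also have "\<dots> = card ((\<lambda>c. c + c) ` C) * card {c \<in> C. c + c = 0\<^sub>v n}"
    using card_eq_card_double_times_kernel[OF add_closed_vec_poly[OF lin]] finite_linear_code[OF lin]
    by (simp only: 1 2 finite_imageI)
  also have "card {c \<in> C. c + c = 0\<^sub>v n} = 2 ^ card (spec (half (ideal_of C)))"
    unfolding kernel_code[OF assms] by (rule card_W[OF pair_sq_closed_spec spec_subset])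
  finally show ?thesis unfolding card_doubles_code[OF assms] by (simp only: power_add)
qed

text \<open>The substitution \<open>x \<mapsto> x^(-1)\<close> modulo \<open>x^n - 1\<close>.\<close>

definition star :: "z4v poly \<Rightarrow> z4v poly" where "star p = pcompose p (monom 1 (n - 1))"

lemma star_monom: "star (monom c k) = monom c (k * (n - 1))"
proof (induction k)
  case 0
  then show ?case by (simp add: star_def monom_0)
next
  case (Suc k)
  have "star (monom c (Suc k)) = monom 1 (n - 1) * star (monom c k)"
    by (simp add: star_def monom_Suc pcompose_pCons)
  then show ?case using Suc by (simp add: mult_monom)
qed

lemma star_add: "star (p + q) = star p + star q" by (simp add: star_def pcompose_add)

lemma star_mult: "star (p * q) = star p * star q" by (simp add: star_def pcompose_mult)

text \<open>n - 1 is -1 modulo n, so adding k on both sides clears the product.\<close>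

lemma mod_mult_pred_iff:
  assumes "l < n" shows "(i + k * (n - 1)) mod n = l \<longleftrightarrow> i mod n = (l + k) mod n"
proof -
  have "(i + k * (n - 1)) mod n = l \<longleftrightarrow> [i + k * (n - 1) = l] (mod n)" using assms by (simp add: cong_def)
  also have "\<dots> \<longleftrightarrow> [i + k * (n - 1) + k = l + k] (mod n)" by (rule cong_add_rcancel_nat[symmetric])
  also have "i + k * (n - 1) + k = i + k * n" using n_pos by (cases n) simp_all
  finally show ?thesis by (simp add: cong_def)
qed

lemma rc_star:
  assumes "l < n" shows "rc l (star p) = rc ((n - l) mod n) p"
proof (rule poly_additive_eqI[of "\<lambda>p. rc l (star p)"])
  fix c k
  have "(k * (n - 1)) mod n = l \<longleftrightarrow> [0 = l + k] (mod n)"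
    using mod_mult_pred_iff[OF assms, of 0 k] by (simp add: cong_def)
  also have "\<dots> \<longleftrightarrow> [l + (n - l) = l + k] (mod n)" using assms by (simp add: cong_def)
  also have "\<dots> \<longleftrightarrow> [n - l = k] (mod n)" by (rule cong_add_lcancel_nat)
  finally have "(k * (n - 1)) mod n = l \<longleftrightarrow> k mod n = (n - l) mod n" by (auto simp: cong_def)
  then show "rc l (star (monom c k)) = rc ((n - l) mod n) (monom c k)" by (simp add: star_monom rc_monom)
qed (simp_all add: star_add rc_add)

lemma rho_star_cong: "rho p = rho q \<Longrightarrow> rho (star p) = rho (star q)"
  using n_pos by (simp add: rho_eq_iff rc_star)

lemma rho_star_star: "rho (star (star p)) = rho p"
proof -
  have "(n - (n - l) mod n) mod n = l" if "l < n" for l using that by (cases "l = 0") simp_all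
  then show ?thesis using n_pos by (simp add: rho_eq_iff rc_star)
qed

lemma hat_star:
  assumes "m \<in> M" shows "hat m (star p) = hat (pair_inverse m) p"
proof -
  obtain z e where m: "m = (z, e)" by (cases m)
  then have z: "z \<in> mu" using assms by (simp add: M_def)
  have "z * z ^ (n - 1) = 1" using z n_pos by (simp add: mu_def power_eq_if)
  then have inv: "z ^ (n - 1) = inverse z" by (metis inverse_unique)
  have "hat (z, e) (star p) = hat (inverse z, e) p"
  proof (rule poly_additive_eqI[of "\<lambda>p. hat (z, e) (star p)"])
    fix c k
    have "z ^ (k * (n - 1)) = inverse z ^ k" unfolding inv[symmetric] by (simp add: mult.commute flip: power_mult)
    then show "hat (z, e) (star (monom c k)) = hat (inverse z, e) (monom c k)" by (simp add: star_monom hat_monom)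
  qed (simp_all add: star_add hat_add)
  then show ?thesis by (simp add: m)
qed

text \<open>The constant coefficient of p(x) q(x^-1) modulo x^n - 1 collects the products of
  coefficients at equal positions. Both sides are biadditive, so monomials suffice.\<close>

lemma scalar_prod_rho: "rho p \<bullet> rho q = rc 0 (p * star q)"
proof -
  have "rho p \<bullet> rho q = (\<Sum>l<n. rc l p * rc l q)"
    by (simp add: scalar_prod_def rho_def lessThan_atLeast0)
  also have "\<dots> = rc 0 (p * star q)"
  proof (rule poly_additive_eqI[of "\<lambda>p. \<Sum>l<n. rc l p * rc l q"])
    fix a i
    show "(\<Sum>l<n. rc l (monom a i) * rc l q) = rc 0 (monom a i * star q)"
    proof (rule poly_additive_eqI[of "\<lambda>q. \<Sum>l<n. rc l (monom a i) * rc l q"])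
      fix b k
      have "(\<Sum>l<n. rc l (monom a i) * rc l (monom b k)) =
          (\<Sum>l<n. if l = i mod n then (if i mod n = k mod n then a * b else 0) else 0)"
        by (intro sum.cong) (auto simp: rc_monom)
      also have "\<dots> = (if i mod n = k mod n then a * b else 0)" using n_pos by simp
      finally show "(\<Sum>l<n. rc l (monom a i) * rc l (monom b k)) = rc 0 (monom a i * star (monom b k))"
        using mod_mult_pred_iff[OF n_pos, of i k] by (simp add: star_monom mult_monom rc_monom)
    qed (simp_all add: rc_add star_add distrib_left sum.distrib)
  qed (simp_all add: rc_add distrib_right sum.distrib)
  finally show ?thesis .
qed

text \<open>Multiplication by x^-l, written with a nonnegative exponent, moves coefficient l to
  position 0.\<close>

lemma rc_0_shift: "l < n \<Longrightarrow> rc 0 (monom 1 (l * (n - 1)) * p) = rc l p"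
proof (rule poly_additive_eqI[of "\<lambda>p. rc 0 (monom 1 (l * (n - 1)) * p)"])
  fix c i assume "l < n"
  then show "rc 0 (monom 1 (l * (n - 1)) * monom c i) = rc l (monom c i)"
    using mod_mult_pred_iff[OF n_pos, of i l] by (simp add: mult_monom rc_monom add.commute)
qed (simp_all add: rc_add distrib_left)

text \<open>Testing p against all shifts x^l q of one codeword kills every coefficient of p(x)
  q(x^-1), not only the constant one.\<close>

lemma rho_in_dual_iff:
  assumes "cyclic_code n C"
  shows "rho p \<in> dual_code n C \<longleftrightarrow> (\<forall>q\<in>ideal_of C. rho (p * star q) = 0\<^sub>v n)"
proof
  assume dual: "rho p \<in> dual_code n C"
  show "\<forall>q\<in>ideal_of C. rho (p * star q) = 0\<^sub>v n"
  proof
    fix q assume q: "q \<in> ideal_of C"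
    have "rc l (p * star q) = 0" if "l < n" for l
    proof -
      have "rho (monom 1 l * q) \<in> C"
        using poly_idealD(3)[OF poly_ideal_ideal_of[OF assms] q, of "monom 1 l"] by (simp add: ideal_of_def)
      then have "rho p \<bullet> rho (monom 1 l * q) = 0" using dual by (simp add: dual_code_def)
      then have "rc 0 (p * (monom 1 (l * (n - 1)) * star q)) = 0"
        by (simp only: scalar_prod_rho star_mult star_monom)
      then show ?thesis using rc_0_shift[OF that, of "p * star q"] by (simp only: mult.left_commute[of p])
    qed
    then show "rho (p * star q) = 0\<^sub>v n" by (simp add: rho_eq_0_iff)
  qed
next
  assume zero: "\<forall>q\<in>ideal_of C. rho (p * star q) = 0\<^sub>v n"
  have "rho p \<bullet> c = 0" if c: "c \<in> C" for c
  proof -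
    obtain q where q: "q \<in> ideal_of C" "c = rho q"
      using c rho_image_ideal_of linear_codeD(1)[OF cyclic_codeD(1)[OF assms]] by blast
    then have "rc 0 (p * star q) = 0" using zero n_pos by (simp add: rho_eq_0_iff)
    then show ?thesis by (simp only: q(2) scalar_prod_rho)
  qed
  then show "rho p \<in> dual_code n C" by (simp add: dual_code_def)
qed

section \<open>The hull and its two spectra\<close>

lemma ideal_of_Hull:
  assumes "cyclic_code n C"
  shows "ideal_of (Hull n C) = {p \<in> ideal_of C. \<forall>q\<in>ideal_of C. rho (p * star q) = 0\<^sub>v n}"
  using rho_in_dual_iff[OF assms] by (auto simp: ideal_of_def Hull_def)

lemma cyclic_code_Hull:
  assumes "cyclic_code n C" shows "cyclic_code n (Hull n C)"
proof -
  note I = poly_idealD[OF poly_ideal_ideal_of[OF assms]]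
  note K = poly_idealD[OF poly_ideal_kernel, unfolded mem_Collect_eq]
  have "poly_ideal (ideal_of (Hull n C))"
    unfolding ideal_of_Hull[OF assms] poly_ideal_def
    using I(1-3) K(1-3) by (simp add: distrib_right mult.assoc)
  then have "cyclic_code n (rho ` ideal_of (Hull n C))" by (rule cyclic_code_rho_image)
  moreover have "Hull n C \<subseteq> carrier_vec n" by (auto simp: Hull_def dual_code_def)
  ultimately show ?thesis by (simp only: rho_image_ideal_of)
qed

lemma double_mult: "p * q + p * q = p * (q + q)" "p * q + p * q = (p + p) * q" for p q :: "z4v poly"
  by (simp_all only: distrib_left distrib_right)

text \<open>Orthogonality of 2p is an equation between multiples of 2, hence purely spectral: at
  each point m the value of p at m times that of q at the inverse of m must vanish. An element with
  the required support is an indicator from the half ideal cut down by an interpolated one.\<close>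

lemma spec_half_Hull:
  assumes "cyclic_code n C"
  shows "spec (half (ideal_of (Hull n C))) =
    spec (half (ideal_of C)) - pair_inverse ` spec (ideal_of C)"
proof -
  let ?I = "ideal_of C"
  note idl = poly_ideal_ideal_of[OF assms]
  note I = poly_idealD[OF idl]
  have half_iff: "p \<in> half (ideal_of (Hull n C)) \<longleftrightarrow>
      p \<in> half ?I \<and> (\<forall>q\<in>?I. \<forall>m\<in>M. hat m p * hat (pair_inverse m) q = 0)" for p
  proof -
    have "rho ((p + p) * star q) = 0\<^sub>v n \<longleftrightarrow> (\<forall>m\<in>M. hat m p * hat (pair_inverse m) q = 0)" for q
      unfolding double_mult(2)[symmetric] hats_zero_iff[symmetric] by (simp add: hat_mult hat_star)
    then show ?thesis unfolding half_def ideal_of_Hull[OF assms] by simp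
  qed
  show ?thesis
  proof (intro equalityI subsetI)
    fix m assume "m \<in> spec (half (ideal_of (Hull n C)))"
    then obtain p where p: "m \<in> M" "p \<in> half (ideal_of (Hull n C))" "hat m p \<noteq> 0" unfolding spec_def by blast
    then have "m \<in> spec (half ?I)" unfolding spec_def half_iff by blast
    moreover have "pair_inverse m \<notin> spec ?I" using p unfolding half_iff spec_def by auto
    ultimately show "m \<in> spec (half ?I) - pair_inverse ` spec ?I" by (simp add: mem_pair_inverse_image_iff)
  next
    fix m assume m: "m \<in> spec (half ?I) - pair_inverse ` spec ?I"
    define A where "A = spec (half ?I) - pair_inverse ` spec ?I"
    obtain f where f: "f \<in> half ?I" "\<And>m. m \<in> M \<Longrightarrow> hat m f = of_bool (m \<in> spec (half ?I))"
      using ex_spec_indicator[OF poly_ideal_half[OF idl]] by blast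
    have "pair_sq_closed A" "A \<subseteq> M"
      using spec_subset pair_sq_closed_iff[OF pair_sq_closed_spec spec_subset]
      unfolding A_def pair_sq_closed_def by (auto simp: mem_pair_inverse_image_iff simp flip: power_inverse)
    then obtain g where g: "\<And>m. m \<in> M \<Longrightarrow> hat m g = of_bool (m \<in> A)" using ex_hat_indicator by blast
    have "hat m' (g * f) * hat (pair_inverse m') q = 0" if "q \<in> ?I" "m' \<in> M" for q m'
    proof (cases "m' \<in> A")
      case True
      then have "pair_inverse m' \<notin> spec ?I" by (simp add: A_def mem_pair_inverse_image_iff)
      then show ?thesis using hat_zero_off_spec[OF that(1) M_inverse[OF that(2)]] by simp
    next
      case False
      then show ?thesis using g[OF that(2)] by (simp add: hat_mult)
    qed
    then have "g * f \<in> half (ideal_of (Hull n C))"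
      unfolding half_iff using poly_idealD(3)[OF poly_ideal_half[OF idl] f(1)] by blast
    moreover have mM: "m \<in> M" using m spec_subset by blast
    moreover have "hat m (g * f) \<noteq> 0" using m f(2)[OF mM] g[OF mM] by (simp add: hat_mult A_def)
    ultimately show "m \<in> spec (half (ideal_of (Hull n C)))" by (rule specI)
  qed
qed

text \<open>Squares lift idempotents along the reduction modulo 2: if \<open>c^2 = c + 2u\<close>, then
  \<open>c^4 = (c + 2u)^2 = c^2\<close>.\<close>

lemma rho_square_idem:
  assumes "\<And>m. m \<in> M \<Longrightarrow> hat m c \<in> {0, 1}"
  shows "rho ((c * c) * (c * c)) = rho (c * c)"
proof -
  have "hat m (c * c - c) = 0" if "m \<in> M" for m
    using assms[OF that] by (auto simp: hat_diff hat_mult)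
  then obtain u where u: "rho (c * c - c) = rho (u + u)" using hats_zero_imp_double by blast
  have "c * c = (c * c - c) + c" by simp
  then have "rho (c * c) = rho (c * c - c) + rho c" by (metis rho_add)
  also have "\<dots> = rho (c + (u + u))" unfolding u rho_add[symmetric] by (simp only: add.commute)
  finally have cc: "rho (c * c) = rho (c + (u + u))" .
  have "rho ((c * c) * (c * c)) = rho ((c * c) * (c + (u + u)))" by (rule rho_mult_cong[OF cc])
  also have "\<dots> = rho ((c + (u + u)) * (c * c))" by (simp only: mult.commute)
  also have "\<dots> = rho ((c + (u + u)) * (c + (u + u)))" by (rule rho_mult_cong[OF cc])
  also have "(c + (u + u)) * (c + (u + u)) = c * c + ((c * u + u * u) + (c * u + u * u) + ((c * u + u * u) + (c * u + u * u)))"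
    by (simp add: algebra_simps)
  also have "\<dots> = c * c" by (simp only: smult_z4v_four add_0_right)
  finally show ?thesis .
qed

text \<open>If p is in the hull and 2t in the code, then 2 p star(t) = 0, which gives one inclusion.
  The other needs a word orthogonal to the code modulo 4: an idempotent lift e of the indicator of
  \<open>A\<close>. By spectra e star(q) = 2u; as 2 star(u) = star(e) q is in the ideal, star(u) is
  in its half, so e u has zero spectrum; and idempotence gives e star(q) = 2 e u = 0.\<close>

lemma spec_Hull:
  assumes "cyclic_code n C"
  shows "spec (ideal_of (Hull n C)) =
    spec (ideal_of C) - pair_inverse ` spec (half (ideal_of C))"
proof -
  let ?I = "ideal_of C"
  note idl = poly_ideal_ideal_of[OF assms]
  note I = poly_idealD[OF idl]
  show ?thesis
  proof (intro equalityI subsetI)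
    fix m assume "m \<in> spec (ideal_of (Hull n C))"
    then obtain p where p: "m \<in> M" "p \<in> ?I" "\<And>q. q \<in> ?I \<Longrightarrow> rho (p * star q) = 0\<^sub>v n" "hat m p \<noteq> 0"
      unfolding spec_def ideal_of_Hull[OF assms] by blast
    have "pair_inverse m \<notin> spec (half ?I)"
    proof
      assume "pair_inverse m \<in> spec (half ?I)"
      then obtain t where t: "t + t \<in> ?I" "hat (pair_inverse m) t \<noteq> 0" unfolding spec_def half_def by blast
      have "rho (p * star t + p * star t) = 0\<^sub>v n"
        using p(3)[OF t(1)] by (simp only: star_add double_mult(1))
      then have "hat m (p * star t) = 0" using hats_zero_iff p(1) by blast
      then show False using p(1,4) t(2) by (simp add: hat_mult hat_star)
    qed
    moreover have "m \<in> spec ?I" using p unfolding spec_def by blast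
    ultimately show "m \<in> spec ?I - pair_inverse ` spec (half ?I)" by (simp add: mem_pair_inverse_image_iff)
  next
    fix m assume m: "m \<in> spec ?I - pair_inverse ` spec (half ?I)"
    define A where "A = spec ?I - pair_inverse ` spec (half ?I)"
    obtain f where f: "f \<in> ?I" "\<And>m. m \<in> M \<Longrightarrow> hat m f = of_bool (m \<in> spec ?I)"
      using ex_spec_indicator[OF idl] by blast
    have "pair_sq_closed A" "A \<subseteq> M"
      using spec_subset pair_sq_closed_iff[OF pair_sq_closed_spec spec_subset]
      unfolding A_def pair_sq_closed_def by (auto simp: mem_pair_inverse_image_iff simp flip: power_inverse)
    then obtain g where g: "\<And>m. m \<in> M \<Longrightarrow> hat m g = of_bool (m \<in> A)" using ex_hat_indicator by blast
    define c where "c = g * f"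
    define e where "e = c * c"
    have hat_c: "hat m c = of_bool (m \<in> A)" if "m \<in> M" for m
      using f(2)[OF that] g[OF that] by (auto simp: c_def hat_mult A_def)
    have hat_e: "hat m e = of_bool (m \<in> A)" if "m \<in> M" for m
      using hat_c[OF that] by (simp add: e_def hat_mult)
    have e_I: "e \<in> ?I" unfolding e_def c_def using I(3) f(1) by blast
    have idem: "rho (e * e) = rho e" unfolding e_def by (rule rho_square_idem) (simp add: hat_c)
    have "rho (e * star q) = 0\<^sub>v n" if q: "q \<in> ?I" for q
    proof -
      have "hat m (e * star q) = 0" if mM: "m \<in> M" for m
      proof (cases "m \<in> A")
        case True
        then have "pair_inverse m \<notin> spec (half ?I)" by (simp add: A_def mem_pair_inverse_image_iff)
        then have "pair_inverse m \<notin> spec ?I" using spec_mono[OF ideal_subset_half[OF idl]] by blast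
        then show ?thesis using hat_zero_off_spec[OF q M_inverse[OF mM]] mM by (simp add: hat_mult hat_star)
      next
        case False
        then show ?thesis using hat_e[OF mM] by (simp add: hat_mult)
      qed
      then obtain u where u: "rho (e * star q) = rho (u + u)" using hats_zero_imp_double by blast
      have "rho (star u + star u) = rho (star (e * star q))"
        unfolding star_add[symmetric] by (rule rho_star_cong[OF u[symmetric]])
      also have "\<dots> = rho (star e * q)"
        unfolding star_mult by (rule rho_mult_cong[OF rho_star_star])
      finally have star_u: "star u \<in> half ?I"
        using I(3)[OF q, of "star e"] unfolding half_def ideal_of_def by simp
      have "hat m (e * u) = 0" if mM: "m \<in> M" for m
      proof (cases "m \<in> A")
        case True
        then have "pair_inverse m \<notin> spec (half ?I)" by (simp add: A_def mem_pair_inverse_image_iff)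
        then have "hat (pair_inverse m) (star u) = 0"
          by (rule hat_zero_off_spec[OF star_u M_inverse[OF mM]])
        then show ?thesis using hat_star[OF M_inverse[OF mM], of u] by (simp add: hat_mult)
      next
        case False
        then show ?thesis using hat_e[OF mM] by (simp add: hat_mult)
      qed
      then have "rho (e * u + e * u) = 0\<^sub>v n" using hats_zero_iff by blast
      moreover have "rho (e * star q) = rho (e * u + e * u)"
      proof -
        have "rho (e * star q) = rho (star q * (e * e))"
          using rho_mult_cong[OF idem, of "star q"] by (simp only: mult.commute)
        also have "star q * (e * e) = e * (e * star q)" by (simp only: mult_ac)
        also have "rho (e * (e * star q)) = rho (e * (u + u))" by (rule rho_mult_cong[OF u])
        finally show ?thesis by (simp only: double_mult(1))
      qed
      ultimately show ?thesis by simp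
    qed
    then have "e \<in> ideal_of (Hull n C)" unfolding ideal_of_Hull[OF assms] using e_I by blast
    moreover have mM: "m \<in> M" using m spec_subset by blast
    moreover have "hat m e \<noteq> 0" using hat_e[OF mM] m by (simp add: A_def)
    ultimately show "m \<in> spec (ideal_of (Hull n C))" by (rule specI)
  qed
qed

text \<open>The code is generated by \<open>e\<close>, an idempotent lift of the indicator of
  \<open>S\<close>, and by 2f, where \<open>f\<close> has the indicator of \<open>T\<close> as
  spectrum.\<close>

lemma ex_code_of_spec:
  assumes S: "pair_sq_closed S" and T: "pair_sq_closed T" and ST: "S \<subseteq> T" and TM: "T \<subseteq> M"
  shows "\<exists>C. cyclic_code n C \<and> spec (ideal_of C) = S \<and> spec (half (ideal_of C)) = T"
proof -
  have SM: "S \<subseteq> M" using ST TM by blast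
  obtain c where c: "\<And>m. m \<in> M \<Longrightarrow> hat m c = of_bool (m \<in> S)" using ex_hat_indicator[OF S SM] by blast
  obtain f where f: "\<And>m. m \<in> M \<Longrightarrow> hat m f = of_bool (m \<in> T)" using ex_hat_indicator[OF T TM] by blast
  define e where "e = c * c"
  have hat_e: "hat m e = of_bool (m \<in> S)" if "m \<in> M" for m using c[OF that] by (simp add: e_def hat_mult)
  have idem: "rho (e * e) = rho e" unfolding e_def by (rule rho_square_idem) (simp add: c)
  define J where "J = {e * a + (f * b + f * b) |a b. True}"
  have J: "poly_ideal J"
    unfolding poly_ideal_def
  proof (intro conjI ballI allI)
    show "0 \<in> J" unfolding J_def by (intro CollectI exI[of _ 0]) simp
    fix p assume "p \<in> J"
    then obtain a b where p: "p = e * a + (f * b + f * b)" unfolding J_def by blast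
    have "q * p = e * (q * a) + (f * (q * b) + f * (q * b))" for q by (simp add: p algebra_simps)
    then show "q * p \<in> J" for q unfolding J_def by blast
    fix q assume "q \<in> J"
    then obtain a' b' where q: "q = e * a' + (f * b' + f * b')" unfolding J_def by blast
    have "p + q = e * (a + a') + (f * (b + b') + f * (b + b'))" by (simp add: p q algebra_simps)
    then show "p + q \<in> J" unfolding J_def by blast
  qed
  define C where "C = rho ` J"
  have cyc: "cyclic_code n C" unfolding C_def by (rule cyclic_code_rho_image[OF J])
  have IC: "\<exists>a b. rho p = rho (e * a + (f * b + f * b))" if "p \<in> ideal_of C" for p
    using that unfolding ideal_of_def C_def J_def by blast
  have JI: "J \<subseteq> ideal_of C" unfolding ideal_of_def C_def by blast
  have hatJ: "hat m (e * a + (f * b + f * b)) = of_bool (m \<in> S) * hat m a" if "m \<in> M" for m a b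
    by (simp only: hat_add[of m "e * a"] hat_double hat_mult hat_e[OF that] add_0_right)
  have "spec (ideal_of C) = S"
  proof (intro equalityI subsetI)
    fix m assume "m \<in> spec (ideal_of C)"
    then obtain p where p: "m \<in> M" "p \<in> ideal_of C" "hat m p \<noteq> 0" unfolding spec_def by blast
    obtain a b where "rho p = rho (e * a + (f * b + f * b))" using IC[OF p(2)] by blast
    then have "hat m p = of_bool (m \<in> S) * hat m a"
      using hat_cong_rho[OF p(1)] hatJ[OF p(1)] by metis
    then show "m \<in> S" using p(3) by auto
  next
    fix m assume m: "m \<in> S"
    have "e * 1 + (f * 0 + f * 0) \<in> J" unfolding J_def by blast
    then have "e \<in> ideal_of C" using JI by auto
    then show "m \<in> spec (ideal_of C)" using m SM hat_e[of m] by (intro specI[of e]) auto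
  qed
  moreover have "spec (half (ideal_of C)) = T"
  proof (intro equalityI subsetI)
    fix m assume "m \<in> spec (half (ideal_of C))"
    then obtain p where p: "m \<in> M" "p + p \<in> ideal_of C" "hat m p \<noteq> 0" unfolding spec_def half_def by blast
    obtain a b where ab: "rho (p + p) = rho (e * a + (f * b + f * b))" using IC[OF p(2)] by blast
    have "hat m' (e * a) = 0" if "m' \<in> M" for m'
      using hat_cong_rho[OF that ab] hatJ[OF that, of a b] hat_double[of m' p] hat_e[OF that] by (simp add: hat_mult)
    then obtain u where u: "rho (e * a) = rho (u + u)" using hats_zero_imp_double by blast
    \<comment> \<open>The spectrum of \<open>u\<close> is unknown, but idempotence replaces it: e a
      = e (e a) = 2 e u, and the half \<open>e * u\<close> is supported in \<open>S\<close>.\<close>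
    have "rho (e * a) = rho (a * (e * e))"
      using rho_mult_cong[OF idem, of a] by (simp only: mult.commute)
    also have "a * (e * e) = e * (e * a)" by (simp only: mult_ac)
    also have "rho (e * (e * a)) = rho (e * (u + u))" by (rule rho_mult_cong[OF u])
    finally have "rho (p + p) = rho ((e * u + f * b) + (e * u + f * b))"
      unfolding ab rho_add[of "e * a"] by (simp only: rho_add[symmetric] distrib_left add_ac)
    then have "hat m p = hat m (e * u + f * b)" using double_eq_iff p(1) by blast
    then have "hat m e \<noteq> 0 \<or> hat m f \<noteq> 0" using p(3) by (auto simp: hat_add hat_mult)
    then show "m \<in> T" using hat_e[OF p(1)] f[OF p(1)] ST by (auto split: if_splits)
  next
    fix m assume m: "m \<in> T"
    have "e * 0 + (f * 1 + f * 1) \<in> J" unfolding J_def by blast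
    then have "f + f \<in> ideal_of C" using JI by auto
    then have "f \<in> half (ideal_of C)" unfolding half_def by blast
    then show "m \<in> spec (half (ideal_of C))" using m TM f[of m] by (intro specI[of f]) auto
  qed
  ultimately show ?thesis using cyc by blast
qed

section \<open>From spectra to types\<close>

lemma of_type_Hull_iff:
  assumes "cyclic_code n C"
  defines "S \<equiv> spec (ideal_of C)" and "T \<equiv> spec (half (ideal_of C))"
  shows "of_type n (Hull n C) k1 k2 \<longleftrightarrow>
    card (S - pair_inverse ` T) = k1 \<and> card (T - pair_inverse ` S) = k1 + k2"
proof -
  note H = cyclic_code_Hull[OF assms(1)]
  let ?a = "card (S - pair_inverse ` T)" and ?b = "card (T - pair_inverse ` S)"
  have "card ((\<lambda>c. c + c) ` Hull n C) = 2 ^ ?a" "card (Hull n C) = 2 ^ (?a + ?b)"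
    using card_doubles_code[OF H] card_code[OF H] spec_Hull[OF assms(1)] spec_half_Hull[OF assms(1)]
    by (simp_all add: S_def T_def)
  moreover have "4 ^ k1 * 2 ^ k2 = (2 :: nat) ^ (k1 + (k1 + k2))"
    by (simp add: power_add flip: power_mult_distrib)
  ultimately show ?thesis
    unfolding of_type_iff_cards[OF cyclic_codeD(1)[OF H]] by (auto simp only: power_inject_exp one_less_numeral_iff semiring_norm add_left_cancel)
qed

lemma hull_types_eq:
  "{(k1, k2). \<exists>C. cyclic_code n C \<and> of_type n (Hull n C) k1 k2} = hull_types n"
proof -
  have "(\<exists>C. cyclic_code n C \<and> of_type n (Hull n C) k1 k2) \<longleftrightarrow> (k1, k2) \<in> hull_types n" for k1 k2
  proof
    assume "\<exists>C. cyclic_code n C \<and> of_type n (Hull n C) k1 k2"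
    then obtain C where C: "cyclic_code n C" "of_type n (Hull n C) k1 k2" by blast
    show "(k1, k2) \<in> hull_types n"
      unfolding hull_types_iff[OF n_pos odd_n two_eq_0] mu_def[symmetric] M_def[symmetric]
      using C(2)[unfolded of_type_Hull_iff[OF C(1)]] pair_sq_closed_spec spec_subset
        spec_mono[OF ideal_subset_half[OF poly_ideal_ideal_of[OF C(1)]]]
      by blast
  next
    assume "(k1, k2) \<in> hull_types n"
    then obtain S T :: "('k \<times> bool) set" where ST: "pair_sq_closed S" "pair_sq_closed T" "S \<subseteq> T" "T \<subseteq> M"
      "card (S - pair_inverse ` T) = k1" "card (T - pair_inverse ` S) = k1 + k2"
      unfolding hull_types_iff[OF n_pos odd_n two_eq_0] mu_def[symmetric] M_def[symmetric] by blast
    obtain C where "cyclic_code n C" "spec (ideal_of C) = S" "spec (half (ideal_of C)) = T"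
      using ex_code_of_spec[OF ST(1-4)] by blast
    then show "\<exists>C. cyclic_code n C \<and> of_type n (Hull n C) k1 k2"
      using of_type_Hull_iff ST(5,6) by blast
  qed
  then show ?thesis by auto
qed

end

theorem theorem4p2:
  fixes n :: nat
  assumes "n > 0" and "odd n"
  shows "(\<forall>C. cyclic_code n C \<longrightarrow> (\<exists>k1 k2. of_type n (Hull n C) k1 k2)) \<and>
    {(k1, k2). \<exists>C. cyclic_code n C \<and> of_type n (Hull n C) k1 k2} =
    {(k1, k2). \<exists>a1 a2 b1 b2 c1 c2 :: nat \<Rightarrow> nat.
       (\<forall>j. j dvd n \<and> j \<notin> N2 \<longrightarrow>
          a1 j \<le> beta j \<and> a2 j \<le> beta j \<and>
          c1 j \<le> 2 * (beta j - a1 j) \<and> c2 j \<le> 2 * (beta j - a2 j)) \<and>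
       (\<forall>j. j dvd n \<and> j \<in> N2 \<longrightarrow> b1 j \<le> gamma j \<and> b2 j \<le> gamma j) \<and>
       k1 = (\<Sum>j | j dvd n \<and> j \<notin> N2. ord j 2 * a1 j)
          + (\<Sum>j | j dvd n \<and> j \<notin> N2. ord j 2 * a2 j) \<and>
       k2 = (\<Sum>j | j dvd n \<and> j \<in> N2. ord j 2 * b1 j)
          + (\<Sum>j | j dvd n \<and> j \<in> N2. ord j 2 * b2 j)
          + (\<Sum>j | j dvd n \<and> j \<notin> N2. ord j 2 * c1 j)
          + (\<Sum>j | j dvd n \<and> j \<notin> N2. ord j 2 * c2 j)}"
proof -
  \<comment> \<open>Any algebraically closed field of characteristic 2 would serve to host the
    spectra.\<close>
  have "(2 :: bit alg_closure) = 0" by (metis bit_2_eq_0 to_ac_0 to_ac_numeral)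
  then interpret odd_length n "TYPE(bit alg_closure)" using assms by unfold_locales
  have "\<exists>k1 k2. of_type n (Hull n C) k1 k2" if "cyclic_code n C" for C
    using ex_of_type[OF cyclic_codeD(1)[OF cyclic_code_Hull[OF that]]] .
  then show ?thesis using hull_types_eq unfolding hull_types_def by blast
qed

end
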